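(* Let $F$ be an exponential field, let $p\in F$ be exponentially transcendental in $F$, and let $\bar x=(x_1,\dots,x_n)\in F^n$ be such that $\exp(\bar x)=(\exp(x_1),\dots,\exp(x_n))$ is multiplicatively independent. Then \[\operatorname{td}(\exp(\bar x),\exp(p\bar x)/p)\ge n,\] where $\exp(p\bar x)=(\exp(px_1),\dots,\exp(px_n))$.
   Context: An exponential field is a field $F$ of characteristic zero with a homomorphism $\exp$ from $(F,+)$ to $(F^\times,\cdot)$. An element $x\in F$ is exponentially algebraic in $F$ if there are $k\in\mathbb{N}$, $\bar x=(x_1,\dots,x_k)\in F^k$ with $x=x_1$, and exponential polynomials $f_1,\dots,f_k\in\mathbb{Z}[X_1,\dots,X_k,e^{X_1},\dots,e^{X_k}]$ such that $f_i(\bar x,\exp(\bar x))=0$ for all $i$ and the Jacobian determinant $\det\big(\partial f_i/\partial X_j\big)_{i,j}$ (with $\partial e^{X_j}/\partial X_j=e^{X_j}$) is nonzero at $\bar x$; otherwise $x$ is exponentially transcendental. For subsets $X,Y$, $\operatorname{td}(X/Y)$ is the transcendence degree of $\mathbb{Q}(X,Y)$ over $\mathbb{Q}(Y)$. A tuple $(a_1,\dots,a_n)$ is multiplicatively independent if $\prod a_i^{m_i}=1$ with $m_i\in\mathbb{Z}$ implies all $m_i=0$. *)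

theory Defs
  imports
    "HOL-Library.Extended_Nat"
    "HOL-Library.Poly_Mapping"
    "Jordan_Normal_Form.Determinant"
begin

text \<open>
  A polynomial with coefficients in \<open>'c\<close> and indeterminates in \<open>'v\<close> is a finitely supported
  map from monomials (finitely supported exponent maps \<open>'v \<Rightarrow>\<^sub>0 nat\<close>) to coefficients; its ring
  structure is the convolution one of Poly_Mapping.
\<close>

type_synonym ('v, 'c) mpol = "('v \<Rightarrow>\<^sub>0 nat) \<Rightarrow>\<^sub>0 'c"

definition mpol_indets :: "('v, 'c::zero) mpol \<Rightarrow> 'v set" where
  "mpol_indets f = (\<Union>m\<in>Poly_Mapping.keys f. Poly_Mapping.keys m)"

definition mpol_eval :: "('c::zero \<Rightarrow> 'a::comm_ring_1) \<Rightarrow> ('v \<Rightarrow> 'a) \<Rightarrow> ('v, 'c) mpol \<Rightarrow> 'a" where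
  "mpol_eval h a f =
     (\<Sum>m\<in>Poly_Mapping.keys f.
        h (Poly_Mapping.lookup f m) *
        (\<Prod>v\<in>Poly_Mapping.keys m. a v ^ Poly_Mapping.lookup m v))"

text \<open>
  Formal partial derivative. In a monomial not containing \<open>v\<close> the exponent subtraction is
  truncated, but the coefficient is then multiplied by \<open>0\<close>.
\<close>

definition mpol_pderiv :: "'v \<Rightarrow> ('v, 'c::comm_ring_1) mpol \<Rightarrow> ('v, 'c) mpol" where
  "mpol_pderiv v f =
     (\<Sum>m\<in>Poly_Mapping.keys f.
        Poly_Mapping.single (m - Poly_Mapping.single v 1)
          (of_nat (Poly_Mapping.lookup m v) * Poly_Mapping.lookup f m))"

locale exponential_field =
  fixes E :: "'a::field_char_0 \<Rightarrow> 'a"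
  assumes E_add: "E (x + y) = E x * E y"
    and E_nonzero: "E x \<noteq> 0"

text \<open>
  Exponential polynomials over \<open>\<int>\<close> are the elements of
  \<open>\<int>[X\<^sub>0, \<dots>, X\<^bsub>k-1\<^esub>, e\<^bsup>X\<^sub>0\<^esup>, \<dots>, e\<^bsup>X\<^bsub>k-1\<^esub>\<^esup>]\<close>, with \<open>X\<^sub>j\<close> (\<open>IVar j\<close>) and \<open>e\<^bsup>X\<^sub>j\<^esup>\<close> (\<open>IExp j\<close>)
  independent indeterminates.
\<close>

datatype exp_indet = IVar nat | IExp nat

type_synonym exp_poly = "(exp_indet, int) mpol"

definition exp_polys :: "nat \<Rightarrow> exp_poly set" where
  "exp_polys k = {f. mpol_indets f \<subseteq> IVar ` {..<k} \<union> IExp ` {..<k}}"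

definition exp_poly_eval :: "('a::field_char_0 \<Rightarrow> 'a) \<Rightarrow> (nat \<Rightarrow> 'a) \<Rightarrow> exp_poly \<Rightarrow> 'a" where
  "exp_poly_eval E x f =
     mpol_eval of_int (\<lambda>v. case v of IVar j \<Rightarrow> x j | IExp j \<Rightarrow> E (x j)) f"

text \<open>
  The derivation \<open>\<partial>/\<partial>X\<^sub>j\<close> with \<open>\<partial>e\<^bsup>X\<^sub>j\<^esup>/\<partial>X\<^sub>j = e\<^bsup>X\<^sub>j\<^esup>\<close>, via the chain rule.
\<close>

definition exp_poly_deriv :: "nat \<Rightarrow> exp_poly \<Rightarrow> exp_poly" where
  "exp_poly_deriv j f =
     mpol_pderiv (IVar j) f +
     Poly_Mapping.single (Poly_Mapping.single (IExp j) 1) 1 * mpol_pderiv (IExp j) f"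

definition exp_algebraic :: "('a::field_char_0 \<Rightarrow> 'a) \<Rightarrow> 'a \<Rightarrow> bool" where
  "exp_algebraic E a \<longleftrightarrow>
     (\<exists>k x f. 0 < k \<and> x 0 = a \<and>
        (\<forall>i<k. f i \<in> exp_polys k \<and> exp_poly_eval E x (f i) = 0) \<and>
        det (mat k k (\<lambda>(i, j). exp_poly_eval E x (exp_poly_deriv j (f i)))) \<noteq> 0)"

abbreviation exp_transcendental :: "('a::field_char_0 \<Rightarrow> 'a) \<Rightarrow> 'a \<Rightarrow> bool" where
  "exp_transcendental E a \<equiv> \<not> exp_algebraic E a"

definition is_subfield :: "'a::field set \<Rightarrow> bool" where
  "is_subfield K \<longleftrightarrow>
     0 \<in> K \<and> 1 \<in> K \<and>
     (\<forall>a\<in>K. \<forall>b\<in>K. a + b \<in> K \<and> a * b \<in> K) \<and>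
     (\<forall>a\<in>K. - a \<in> K \<and> inverse a \<in> K)"

text \<open>
  The smallest subfield containing \<open>X\<close>; in characteristic zero this is \<open>\<rat>(X)\<close>.
\<close>

definition field_gen :: "'a::field_char_0 set \<Rightarrow> 'a set" where
  "field_gen X = is_subfield hull X"

text \<open>
  The elements of \<open>S\<close> themselves serve as indeterminates, each evaluated at itself.
\<close>

definition alg_independent :: "'a::field set \<Rightarrow> 'a set \<Rightarrow> bool" where
  "alg_independent K S \<longleftrightarrow>
     (\<forall>f :: ('a, 'a) mpol.
        (\<forall>m. Poly_Mapping.lookup f m \<in> K) \<longrightarrow> mpol_indets f \<subseteq> S \<longrightarrow>
        mpol_eval (\<lambda>c. c) (\<lambda>s. s) f = 0 \<longrightarrow> f = 0)"

text \<open>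
  The transcendence degree of \<open>L\<close> over \<open>K\<close> is the largest size of a subset of \<open>L\<close> algebraically
  independent over \<open>K\<close>; all infinite degrees are identified with \<open>\<infinity>\<close>.
\<close>

definition trans_degree :: "'a::field set \<Rightarrow> 'a set \<Rightarrow> enat" where
  "trans_degree L K = (SUP S\<in>{S. S \<subseteq> L \<and> finite S \<and> alg_independent K S}. enat (card S))"

definition td :: "'a::field_char_0 set \<Rightarrow> 'a set \<Rightarrow> enat" where
  "td X Y = trans_degree (field_gen (X \<union> Y)) (field_gen Y)"

definition mult_independent :: "nat \<Rightarrow> (nat \<Rightarrow> 'a::field) \<Rightarrow> bool" where
  "mult_independent n a \<longleftrightarrow>
     (\<forall>m :: nat \<Rightarrow> int. (\<Prod>i<n. a i powi m i) = 1 \<longrightarrow> (\<forall>i<n. m i = 0))"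

end

(*
  For u in F consider the form d(E u)/E u - du on derivations of F. Given finitely many u, let K be
  the field of constants of the derivations killing all these forms. Three facts are combined.

  Ax: modulo K, the forms of Q-linearly independent elements are linearly independent over F. This
  reduces to a residue computation in a rational function field.

  Khovanskii: an element of K is exponentially algebraic, because after discarding redundant u one may
  assume that all u lie in K, and then the polynomial relations between the u and the E u form a
  nonsingular system. Hence p is not in K, where the u are now the x_i and p x_i, and p is
  transcendental over K.

  If td < n, the forms of p x_i minus p times those of x_i are linearly dependent over F. By Ax's
  theorem this dependence descends to Q[p], and comparing powers of p makes the x_i linearly dependent
  over Q, contrary to the multiplicative independence of the E x_i.
*)

theory Submission
  imports Defs "HOL-Computational_Algebra.Formal_Laurent_Series"
begin

subsection \<open>Derivations and their extension\<close>

text \<open>No module of differentials is built: a form is the function that it induces on the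
  derivations of \<open>F\<close>, and dependence over \<open>F\<close> means dependence of such
  functions. This is adequate because in characteristic zero a derivation from a subring into
  \<open>F\<close> extends to all of \<open>F\<close>. Residues would naturally be taken at a place
  of an algebraic function field. Here they are taken only in a rational function field
  \<open>L(t)\<close>, as coefficients of Laurent series, and relations higher up are brought down
  by trace and norm. The obstacle in the last step is that the \<open>x_i\<close> are independent
  over Q, but perhaps not modulo \<open>K\<close>, so Ax's theorem does not apply directly to the
  \<open>x_i\<close> and \<open>p x_i\<close>. It is applied to a basis of their span modulo
  \<open>K\<close>, with remainders in \<open>K\<close>. If the polynomials \<open>u_l\<close> over
  Q give the descended relation at \<open>T = p\<close>, then \<open>p - T\<close> times the sum of
  the \<open>x_l u_l(T)\<close> has its coefficients in \<open>K\<close>: the basis parts cancel and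
  only remainders are left. It vanishes at \<open>T = p\<close>, hence identically, and independence
  over Q applies to each power of \<open>T\<close>.\<close>

definition derivation :: "('a::idom \<Rightarrow> 'a) \<Rightarrow> bool" where
  "derivation D \<longleftrightarrow> (\<forall>a b. D (a + b) = D a + D b) \<and> (\<forall>a b. D (a * b) = a * D b + D a * b)"

definition subring :: "'a::idom set \<Rightarrow> bool" where
  "subring M \<longleftrightarrow> 1 \<in> M \<and> (\<forall>a\<in>M. \<forall>b\<in>M. a - b \<in> M \<and> a * b \<in> M)"

definition polys_over :: "'a::idom set \<Rightarrow> 'a poly set" where
  "polys_over M = {q. \<forall>i. coeff q i \<in> M}"

definition algebraic_over :: "'a::idom set \<Rightarrow> 'a \<Rightarrow> bool" where
  "algebraic_over M a \<longleftrightarrow> (\<exists>q\<in>polys_over M. q \<noteq> 0 \<and> poly q a = 0)"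

text \<open>
  The graph of a derivation defined on a subring, seen as a subring of the dual numbers
  \<open>F[\<epsilon>]\<close> that meets \<open>\<epsilon>F\<close> only in \<open>0\<close>.
\<close>

definition deriv_graph :: "('a::idom \<times> 'a) set \<Rightarrow> bool" where
  "deriv_graph G \<longleftrightarrow> (1, 0) \<in> G \<and>
     (\<forall>(a, a')\<in>G. \<forall>(b, b')\<in>G. (a - b, a' - b') \<in> G \<and> (a * b, a * b' + a' * b) \<in> G) \<and>
     (\<forall>c. (0, c) \<in> G \<longrightarrow> c = 0)"

section \<open>Subrings and polynomials with coefficients in them\<close>

lemma
  assumes "subring M"
  shows subring_0: "0 \<in> M" and subring_1: "1 \<in> M"
    and subring_diff: "a \<in> M \<Longrightarrow> b \<in> M \<Longrightarrow> a - b \<in> M"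
    and subring_mult: "a \<in> M \<Longrightarrow> b \<in> M \<Longrightarrow> a * b \<in> M"
    and subring_uminus: "a \<in> M \<Longrightarrow> - a \<in> M"
    and subring_add: "a \<in> M \<Longrightarrow> b \<in> M \<Longrightarrow> a + b \<in> M"
proof -
  have d: "a - b \<in> M" if "a \<in> M" "b \<in> M" for a b
    using assms that by (auto simp: subring_def)
  show "a \<in> M \<Longrightarrow> b \<in> M \<Longrightarrow> a * b \<in> M" using assms by (auto simp: subring_def)
  have 1: "1 \<in> M" using assms by (auto simp: subring_def)
  show 0: "0 \<in> M" using d[OF 1 1] by simp
  have u: "- a \<in> M" if "a \<in> M" for a using d[OF 0 that] by simp
  show "1 \<in> M" by (rule 1)
  show "a \<in> M \<Longrightarrow> - a \<in> M" by (rule u)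
  show "a \<in> M \<Longrightarrow> b \<in> M \<Longrightarrow> a + b \<in> M" using d[of a "- b"] u[of b] by simp
qed (use assms in \<open>auto simp: subring_def\<close>)

lemma subring_sum:
  assumes "subring M" "\<And>i. i \<in> I \<Longrightarrow> f i \<in> M"
  shows "sum f I \<in> M"
  using assms(2) by (induction I rule: infinite_finite_induct)
    (auto intro: subring_0[OF assms(1)] subring_add[OF assms(1)])

lemma subring_prod:
  assumes "subring M" "\<And>i. i \<in> I \<Longrightarrow> f i \<in> M"
  shows "prod f I \<in> M"
  using assms(2) by (induction I rule: infinite_finite_induct)
    (auto intro: subring_1[OF assms(1)] subring_mult[OF assms(1)])

lemma subring_power:
  assumes "subring M" "a \<in> M"
  shows "a ^ n \<in> M"
  by (induction n) (auto intro: subring_1 subring_mult assms)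

lemma subring_of_nat:
  assumes "subring M"
  shows "of_nat n \<in> M"
  by (induction n) (auto intro: subring_0 subring_1 subring_add assms)

lemma subring_of_int:
  assumes "subring M"
  shows "of_int n \<in> M"
  by (cases n rule: int_diff_cases) (auto intro: subring_diff subring_of_nat assms)

lemma
  assumes M: "subring M"
  shows polys_over_const: "c \<in> M \<Longrightarrow> [:c:] \<in> polys_over M"
    and polys_over_1: "1 \<in> polys_over M"
    and polys_over_0: "0 \<in> polys_over M"
    and polys_over_monom: "c \<in> M \<Longrightarrow> monom c n \<in> polys_over M"
    and polys_over_add: "p \<in> polys_over M \<Longrightarrow> q \<in> polys_over M \<Longrightarrow> p + q \<in> polys_over M"
    and polys_over_diff: "p \<in> polys_over M \<Longrightarrow> q \<in> polys_over M \<Longrightarrow> p - q \<in> polys_over M"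
    and polys_over_mult: "p \<in> polys_over M \<Longrightarrow> q \<in> polys_over M \<Longrightarrow> p * q \<in> polys_over M"
    and polys_over_smult: "c \<in> M \<Longrightarrow> q \<in> polys_over M \<Longrightarrow> smult c q \<in> polys_over M"
    and polys_over_pderiv: "p \<in> polys_over M \<Longrightarrow> pderiv p \<in> polys_over M"
    and polys_over_pCons: "c \<in> M \<Longrightarrow> p \<in> polys_over M \<Longrightarrow> pCons c p \<in> polys_over M"
  using subring_0[OF M] subring_1[OF M]
  by (auto simp: polys_over_def coeff_pCons coeff_mult coeff_pderiv simp del: of_nat_Suc split: nat.splits
      intro!: subring_sum[OF M] intro: subring_add[OF M] subring_diff[OF M] subring_mult[OF M] subring_of_nat[OF M])

lemma subring_polys_over: "subring M \<Longrightarrow> subring (polys_over M)"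
  unfolding subring_def[of "polys_over M"]
  by (auto intro: polys_over_1 polys_over_diff polys_over_mult)

lemma is_subfield_subring: "is_subfield K \<Longrightarrow> subring K"
  unfolding is_subfield_def subring_def by (metis diff_conv_add_uminus)

lemma algebraic_over_mono: "M \<subseteq> N \<Longrightarrow> algebraic_over M a \<Longrightarrow> algebraic_over N a"
  by (auto simp: algebraic_over_def polys_over_def)

text \<open>Least degree replaces the monic minimal polynomial, since \<open>M\<close> may be a mere
  subring without inverses.\<close>

lemma minimal_annihilator:
  fixes a :: "'a::field"
  assumes "algebraic_over M a"
  obtains p where "p \<in> polys_over M" "p \<noteq> 0" "poly p a = 0"
    "\<And>q. q \<in> polys_over M \<Longrightarrow> poly q a = 0 \<Longrightarrow> degree q < degree p \<Longrightarrow> q = 0" "0 < degree p"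
proof -
  define P where "P q \<longleftrightarrow> q \<in> polys_over M \<and> q \<noteq> 0 \<and> poly q a = 0" for q
  obtain q where "P q" using assms by (auto simp: algebraic_over_def P_def)
  from ex_has_least_nat[of P q degree, OF this] obtain p
    where p: "P p" "\<And>q. P q \<Longrightarrow> degree p \<le> degree q" by blast
  have "0 < degree p"
  proof (rule ccontr)
    assume "\<not> 0 < degree p"
    then obtain c where "p = [:c:]" by (auto elim: degree_eq_zeroE)
    then show False using p(1) by (auto simp: P_def)
  qed
  then show ?thesis using p that[of p] unfolding P_def using leD by blast
qed

text \<open>Separability in characteristic zero: the derivative has smaller degree, so if it
  vanished at \<open>a\<close> it would be the zero polynomial, and \<open>p\<close> would be
  constant.\<close>

lemma pderiv_minimal_annihilator_nonzero:
  fixes a :: "'a::field_char_0"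
  assumes "subring M" "p \<in> polys_over M" "0 < degree p"
    "\<And>q. q \<in> polys_over M \<Longrightarrow> poly q a = 0 \<Longrightarrow> degree q < degree p \<Longrightarrow> q = 0"
  shows "poly (pderiv p) a \<noteq> 0"
proof
  assume "poly (pderiv p) a = 0"
  then have "pderiv p = 0"
    using assms by (intro assms(4)) (auto intro: polys_over_pderiv simp: degree_pderiv)
  then show False using assms(3) by (simp add: pderiv_eq_0_iff)
qed

text \<open>Each division step first multiplies by the leading coefficient of \<open>p\<close>
  instead of dividing by it; \<open>l\<close> collects these factors.\<close>

lemma pseudo_division:
  fixes p q :: "'a::idom poly"
  assumes M: "subring M" and p: "p \<in> polys_over M" "0 < degree p" and "q \<in> polys_over M"
  obtains l s r where "l \<in> M" "l \<noteq> 0" "s \<in> polys_over M" "r \<in> polys_over M"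
    "degree r < degree p" "[:l:] * q = s * p + r"
proof -
  have "\<exists>l s r. l \<in> M \<and> l \<noteq> 0 \<and> s \<in> polys_over M \<and> r \<in> polys_over M \<and>
      degree r < degree p \<and> [:l:] * q = s * p + r"
    using assms(4)
  proof (induction "degree q" arbitrary: q rule: less_induct)
    case less
    show ?case
    proof (cases "degree q < degree p")
      case True
      then show ?thesis
        using less.prems subring_1[OF M] polys_over_0[OF M]
        by (intro exI[of _ 1] exI[of _ 0] exI[of _ q]) auto
    next
      case False
      define l where "l = lead_coeff p"
      define u where "u = monom (lead_coeff q) (degree q - degree p)"
      define r where "r = [:l:] * q - u * p"
      have l: "l \<in> M" "l \<noteq> 0" using p by (auto simp: l_def polys_over_def)
      have u: "u \<in> polys_over M"
        using less.prems unfolding u_def by (intro polys_over_monom[OF M]) (auto simp: polys_over_def)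
      have r: "r \<in> polys_over M"
        unfolding r_def by (intro polys_over_diff polys_over_mult polys_over_const M l u less.prems p)
      have "degree u \<le> degree q - degree p" unfolding u_def by (rule degree_monom_le)
      then have "degree r \<le> degree q"
        unfolding r_def using False
        by (intro degree_diff_le order_trans[OF degree_mult_le]) auto
      moreover have "coeff r (degree q) = 0"
        using False unfolding r_def l_def u_def by (simp add: coeff_monom_mult)
      moreover have "degree q > 0" using False p(2) by simp
      ultimately have "degree r < degree q"
        by (metis coeff_0 degree_0 leading_coeff_0_iff le_neq_implies_less)
      from less.hyps[OF this r] obtain l' s' r' where *: "l' \<in> M" "l' \<noteq> 0" "s' \<in> polys_over M"
        "r' \<in> polys_over M" "degree r' < degree p" "[:l':] * r = s' * p + r'" by blast
      have "[:l' * l:] * q = (s' + [:l':] * u) * p + r'"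
      proof -
        have "[:l' * l:] * q = [:l':] * r + [:l':] * u * p" by (simp add: r_def algebra_simps smult_diff_right)
        then show ?thesis using *(6) by (simp add: algebra_simps)
      qed
      then show ?thesis
        using * l u
        by (intro exI[of _ "l' * l"] exI[of _ "s' + [:l':] * u"] exI[of _ r'])
          (auto intro!: subring_mult[OF M] polys_over_add[OF M] polys_over_mult[OF M] polys_over_smult[OF M])
    qed
  qed
  then show ?thesis using that by blast
qed

section \<open>Calculus of derivations\<close>

lemma
  assumes "derivation D"
  shows derivation_add: "D (a + b) = D a + D b"
    and derivation_mult: "D (a * b) = a * D b + D a * b"
    and derivation_0: "D 0 = 0"
    and derivation_1: "D 1 = 0"
    and derivation_minus: "D (- a) = - D a"
    and derivation_diff: "D (a - b) = D a - D b"
proof -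
  have a: "D (a + b) = D a + D b" and m: "D (a * b) = a * D b + D a * b" for a b
    using assms by (auto simp: derivation_def)
  show "D (a + b) = D a + D b" "D (a * b) = a * D b + D a * b" by (rule a, rule m)
  show 0: "D 0 = 0" using a[of 0 0] by (metis add.right_neutral add_left_cancel)
  have "D 1 = D 1 + D 1" using m[of 1 1] by (metis mult_1_left mult_1_right)
  then show "D 1 = 0" by (metis add.right_neutral add_left_cancel)
  have u: "D (- a) = - D a" for a using a[of a "- a"] 0 by (simp add: eq_neg_iff_add_eq_0 add.commute)
  show "D (- a) = - D a" by (rule u)
  show "D (a - b) = D a - D b" using a[of a "- b"] u[of b] by simp
qed

lemma derivation_sum:
  assumes "derivation D"
  shows "D (sum f I) = (\<Sum>i\<in>I. D (f i))"
  by (induction I rule: infinite_finite_induct)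
    (auto simp: derivation_0[OF assms] derivation_add[OF assms])

lemma derivation_power:
  assumes "derivation D"
  shows "D (a ^ n) = of_nat n * a ^ (n - 1) * D a"
proof (induction n)
  case (Suc n)
  then show ?case
    by (cases n) (simp_all add: derivation_mult[OF assms] derivation_1[OF assms] algebra_simps)
qed (simp add: derivation_1[OF assms])

lemma derivation_inverse:
  fixes D :: "'a::field \<Rightarrow> 'a"
  assumes "derivation D" "a \<noteq> 0"
  shows "D (inverse a) = - D a / a\<^sup>2"
proof -
  have "0 = a * D (inverse a) + D a * inverse a"
    using derivation_mult[OF assms(1), of a "inverse a"] assms(2) by (simp add: derivation_1[OF assms(1)])
  then have "a * D (inverse a) = - (D a * inverse a)" by (simp add: eq_neg_iff_add_eq_0)
  then show ?thesis using assms(2) by (simp add: field_simps power2_eq_square)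
qed

lemma derivation_divide:
  fixes D :: "'a::field \<Rightarrow> 'a"
  assumes "derivation D" "b \<noteq> 0"
  shows "D (a / b) = (D a * b - a * D b) / b\<^sup>2"
proof -
  have "D (a / b) = a * (- D b / b\<^sup>2) + D a * inverse b"
    by (simp only: divide_inverse[of a b] derivation_mult[OF assms(1)] derivation_inverse[OF assms])
  also have "\<dots> = (D a * b - a * D b) / b\<^sup>2"
    using assms(2) by (simp add: field_simps power2_eq_square)
  finally show ?thesis .
qed

lemma derivation_poly:
  assumes "derivation D"
  shows "D (poly q a) = poly (map_poly D q) a + poly (pderiv q) a * D a"
proof (induction q)
  case (pCons c q)
  have "map_poly D (pCons c q) = pCons (D c) (map_poly D q)"
    using derivation_0[OF assms] by (intro poly_eqI) (auto simp: coeff_map_poly coeff_pCons split: nat.splits)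
  then show ?case
    using pCons by (simp add: derivation_add[OF assms] derivation_mult[OF assms] pderiv_pCons algebra_simps)
qed (simp add: derivation_0[OF assms])

section \<open>Extending a derivation by one element, then to the whole field\<close>

definition graph_polys :: "('a::idom \<times> 'a) set \<Rightarrow> ('a poly \<times> 'a poly) set" where
  "graph_polys G = {(q, q'). \<forall>i. (coeff q i, coeff q' i) \<in> G}"

lemma
  assumes "deriv_graph G"
  shows deriv_graph_1: "(1, 0) \<in> G"
    and deriv_graph_diff: "(a, a') \<in> G \<Longrightarrow> (b, b') \<in> G \<Longrightarrow> (a - b, a' - b') \<in> G"
    and deriv_graph_mult: "(a, a') \<in> G \<Longrightarrow> (b, b') \<in> G \<Longrightarrow> (a * b, a * b' + a' * b) \<in> G"
    and deriv_graph_0D: "(0, c) \<in> G \<Longrightarrow> c = 0"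
    and deriv_graph_0: "(0, 0) \<in> G"
    and deriv_graph_add: "(a, a') \<in> G \<Longrightarrow> (b, b') \<in> G \<Longrightarrow> (a + b, a' + b') \<in> G"
    and deriv_graph_unique: "(a, c) \<in> G \<Longrightarrow> (a, d) \<in> G \<Longrightarrow> c = d"
proof -
  show 1: "(1, 0) \<in> G" using assms by (auto simp: deriv_graph_def)
  have d: "(a, a') \<in> G \<Longrightarrow> (b, b') \<in> G \<Longrightarrow> (a - b, a' - b') \<in> G" for a a' b b'
    using assms by (auto simp: deriv_graph_def)
  show "(a, a') \<in> G \<Longrightarrow> (b, b') \<in> G \<Longrightarrow> (a - b, a' - b') \<in> G" by (rule d)
  show "(a, a') \<in> G \<Longrightarrow> (b, b') \<in> G \<Longrightarrow> (a * b, a * b' + a' * b) \<in> G"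
    using assms by (auto simp: deriv_graph_def)
  have z: "(0, c) \<in> G \<Longrightarrow> c = 0" for c using assms by (auto simp: deriv_graph_def)
  then show "(0, c) \<in> G \<Longrightarrow> c = 0" .
  show 0: "(0, 0) \<in> G" using d[OF 1 1] by simp
  show "(a, a') \<in> G \<Longrightarrow> (b, b') \<in> G \<Longrightarrow> (a + b, a' + b') \<in> G"
    using d[of a a' "- b" "- b'"] d[OF 0, of b b'] by simp
  show "(a, c) \<in> G \<Longrightarrow> (a, d) \<in> G \<Longrightarrow> c = d" using z[of "c - d"] d[of a c a d] by simp
qed

lemma deriv_graph_sum:
  assumes "deriv_graph G" "\<And>i. i \<in> I \<Longrightarrow> (f i, f' i) \<in> G"
  shows "(sum f I, sum f' I) \<in> G"
  using assms(2) by (induction I rule: infinite_finite_induct)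
    (auto intro: deriv_graph_0[OF assms(1)] deriv_graph_add[OF assms(1)])

lemma subring_fst_deriv_graph:
  assumes "deriv_graph G"
  shows "subring (fst ` G)"
proof -
  have mem: "a \<in> fst ` G \<longleftrightarrow> (\<exists>a'. (a, a') \<in> G)" for a by force
  show ?thesis
    unfolding subring_def Ball_def mem
    using deriv_graph_1[OF assms] by (meson deriv_graph_diff[OF assms] deriv_graph_mult[OF assms])
qed

lemma
  assumes G: "deriv_graph G"
  shows graph_polys_diff: "(p, p') \<in> graph_polys G \<Longrightarrow> (q, q') \<in> graph_polys G \<Longrightarrow>
      (p - q, p' - q') \<in> graph_polys G"
    and graph_polys_mult: "(p, p') \<in> graph_polys G \<Longrightarrow> (q, q') \<in> graph_polys G \<Longrightarrow>
      (p * q, p * q' + p' * q) \<in> graph_polys G"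
    and graph_polys_monom: "(a, a') \<in> G \<Longrightarrow> (monom a n, monom a' n) \<in> graph_polys G"
proof -
  show "(p, p') \<in> graph_polys G \<Longrightarrow> (q, q') \<in> graph_polys G \<Longrightarrow> (p - q, p' - q') \<in> graph_polys G"
    by (auto simp: graph_polys_def intro: deriv_graph_diff[OF G])
  show "(a, a') \<in> G \<Longrightarrow> (monom a n, monom a' n) \<in> graph_polys G"
    by (auto simp: graph_polys_def intro: deriv_graph_0[OF G])
  assume "(p, p') \<in> graph_polys G" "(q, q') \<in> graph_polys G"
  then show "(p * q, p * q' + p' * q) \<in> graph_polys G"
    by (auto simp: graph_polys_def coeff_mult sum.distrib[symmetric]
        intro!: deriv_graph_sum[OF G] deriv_graph_mult[OF G])
qed

lemma graph_polys_lift: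
  assumes "p \<in> polys_over (fst ` G)" "deriv_graph G"
  obtains p' where "(p, p') \<in> graph_polys G"
proof -
  have "\<forall>i. \<exists>c. (coeff p i, c) \<in> G" using assms by (fastforce simp: polys_over_def)
  then obtain f where f: "\<And>i. (coeff p i, f i) \<in> G" by metis
  \<comment> \<open>The only derivative of \<open>0\<close> in \<open>G\<close> is \<open>0\<close>,
    so the chosen coefficients have finite support and form a polynomial.\<close>
  have "f i = 0" if "i > degree p" for i
    using f[of i] that deriv_graph_0D[OF assms(2)] by (simp add: coeff_eq_0)
  then have "eventually (\<lambda>i. f i = 0) cofinite"
    unfolding MOST_nat by blast
  then have "\<And>i. coeff (Abs_poly f) i = f i" by (simp add: Abs_poly_inverse)
  then show ?thesis using f that[of "Abs_poly f"] by (auto simp: graph_polys_def)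
qed

lemma graph_polys_fst: "(p, p') \<in> graph_polys G \<Longrightarrow> p \<in> polys_over (fst ` G)"
  by (force simp: graph_polys_def polys_over_def)

text \<open>The subring of the dual numbers generated by \<open>G\<close> and
  \<open>a + c \<epsilon>\<close>: evaluating \<open>q + q' \<epsilon>\<close> at this point gives
  the pair in the body.\<close>

definition graph_adjoin :: "('a::idom \<times> 'a) set \<Rightarrow> 'a \<Rightarrow> 'a \<Rightarrow> ('a \<times> 'a) set" where
  "graph_adjoin G a c = (\<lambda>(q, q'). (poly q a, poly q' a + poly (pderiv q) a * c)) ` graph_polys G"

lemma
  assumes "deriv_graph G"
  shows graph_adjoin_superset: "G \<subseteq> graph_adjoin G a c"
    and graph_adjoin_mem: "(a, c) \<in> graph_adjoin G a c"
proof -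
  have "(monom b 0, monom b' 0) \<in> graph_polys G" if "(b, b') \<in> G" for b b'
    using that by (rule graph_polys_monom[OF assms])
  then show "G \<subseteq> graph_adjoin G a c"
    by (force simp: graph_adjoin_def image_iff pderiv_monom poly_monom monom_0)
  have "(monom 1 1, monom 0 1) \<in> graph_polys G"
    by (rule graph_polys_monom[OF assms deriv_graph_1[OF assms]])
  then show "(a, c) \<in> graph_adjoin G a c"
    by (force simp: graph_adjoin_def image_iff pderiv_monom poly_monom)
qed

lemma deriv_graph_adjoin:
  assumes G: "deriv_graph G"
    and wd: "\<And>q q'. (q, q') \<in> graph_polys G \<Longrightarrow> poly q a = 0 \<Longrightarrow> poly q' a + poly (pderiv q) a * c = 0"
  shows "deriv_graph (graph_adjoin G a c)"
  unfolding deriv_graph_def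
proof (intro conjI allI impI, goal_cases)
  case 1
  then show ?case using graph_adjoin_superset[OF G] deriv_graph_1[OF G] by blast
next
  case 2
  have "(x - y, x' - y') \<in> graph_adjoin G a c \<and> (x * y, x * y' + x' * y) \<in> graph_adjoin G a c"
    if xy: "(x, x') \<in> graph_adjoin G a c" "(y, y') \<in> graph_adjoin G a c" for x x' y y'
  proof -
    obtain p p' q q' where *: "(p, p') \<in> graph_polys G" "(q, q') \<in> graph_polys G"
      "(x, x') = (poly p a, poly p' a + poly (pderiv p) a * c)"
      "(y, y') = (poly q a, poly q' a + poly (pderiv q) a * c)"
      using xy by (auto simp: graph_adjoin_def)
    show ?thesis
      using graph_polys_diff[OF G *(1,2)] graph_polys_mult[OF G *(1,2)]
      using *(3,4) unfolding graph_adjoin_def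
      by (force simp: image_iff pderiv_diff pderiv_mult algebra_simps)
  qed
  then show ?case by blast
next
  case (3 d)
  then show ?case using wd by (auto simp: graph_adjoin_def)
qed

lemma deriv_graph_adjoin_transcendental:
  assumes "deriv_graph G" "\<not> algebraic_over (fst ` G) a"
  shows "deriv_graph (graph_adjoin G a c)"
proof (rule deriv_graph_adjoin[OF assms(1)])
  fix q q' assume q: "(q, q') \<in> graph_polys G" "poly q a = 0"
  then have "q = 0" using assms(2) graph_polys_fst by (auto simp: algebraic_over_def)
  moreover from this have "q' = 0"
    using q(1) deriv_graph_0D[OF assms(1)] by (intro poly_eqI) (auto simp: graph_polys_def)
  ultimately show "poly q' a + poly (pderiv q) a * c = 0" by simp
qed

text \<open>Differentiating \<open>poly p a = 0\<close> leaves one choice for \<open>c\<close>. Any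
  other annihilator \<open>q\<close> is, up to a nonzero factor \<open>l\<close>, a multiple of
  \<open>p\<close>, and the product rule carries consistency from \<open>p\<close> over to
  \<open>q\<close>.\<close>

lemma deriv_graph_adjoin_algebraic:
  fixes a :: "'a::field_char_0"
  assumes G: "deriv_graph G" and "algebraic_over (fst ` G) a"
  shows "\<exists>c. deriv_graph (graph_adjoin G a c)"
proof -
  note M = subring_fst_deriv_graph[OF G]
  obtain p where p: "p \<in> polys_over (fst ` G)" "p \<noteq> 0" "poly p a = 0" "0 < degree p"
    and min: "\<And>q. q \<in> polys_over (fst ` G) \<Longrightarrow> poly q a = 0 \<Longrightarrow> degree q < degree p \<Longrightarrow> q = 0"
    using minimal_annihilator[OF assms(2)] by metis
  obtain p' where p': "(p, p') \<in> graph_polys G" by (rule graph_polys_lift[OF p(1) G])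
  have nz: "poly (pderiv p) a \<noteq> 0"
    by (rule pderiv_minimal_annihilator_nonzero[OF M p(1,4) min])
  define c where "c = - poly p' a / poly (pderiv p) a"
  \<comment> \<open>\<open>V q q'\<close> is the value that the extended derivation must take at
    \<open>poly q a\<close>.\<close>
  define V where "V q q' = poly q' a + poly (pderiv q) a * c" for q q'
  have Vp: "V p p' = 0" using nz by (simp add: V_def c_def)
  have V_diff: "V (q - r) (q' - r') = V q q' - V r r'" for q r q' r'
    by (simp add: V_def pderiv_diff algebra_simps)
  have V_mult: "V (q * r) (q * r' + q' * r) = poly q a * V r r' + V q q' * poly r a" for q r q' r'
    by (simp add: V_def pderiv_mult algebra_simps)
  have "V q q' = 0" if q: "(q, q') \<in> graph_polys G" "poly q a = 0" for q q'
  proof -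
    obtain l s r where l: "l \<in> fst ` G" "l \<noteq> 0" and s: "s \<in> polys_over (fst ` G)"
      and r: "r \<in> polys_over (fst ` G)" "degree r < degree p" and eq: "[:l:] * q = s * p + r"
      using pseudo_division[OF M p(1,4) graph_polys_fst[OF q(1)]] by metis
    have "poly r a = 0" using arg_cong[OF eq, of "\<lambda>q. poly q a"] q(2) p(3) by simp
    then have "r = 0" using min r by blast
    obtain l' where l': "(l, l') \<in> G" using l(1) by force
    obtain s' where s': "(s, s') \<in> graph_polys G" by (rule graph_polys_lift[OF s G])
    have "([:l:], [:l':]) \<in> graph_polys G"
      using graph_polys_monom[OF G l', of 0] by (simp add: monom_0)
    from graph_polys_diff[OF G graph_polys_mult[OF G this q(1)] graph_polys_mult[OF G s' p']]
    have "(0, ([:l:] * q' + [:l':] * q) - (s * p' + s' * p)) \<in> graph_polys G"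
      using eq \<open>r = 0\<close> by simp
    then have "\<And>i. coeff (([:l:] * q' + [:l':] * q) - (s * p' + s' * p)) i = 0"
      using deriv_graph_0D[OF G] unfolding graph_polys_def by fastforce
    then have "([:l:] * q' + [:l':] * q) - (s * p' + s' * p) = 0"
      by (intro poly_eqI) simp
    then have "V ([:l:] * q - s * p) (([:l:] * q' + [:l':] * q) - (s * p' + s' * p)) = 0"
      using eq \<open>r = 0\<close> by (simp add: V_def)
    then have "l * V q q' = 0"
      unfolding V_diff V_mult using q(2) p(3) Vp by simp
    then show ?thesis using l(2) by simp
  qed
  then show ?thesis using deriv_graph_adjoin[OF G, of a c] unfolding V_def by blast
qed

text \<open>By Zorn's lemma there is a maximal graph above \<open>G\<close>. It is total, because
  any element, algebraic or transcendental over its domain, can still be adjoined.\<close>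

lemma deriv_graph_extend:
  fixes G :: "('a::field_char_0 \<times> 'a) set"
  assumes "deriv_graph G"
  obtains D where "derivation D" "\<And>a a'. (a, a') \<in> G \<Longrightarrow> D a = a'"
proof -
  define A where "A = {H. deriv_graph H \<and> G \<subseteq> H}"
  have "\<exists>M\<in>A. \<forall>X\<in>A. M \<subseteq> X \<longrightarrow> X = M"
  proof (rule subset_Zorn_nonempty)
    show "A \<noteq> {}" using assms by (auto simp: A_def)
    fix C assume C: "C \<noteq> {}" "subset.chain A C"
    have join: "\<exists>H\<in>C. z \<in> H \<and> w \<in> H" if "z \<in> \<Union>C" "w \<in> \<Union>C" for z w
      using that C unfolding subset_chain_def by blast
    have H: "deriv_graph H" if "H \<in> C" for H using that C by (auto simp: A_def subset_chain_def)
    have "deriv_graph (\<Union>C)"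
      unfolding deriv_graph_def
    proof (intro conjI allI impI, goal_cases)
      case 1
      then show ?case using C(1) H deriv_graph_1 by blast
    next
      case 2
      have "(a - b, a' - b') \<in> \<Union>C \<and> (a * b, a * b' + a' * b) \<in> \<Union>C"
        if ab: "(a, a') \<in> \<Union>C" "(b, b') \<in> \<Union>C" for a a' b b'
      proof -
        obtain K where K: "K \<in> C" "(a, a') \<in> K" "(b, b') \<in> K" using join[OF ab] by blast
        then show ?thesis using deriv_graph_diff[OF H K(2,3)] deriv_graph_mult[OF H K(2,3)] by blast
      qed
      then show ?case by blast
    next
      case (3 c)
      then show ?case using H deriv_graph_0D by blast
    qed
    moreover obtain H where "H \<in> C" using C(1) by blast
    moreover from this have "G \<subseteq> H" using C(2) by (auto simp: A_def subset_chain_def)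
    ultimately show "\<Union>C \<in> A" unfolding A_def by blast
  qed
  then obtain H where HA: "H \<in> A" "\<And>X. X \<in> A \<Longrightarrow> H \<subseteq> X \<Longrightarrow> X = H" by metis
  then have H: "deriv_graph H" "G \<subseteq> H" by (simp_all add: A_def)
  have max: "X = H" if "deriv_graph X" "H \<subseteq> X" for X
    using HA(2)[of X] that H(2) unfolding A_def by simp
  have "\<exists>c. (a, c) \<in> H" for a
  proof -
    obtain c where c: "deriv_graph (graph_adjoin H a c)"
      using deriv_graph_adjoin_transcendental[OF H(1)] deriv_graph_adjoin_algebraic[OF H(1)] by blast
    then show ?thesis using max[OF c graph_adjoin_superset[OF H(1)]] graph_adjoin_mem[OF H(1)] by metis
  qed
  then obtain D where D: "\<And>a. (a, D a) \<in> H" by metis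
  have eq: "D a = a'" if "(a, a') \<in> H" for a a' using deriv_graph_unique[OF H(1) D that] .
  have "derivation D"
    unfolding derivation_def
    using eq deriv_graph_add[OF H(1) D D] deriv_graph_mult[OF H(1) D D] by blast
  then show ?thesis using that eq H(2) by blast
qed

lemma exists_derivation_transcendental:
  fixes t :: "'a::field_char_0"
  assumes L: "subring L" and "\<not> algebraic_over L t"
  obtains D where "derivation D" "\<And>c. c \<in> L \<Longrightarrow> D c = 0" "D t = c"
proof -
  define G where "G = (\<lambda>a. (a, 0::'a)) ` L"
  have "deriv_graph G"
    unfolding deriv_graph_def G_def
    using subring_1[OF L] subring_mult[OF L] subring_diff[OF L] by (auto simp: image_iff)
  moreover have "fst ` G = L" by (force simp: G_def)
  ultimately have "deriv_graph (graph_adjoin G t c)" "(t, c) \<in> graph_adjoin G t c"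
      "G \<subseteq> graph_adjoin G t c"
    using assms by (auto intro: deriv_graph_adjoin_transcendental graph_adjoin_mem
        simp: graph_adjoin_superset[THEN subsetD])
  then obtain D where "derivation D" "\<And>a a'. (a, a') \<in> graph_adjoin G t c \<Longrightarrow> D a = a'"
    by (metis deriv_graph_extend)
  then show ?thesis
    using that[of D] \<open>(t, c) \<in> graph_adjoin G t c\<close> \<open>G \<subseteq> graph_adjoin G t c\<close> by (auto simp: G_def)
qed

subsection \<open>Residues in rational function fields\<close>

definition fractions :: "'a::field set \<Rightarrow> 'a \<Rightarrow> 'a set" where
  "fractions L t = {poly A t / poly B t | A B. A \<in> polys_over L \<and> B \<in> polys_over L \<and> poly B t \<noteq> 0}"

lemma fractionsI:
  "A \<in> polys_over L \<Longrightarrow> B \<in> polys_over L \<Longrightarrow> poly B t \<noteq> 0 \<Longrightarrow> poly A t / poly B t \<in> fractions L t"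
  by (auto simp: fractions_def)

lemma poly_in_fractions:
  assumes "subring L" "A \<in> polys_over L"
  shows "poly A t \<in> fractions L t"
  using fractionsI[OF assms(2) polys_over_1[OF assms(1)], of t] by simp

lemma is_subfield_fractions:
  fixes L :: "'a::field set"
  assumes L: "subring L"
  shows "is_subfield (fractions L t)"
  unfolding is_subfield_def
proof (intro conjI ballI)
  show "0 \<in> fractions L t" "1 \<in> fractions L t"
    using poly_in_fractions[OF L polys_over_0[OF L], of t] poly_in_fractions[OF L polys_over_1[OF L], of t] by auto
  fix a assume "a \<in> fractions L t"
  then obtain A B where a: "A \<in> polys_over L" "B \<in> polys_over L" "poly B t \<noteq> 0" "a = poly A t / poly B t"
    by (auto simp: fractions_def)
  have "- a = poly (0 - A) t / poly B t" using a by simp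
  then show "- a \<in> fractions L t"
    using a fractionsI[of "0 - A" L B t] polys_over_diff[OF L polys_over_0[OF L] a(1)] by metis
  show "inverse a \<in> fractions L t"
  proof (cases "poly A t = 0")
    case True
    then show ?thesis using a \<open>0 \<in> fractions L t\<close> by simp
  next
    case False
    then show ?thesis using a fractionsI[OF a(2) a(1) False] by simp
  qed
  fix b assume "b \<in> fractions L t"
  then obtain C E where b: "C \<in> polys_over L" "E \<in> polys_over L" "poly E t \<noteq> 0" "b = poly C t / poly E t"
    by (auto simp: fractions_def)
  have BE: "poly (B * E) t \<noteq> 0" "B * E \<in> polys_over L" using a b by (auto intro: polys_over_mult[OF L])
  have "a + b = poly (A * E + C * B) t / poly (B * E) t" using add_frac_eq[OF a(3) b(3), of "poly A t" "poly C t"] a(4) b(4) by simp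
  moreover have "A * E + C * B \<in> polys_over L" by (intro polys_over_add polys_over_mult L a b)
  ultimately show "a + b \<in> fractions L t" using fractionsI BE by metis
  have "a * b = poly (A * C) t / poly (B * E) t" using a b by simp
  moreover have "A * C \<in> polys_over L" by (intro polys_over_mult L a b)
  ultimately show "a * b \<in> fractions L t" using fractionsI BE by metis
qed

lemma derivation_fractions:
  fixes L :: "'a::field_char_0 set"
  assumes L: "subring L" and D: "derivation D" "\<forall>c\<in>L. D c = 0" "D t = 1"
  shows "A \<in> polys_over L \<Longrightarrow> D (poly A t) = poly (pderiv A) t"
    and "a \<in> fractions L t \<Longrightarrow> D a \<in> fractions L t"
proof -
  have *: "D (poly A t) = poly (pderiv A) t" if "A \<in> polys_over L" for A
  proof -
    have "map_poly D A = 0"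
      using that D(2) by (intro poly_eqI) (auto simp: coeff_map_poly derivation_0[OF D(1)] polys_over_def)
    then show ?thesis by (simp add: derivation_poly[OF D(1)] D(3))
  qed
  then show "A \<in> polys_over L \<Longrightarrow> D (poly A t) = poly (pderiv A) t" .
  assume "a \<in> fractions L t"
  then obtain A B where a: "A \<in> polys_over L" "B \<in> polys_over L" "poly B t \<noteq> 0" "a = poly A t / poly B t"
    by (auto simp: fractions_def)
  have "D a = poly (pderiv A * B - A * pderiv B) t / poly (B * B) t"
    unfolding a(4) derivation_divide[OF D(1) a(3)] using *[OF a(1)] *[OF a(2)] by (simp add: power2_eq_square)
  moreover have "pderiv A * B - A * pderiv B \<in> polys_over L" "B * B \<in> polys_over L" "poly (B * B) t \<noteq> 0"
    using a(3) by (auto intro!: polys_over_diff polys_over_mult polys_over_pderiv L a)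
  ultimately show "D a \<in> fractions L t" using fractionsI by metis
qed

section \<open>Laurent expansion at \<open>t = 0\<close>\<close>

definition poly_to_fls :: "'a::field poly \<Rightarrow> 'a fls" where
  "poly_to_fls A = fps_to_fls (fps_of_poly A)"

lemma poly_to_fls_simps:
  "poly_to_fls (A + B) = poly_to_fls A + poly_to_fls B"
  "poly_to_fls (A - B) = poly_to_fls A - poly_to_fls B"
  "poly_to_fls (A * B) = poly_to_fls A * poly_to_fls B"
  "poly_to_fls A = 0 \<longleftrightarrow> A = 0"
  "poly_to_fls [:c:] = fls_const c"
  "poly_to_fls (pderiv A) = fls_deriv (poly_to_fls A)"
  by (simp_all add: poly_to_fls_def fps_of_poly_add fps_of_poly_diff fps_of_poly_mult fls_times_fps_to_fls
      fps_of_poly_const fps_of_poly_pderiv fls_deriv_fps_to_fls fps_of_poly_eq_iff[of A 0, simplified])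

text \<open>A choice among all representations of \<open>a\<close> as a quotient. When
  \<open>t\<close> is transcendental over \<open>L\<close> they all have the same expansion, by
  \<open>laurent_eq\<close>.\<close>

definition laurent :: "'a::field set \<Rightarrow> 'a \<Rightarrow> 'a \<Rightarrow> 'a fls" where
  "laurent L t a = (SOME f. \<exists>A\<in>polys_over L. \<exists>B\<in>polys_over L. poly B t \<noteq> 0 \<and>
     a = poly A t / poly B t \<and> f = poly_to_fls A / poly_to_fls B)"

lemma laurent_eq:
  fixes t :: "'a::field"
  assumes L: "subring L" "\<not> algebraic_over L t"
    and AB: "A \<in> polys_over L" "B \<in> polys_over L" "poly B t \<noteq> 0"
  shows "laurent L t (poly A t / poly B t) = poly_to_fls A / poly_to_fls B"
  unfolding laurent_def
proof (rule some_equality)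
  show "\<exists>A'\<in>polys_over L. \<exists>B'\<in>polys_over L. poly B' t \<noteq> 0 \<and>
     poly A t / poly B t = poly A' t / poly B' t \<and> poly_to_fls A / poly_to_fls B = poly_to_fls A' / poly_to_fls B'"
    using AB by blast
next
  fix f assume "\<exists>A'\<in>polys_over L. \<exists>B'\<in>polys_over L. poly B' t \<noteq> 0 \<and>
     poly A t / poly B t = poly A' t / poly B' t \<and> f = poly_to_fls A' / poly_to_fls B'"
  then obtain A' B' where *: "A' \<in> polys_over L" "B' \<in> polys_over L" "poly B' t \<noteq> 0"
    "poly A t / poly B t = poly A' t / poly B' t" "f = poly_to_fls A' / poly_to_fls B'" by blast
  have "poly (A * B' - A' * B) t = 0" using AB * by (simp add: field_simps)
  moreover have "A * B' - A' * B \<in> polys_over L" by (intro polys_over_diff polys_over_mult L AB *)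
  ultimately have "A * B' - A' * B = 0" using L(2) by (auto simp: algebraic_over_def)
  then have "poly_to_fls A * poly_to_fls B' = poly_to_fls A' * poly_to_fls B"
    by (metis poly_to_fls_simps(3) eq_iff_diff_eq_0)
  moreover have "poly_to_fls B \<noteq> 0" "poly_to_fls B' \<noteq> 0" using AB * by (auto simp: poly_to_fls_simps)
  ultimately show "f = poly_to_fls A / poly_to_fls B" using *(5) by (simp add: frac_eq_eq)
qed

lemma
  fixes t :: "'a::field_char_0"
  assumes L: "subring L" "\<not> algebraic_over L t"
  shows laurent_add: "a \<in> fractions L t \<Longrightarrow> b \<in> fractions L t \<Longrightarrow> laurent L t (a + b) = laurent L t a + laurent L t b"
    and laurent_mult: "a \<in> fractions L t \<Longrightarrow> b \<in> fractions L t \<Longrightarrow> laurent L t (a * b) = laurent L t a * laurent L t b"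
    and laurent_const: "c \<in> L \<Longrightarrow> laurent L t c = fls_const c"
    and laurent_t: "laurent L t t = fls_X"
    and laurent_eq_0_iff: "a \<in> fractions L t \<Longrightarrow> laurent L t a = 0 \<longleftrightarrow> a = 0"
    and laurent_deriv: "a \<in> fractions L t \<Longrightarrow> derivation D \<Longrightarrow> \<forall>c\<in>L. D c = 0 \<Longrightarrow> D t = 1 \<Longrightarrow>
      laurent L t (D a) = fls_deriv (laurent L t a)"
proof -
  have pc: "laurent L t (poly A t) = poly_to_fls A" if "A \<in> polys_over L" for A
    using laurent_eq[OF L that polys_over_1[OF L(1)]] poly_to_fls_simps(5)[of "1::'a"] by (simp add: one_pCons)
  show "c \<in> L \<Longrightarrow> laurent L t c = fls_const c"
    using pc[of "[:c:]"] polys_over_const[OF L(1)] by (simp add: poly_to_fls_simps)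
  have "[:0, 1:] \<in> polys_over L"
    using L(1) by (intro polys_over_pCons) (auto intro: subring_0 subring_1 polys_over_0)
  from pc[OF this] show "laurent L t t = fls_X"
    by (simp add: poly_to_fls_def fps_of_poly_pCons fps_to_fls_eq_iff)
  assume "a \<in> fractions L t"
  then obtain A B where a: "A \<in> polys_over L" "B \<in> polys_over L" "poly B t \<noteq> 0" "a = poly A t / poly B t"
    by (auto simp: fractions_def)
  have la: "laurent L t a = poly_to_fls A / poly_to_fls B" unfolding a(4) by (rule laurent_eq[OF L a(1-3)])
  have B0: "poly_to_fls B \<noteq> 0" using a(3) by (auto simp: poly_to_fls_simps)
  show "laurent L t a = 0 \<longleftrightarrow> a = 0"
  proof -
    have "a = 0 \<longleftrightarrow> poly A t = 0" using a by simp
    also have "\<dots> \<longleftrightarrow> A = 0" using L(2) a(1) by (auto simp: algebraic_over_def)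
    finally show ?thesis using la B0 by (simp add: poly_to_fls_simps)
  qed
  {
    assume "b \<in> fractions L t"
    then obtain C E where b: "C \<in> polys_over L" "E \<in> polys_over L" "poly E t \<noteq> 0" "b = poly C t / poly E t"
      by (auto simp: fractions_def)
    have lb: "laurent L t b = poly_to_fls C / poly_to_fls E" unfolding b(4) by (rule laurent_eq[OF L b(1-3)])
    have E0: "poly_to_fls E \<noteq> 0" using b(3) by (auto simp: poly_to_fls_simps)
    have BE: "poly (B * E) t \<noteq> 0" "B * E \<in> polys_over L" using a b by (auto intro: polys_over_mult[OF L(1)])
    have "a + b = poly (A * E + C * B) t / poly (B * E) t" using add_frac_eq[OF a(3) b(3), of "poly A t" "poly C t"] a(4) b(4) by simp
    moreover have "A * E + C * B \<in> polys_over L" by (intro polys_over_add polys_over_mult L a b)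
    ultimately show "laurent L t (a + b) = laurent L t a + laurent L t b"
      using laurent_eq[OF L _ BE(2,1), of "A * E + C * B"] la lb B0 E0
      by (simp del: poly_add poly_mult add: poly_to_fls_simps add_frac_eq)
    have "a * b = poly (A * C) t / poly (B * E) t" using a b by simp
    moreover have "A * C \<in> polys_over L" by (intro polys_over_mult L a b)
    ultimately show "laurent L t (a * b) = laurent L t a * laurent L t b"
      using laurent_eq[OF L _ BE(2,1), of "A * C"] la lb
      by (simp del: poly_add poly_mult add: poly_to_fls_simps)
  }
  {
    assume D: "derivation D" "\<forall>c\<in>L. D c = 0" "D t = 1"
    note Dp = derivation_fractions(1)[OF L(1) D]
    have "D a = poly (pderiv A * B - A * pderiv B) t / poly (B * B) t"
      unfolding a(4) derivation_divide[OF D(1) a(3)] using Dp[OF a(1)] Dp[OF a(2)] by (simp add: power2_eq_square)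
    moreover have q: "pderiv A * B - A * pderiv B \<in> polys_over L" "B * B \<in> polys_over L" "poly (B * B) t \<noteq> 0"
      using a(3) by (auto intro!: polys_over_diff polys_over_mult polys_over_pderiv L a)
    ultimately have 1: "laurent L t (D a) =
        (fls_deriv (poly_to_fls A) * poly_to_fls B - poly_to_fls A * fls_deriv (poly_to_fls B)) / (poly_to_fls B)\<^sup>2"
      by (simp only: laurent_eq[OF L q] poly_to_fls_simps power2_eq_square)
    have "poly_to_fls A = laurent L t a * poly_to_fls B" using la B0 by simp
    then show "laurent L t (D a) = fls_deriv (laurent L t a)"
      unfolding 1 using B0 by (simp add: field_simps power2_eq_square)
  }
qed

lemma laurent_sum:
  fixes t :: "'a::field_char_0"
  assumes L: "subring L" "\<not> algebraic_over L t" and "\<And>i. i \<in> I \<Longrightarrow> g i \<in> fractions L t"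
  shows "laurent L t (sum g I) = (\<Sum>i\<in>I. laurent L t (g i))"
  using assms(3)
proof (induction I rule: infinite_finite_induct)
  case (insert i I)
  have "sum g I \<in> fractions L t"
    using insert by (intro subring_sum is_subfield_subring is_subfield_fractions L) auto
  then show ?case using insert laurent_add[OF L] by simp
qed (use laurent_const[OF L subring_0[OF L(1)]] in auto)

text \<open>The residue theorem at \<open>t = 0\<close> in abstract form; the integers
  \<open>m i\<close> stand for the orders of the \<open>w i\<close>. A power \<open>t ^ d\<close> is
  allowed because a norm turns \<open>t\<close> into such a power, which lets the property pass to
  algebraic extensions.\<close>

definition residue_property :: "('a::field \<Rightarrow> 'a) \<Rightarrow> 'a set \<Rightarrow> 'a \<Rightarrow> 'a set \<Rightarrow> bool" where
  "residue_property D L t V \<longleftrightarrow> (\<forall>(I :: nat set) f w v i0 d. finite I \<longrightarrow> f ` I \<subseteq> L \<longrightarrow> w ` I \<subseteq> V - {0} \<longrightarrow>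
     v \<in> V \<longrightarrow> i0 \<in> I \<longrightarrow> 0 < d \<longrightarrow> w i0 = t ^ d \<longrightarrow> (\<Sum>i\<in>I. f i * (D (w i) / w i)) = D v \<longrightarrow>
     (\<exists>m :: nat \<Rightarrow> int. (\<Sum>i\<in>I. f i * of_int (m i)) = 0 \<and> m i0 \<noteq> 0))"

text \<open>Compare coefficients of exponent -1 in the Laurent expansions. A derivative has none, a
  logarithmic derivative has the order of the series there, and the order of \<open>t ^ d\<close> is
  \<open>d\<close>.\<close>

lemma residue_property_fractions:
  fixes t :: "'a::field_char_0"
  assumes L: "subring L" "\<not> algebraic_over L t"
    and D: "derivation D" "\<forall>c\<in>L. D c = 0" "D t = 1"
  shows "residue_property D L t (fractions L t)"
  unfolding residue_property_def
proof (intro allI impI)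
  fix I :: "nat set" and f w v i0 and d :: nat
  assume I: "finite I" and f: "f ` I \<subseteq> L" and w: "w ` I \<subseteq> fractions L t - {0}" and v: "v \<in> fractions L t"
    and i0: "i0 \<in> I" "0 < d" "w i0 = t ^ d" and eq: "(\<Sum>i\<in>I. f i * (D (w i) / w i)) = D v"
  note F = is_subfield_subring[OF is_subfield_fractions[OF L(1), of t]]
  have inv: "inverse a \<in> fractions L t" if "a \<in> fractions L t" for a
    using is_subfield_fractions[OF L(1), of t] that by (auto simp: is_subfield_def)
  have Lf: "c \<in> fractions L t" if "c \<in> L" for c
    using poly_in_fractions[OF L(1) polys_over_const[OF L(1) that]] by simp
  define \<phi> where "\<phi> = laurent L t"
  have \<phi>0: "\<phi> (w i) \<noteq> 0" if "i \<in> I" for i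
    using w that laurent_eq_0_iff[OF L, of "w i"] by (auto simp: \<phi>_def)
  have term1: "f i * (D (w i) / w i) \<in> fractions L t" and
    term2: "\<phi> (f i * (D (w i) / w i)) = fls_const (f i) * (fls_deriv (\<phi> (w i)) * inverse (\<phi> (w i)))"
    if i: "i \<in> I" for i
  proof -
    have wi: "w i \<in> fractions L t" "w i \<noteq> 0" "f i \<in> L" using w f i by auto
    note Dw = derivation_fractions(2)[OF L(1) D wi(1)]
    show "f i * (D (w i) / w i) \<in> fractions L t"
      unfolding divide_inverse by (intro subring_mult[OF F] Dw Lf wi inv)
    have "\<phi> (inverse (w i)) * \<phi> (w i) = \<phi> 1"
      unfolding \<phi>_def using wi inv laurent_mult[OF L, of "inverse (w i)" "w i"] by simp
    also have "\<phi> 1 = 1" unfolding \<phi>_def using laurent_const[OF L subring_1[OF L(1)]] by simp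
    finally have "\<phi> (inverse (w i)) = inverse (\<phi> (w i))"
      using \<phi>0[OF i] by (simp add: field_simps)
    then show "\<phi> (f i * (D (w i) / w i)) = fls_const (f i) * (fls_deriv (\<phi> (w i)) * inverse (\<phi> (w i)))"
      unfolding divide_inverse \<phi>_def
      using laurent_mult[OF L Lf[OF wi(3)] subring_mult[OF F Dw inv[OF wi(1)]]]
        laurent_mult[OF L Dw inv[OF wi(1)]] laurent_const[OF L wi(3)] laurent_deriv[OF L wi(1) D] by simp
  qed
  define m where "m i = fls_subdegree (\<phi> (w i))" for i
  have "fls_deriv (\<phi> v) = \<phi> (\<Sum>i\<in>I. f i * (D (w i) / w i))"
    unfolding eq \<phi>_def using laurent_deriv[OF L v D] by simp
  also have "\<dots> = (\<Sum>i\<in>I. fls_const (f i) * (fls_deriv (\<phi> (w i)) * inverse (\<phi> (w i))))"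
    unfolding \<phi>_def using laurent_sum[OF L, where g = "\<lambda>i. f i * (D (w i) / w i)", OF term1] term2
    unfolding \<phi>_def by simp
  finally have "0 = fls_residue (\<Sum>i\<in>I. fls_const (f i) * (fls_deriv (\<phi> (w i)) * inverse (\<phi> (w i))))"
    by (metis fls_residue_deriv)
  also have "\<dots> = (\<Sum>i\<in>I. fls_residue (fls_const (f i) * (fls_deriv (\<phi> (w i)) * inverse (\<phi> (w i)))))"
    by (simp add: fls_nth_sum)
  also have "\<dots> = (\<Sum>i\<in>I. f i * of_int (m i))"
    by (simp only: fls_residue_fls_const_times fls_residue_deriv_times_inverse_eq_subdegree m_def)
  finally have 1: "(\<Sum>i\<in>I. f i * of_int (m i)) = 0" by simp
  have tf: "t \<in> fractions L t"
    using poly_in_fractions[OF L(1), of "[:0, 1:]"] polys_over_pCons[OF L(1) subring_0[OF L(1)] polys_over_1[OF L(1)]]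
    by (simp add: one_pCons)
  have "\<phi> (t ^ e) = fls_X ^ e" for e
  proof (induction e)
    case 0
    then show ?case unfolding \<phi>_def using laurent_const[OF L subring_1[OF L(1)]] by simp
  next
    case (Suc e)
    then show ?case unfolding \<phi>_def using laurent_mult[OF L tf subring_power[OF F tf]] laurent_t[OF L] by simp
  qed
  then have "m i0 = int d" unfolding m_def i0(3) by (simp add: fls_subdegree_pow)
  then show "\<exists>m :: nat \<Rightarrow> int. (\<Sum>i\<in>I. f i * of_int (m i)) = 0 \<and> m i0 \<noteq> 0"
    using 1 i0(2) by (intro exI[of _ m]) auto
qed

subsection \<open>Norms and traces in simple extensions\<close>

lemma derivation_prod:
  assumes "derivation D" "finite I"
  shows "D (prod f I) = (\<Sum>i\<in>I. D (f i) * prod f (I - {i}))"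
  using assms(2)
proof (induction I rule: finite_induct)
  case (insert j I)
  have "(\<Sum>i\<in>I. D (f i) * prod f (insert j I - {i})) = (\<Sum>i\<in>I. f j * (D (f i) * prod f (I - {i})))"
  proof (rule sum.cong)
    fix i assume "i \<in> I"
    then have "insert j I - {i} = insert j (I - {i})" using insert by auto
    then show "D (f i) * prod f (insert j I - {i}) = f j * (D (f i) * prod f (I - {i}))"
      using insert by (simp add: mult_ac)
  qed simp
  then show ?case
    using insert by (simp add: derivation_mult[OF assms(1)] sum_distrib_left)
qed (simp add: derivation_1[OF assms(1)])

text \<open>The product rule differentiates one row at a time. \<open>B k\<close> is
  \<open>A\<close> with row \<open>k\<close> differentiated, and expansion along that row meets only
  cofactors of \<open>A\<close>.\<close>

lemma derivation_det:
  assumes D: "derivation D" and A: "A \<in> carrier_mat d d"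
  shows "D (det A) = (\<Sum>k<d. \<Sum>j<d. D (A $$ (k, j)) * cofactor A k j)"
proof -
  define B where "B k = mat d d (\<lambda>(i, j). if i = k then D (A $$ (i, j)) else A $$ (i, j))" for k
  have B: "B k \<in> carrier_mat d d" for k by (simp add: B_def)
  have [simp]: "D (signof p) = 0" for p :: "nat \<Rightarrow> nat"
    by (auto simp: sign_def derivation_1[OF D] derivation_minus[OF D])
  have "D (det A) = (\<Sum>p | p permutes {0..<d}. signof p * (\<Sum>k<d. D (A $$ (k, p k)) * (\<Prod>i\<in>{0..<d} - {k}. A $$ (i, p i))))"
    unfolding det_def'[OF A]
    by (simp add: derivation_sum[OF D] derivation_mult[OF D] derivation_prod[OF D] atLeast0LessThan)
  also have "\<dots> = (\<Sum>p | p permutes {0..<d}. signof p * (\<Sum>k<d. \<Prod>i = 0..<d. B k $$ (i, p i)))"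
  proof (intro sum.cong arg_cong2[where f = "(*)"] refl)
    fix p k assume "p \<in> {p. p permutes {0..<d}}" "k \<in> {..<d}"
    then have p: "i < d \<Longrightarrow> p i < d" and k: "k < d" for i using permutes_in_image[of p "{0..<d}" i] by auto
    have "(\<Prod>i = 0..<d. B k $$ (i, p i)) = B k $$ (k, p k) * (\<Prod>i\<in>{0..<d} - {k}. B k $$ (i, p i))"
      using k by (intro prod.remove) auto
    also have "(\<Prod>i\<in>{0..<d} - {k}. B k $$ (i, p i)) = (\<Prod>i\<in>{0..<d} - {k}. A $$ (i, p i))"
      using p by (intro prod.cong) (auto simp: B_def)
    finally show "D (A $$ (k, p k)) * (\<Prod>i\<in>{0..<d} - {k}. A $$ (i, p i)) = (\<Prod>i = 0..<d. B k $$ (i, p i))"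
      using p k by (simp add: B_def)
  qed
  also have "\<dots> = (\<Sum>k<d. det (B k))"
    unfolding det_def'[OF B] by (simp add: sum_distrib_left sum.swap[of _ "{..<d}"])
  also have "\<dots> = (\<Sum>k<d. \<Sum>j<d. D (A $$ (k, j)) * cofactor A k j)"
  proof (intro sum.cong refl)
    fix k assume "k \<in> {..<d}"
    then have k: "k < d" by simp
    have "mat_delete (B k) k j = mat_delete A k j" for j
      using A by (intro eq_matI) (auto simp: mat_delete_def B_def insert_index_def)
    then have "cofactor (B k) k j = cofactor A k j" for j by (simp add: cofactor_def)
    then show "det (B k) = (\<Sum>j<d. D (A $$ (k, j)) * cofactor A k j)"
      unfolding laplace_expansion_row[OF B k] using k by (intro sum.cong) (auto simp: B_def)
  qed
  finally show ?thesis .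
qed

text \<open>Jacobi's formula: the double sum is the trace of the differentiated matrix times the
  inverse \<open>N\<close>, and the adjugate of \<open>A\<close> is \<open>det A\<close> times
  \<open>N\<close>.\<close>

lemma derivation_det_inverse:
  fixes A N :: "'a::idom mat"
  assumes D: "derivation D" and A: "A \<in> carrier_mat d d" and N: "N \<in> carrier_mat d d" and AN: "A * N = 1\<^sub>m d"
  shows "D (det A) = det A * (\<Sum>k<d. \<Sum>j<d. D (A $$ (k, j)) * N $$ (j, k))"
proof -
  have "adj_mat A = adj_mat A * (A * N)" using adj_mat(1)[OF A] by (simp add: AN)
  also have "\<dots> = (adj_mat A * A) * N" using adj_mat(1)[OF A] A N by simp
  also have "\<dots> = det A \<cdot>\<^sub>m N" unfolding adj_mat(3)[OF A] using N by (subst mult_smult_assoc_mat[of _ d d _ d]) auto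
  finally have *: "adj_mat A = det A \<cdot>\<^sub>m N" .
  have "cofactor A k j = det A * N $$ (j, k)" if "k < d" "j < d" for k j
  proof -
    have "adj_mat A $$ (j, k) = cofactor A k j" using that A by (simp add: adj_mat_def)
    then show ?thesis unfolding * using that N by simp
  qed
  then show ?thesis
    unfolding derivation_det[OF D A] by (simp add: sum_distrib_left mult_ac)
qed

section \<open>Simple algebraic extensions inside the ambient field\<close>

lemma is_subfield_inverse: "is_subfield K \<Longrightarrow> a \<in> K \<Longrightarrow> inverse a \<in> K"
  by (simp add: is_subfield_def)

lemma is_subfield_divide: "is_subfield K \<Longrightarrow> a \<in> K \<Longrightarrow> b \<in> K \<Longrightarrow> a / b \<in> K"
  unfolding divide_inverse by (intro subring_mult is_subfield_subring is_subfield_inverse)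

definition adjoin :: "'a::idom set \<Rightarrow> 'a \<Rightarrow> 'a set" where
  "adjoin V a = (\<lambda>q. poly q a) ` polys_over V"

lemma subring_adjoin:
  assumes V: "subring V"
  shows "subring (adjoin V a)"
  unfolding subring_def
proof (intro conjI ballI)
  show "1 \<in> adjoin V a"
    unfolding adjoin_def using polys_over_1[OF V] by (force simp: image_iff)
  fix b c assume "b \<in> adjoin V a" "c \<in> adjoin V a"
  then obtain p q where *: "p \<in> polys_over V" "q \<in> polys_over V" "b = poly p a" "c = poly q a"
    by (auto simp: adjoin_def)
  then have "b - c = poly (p - q) a" "b * c = poly (p * q) a" by simp_all
  then show "b - c \<in> adjoin V a" "b * c \<in> adjoin V a"
    unfolding adjoin_def using polys_over_diff[OF V *(1,2)] polys_over_mult[OF V *(1,2)] by blast+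
qed

lemma
  assumes V: "subring V"
  shows adjoin_superset: "V \<subseteq> adjoin V a" and adjoin_mem: "a \<in> adjoin V a"
proof -
  show "V \<subseteq> adjoin V a"
    unfolding adjoin_def using polys_over_const[OF V] by (force simp: image_iff)
  have "[:0, 1:] \<in> polys_over V"
    by (intro polys_over_pCons V subring_0 subring_1 polys_over_0)
  then show "a \<in> adjoin V a" unfolding adjoin_def by (force simp: image_iff)
qed

text \<open>Inverses come from a descent on the degree: dividing \<open>p\<close> by
  \<open>q\<close> leaves a remainder \<open>r\<close> with \<open>r(a) = - s(a) q(a)\<close>, so an
  inverse of \<open>r(a)\<close> gives one of \<open>q(a)\<close>. If \<open>r(a)\<close> were
  \<open>0\<close>, then \<open>p\<close> would split up to a constant as \<open>s * q\<close> with
  \<open>s(a) = 0\<close>, against minimality.\<close>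

lemma is_subfield_adjoin:
  fixes a :: "'a::field"
  assumes V: "is_subfield V" and alg: "algebraic_over V a"
  shows "is_subfield (adjoin V a)"
proof -
  note R = is_subfield_subring[OF V]
  note S = subring_adjoin[OF R, of a]
  obtain p where p: "p \<in> polys_over V" "poly p a = 0" "0 < degree p"
    and min: "\<And>q. q \<in> polys_over V \<Longrightarrow> poly q a = 0 \<Longrightarrow> degree q < degree p \<Longrightarrow> q = 0"
    using minimal_annihilator[OF alg] by metis
  have inv: "inverse (poly q a) \<in> adjoin V a"
    if "q \<in> polys_over V" "poly q a \<noteq> 0" "degree q < degree p" for q
    using that
  proof (induction "degree q" arbitrary: q rule: less_induct)
    case less
    show ?case
    proof (cases "degree q = 0")
      case True
      then obtain c where c: "q = [:c:]" by (auto elim: degree_eq_zeroE)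
      then have "c \<in> V" using less.prems(1) by (auto simp: polys_over_def dest: spec[of _ 0])
      then show ?thesis using c is_subfield_inverse[OF V] adjoin_superset[OF R] by auto
    next
      case False
      obtain l s r where lsr: "l \<in> V" "l \<noteq> 0" "s \<in> polys_over V" "r \<in> polys_over V"
        "degree r < degree q" "[:l:] * p = s * q + r"
        using pseudo_division[OF R less.prems(1) _ p(1)] False by auto
      have sr: "poly s a * poly q a = - poly r a"
        using arg_cong[OF lsr(6), of "\<lambda>q. poly q a"] p(2) by (simp add: eq_neg_iff_add_eq_0)
      have "poly r a \<noteq> 0"
      proof
        assume r0: "poly r a = 0"
        then have "r = 0" using min lsr less.prems(3) by simp
        have s0: "poly s a = 0" using sr r0 less.prems(2) by simp
        have eq: "smult l p = s * q" using lsr(6) \<open>r = 0\<close> by simp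
        have "s \<noteq> 0" using eq lsr(2) p(3) by auto
        then have "degree p = degree s + degree q"
          using arg_cong[OF eq, of degree] lsr(2) False by (subst (asm) degree_mult_eq) auto
        then show False using min[OF lsr(3) s0] False \<open>s \<noteq> 0\<close> by simp
      qed
      then have "inverse (poly r a) \<in> adjoin V a" using less.hyps[OF lsr(5,4)] lsr(5) less.prems(3) by simp
      moreover have "inverse (poly q a) = (0 - poly s a) * inverse (poly r a)"
        using sr less.prems(2) \<open>poly r a \<noteq> 0\<close> by (simp add: field_simps)
      moreover have "poly s a \<in> adjoin V a" using lsr(3) by (simp add: adjoin_def)
      ultimately show ?thesis
        using subring_mult[OF S] subring_diff[OF S] subring_0[OF S] by metis
    qed
  qed
  have "inverse c \<in> adjoin V a" if c: "c \<in> adjoin V a" for c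
  proof (cases "c = 0")
    case True
    then show ?thesis using c by simp
  next
    case False
    obtain q where q: "q \<in> polys_over V" "c = poly q a" using c by (auto simp: adjoin_def)
    obtain l s r where lsr: "l \<in> V" "l \<noteq> 0" "s \<in> polys_over V" "r \<in> polys_over V"
        "degree r < degree p" "[:l:] * q = s * p + r"
      using pseudo_division[OF R p(1,3) q(1)] by blast
    have "l * c = poly r a" using arg_cong[OF lsr(6), of "\<lambda>q. poly q a"] p(2) q(2) by simp
    then have "poly r a \<noteq> 0" "inverse c = l * inverse (poly r a)" using lsr(2) False by (auto simp: field_simps)
    then show ?thesis
      using inv[OF lsr(4) _ lsr(5)] subring_mult[OF S] lsr(1) adjoin_superset[OF R, of a] by auto
  qed
  then show ?thesis
    unfolding is_subfield_def
    by (intro conjI ballI subring_0[OF S] subring_1[OF S] subring_add[OF S] subring_mult[OF S] subring_uminus[OF S])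
qed

text \<open>Differentiating the minimal relation expresses \<open>D a\<close> as a quotient of
  elements of \<open>adjoin V a\<close>, which is a field.\<close>

lemma derivation_adjoin:
  fixes a :: "'a::field_char_0"
  assumes V: "is_subfield V" and alg: "algebraic_over V a" and D: "derivation D" "D ` V \<subseteq> V"
  shows "D ` adjoin V a \<subseteq> adjoin V a"
proof -
  note R = is_subfield_subring[OF V]
  note F = is_subfield_adjoin[OF V alg]
  note S = is_subfield_subring[OF F]
  obtain p where p: "p \<in> polys_over V" "poly p a = 0" "0 < degree p"
    and min: "\<And>q. q \<in> polys_over V \<Longrightarrow> poly q a = 0 \<Longrightarrow> degree q < degree p \<Longrightarrow> q = 0"
    using minimal_annihilator[OF alg] by metis
  have Dq: "map_poly D q \<in> polys_over V" if "q \<in> polys_over V" for q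
    using that D(2) by (auto simp: polys_over_def coeff_map_poly derivation_0[OF D(1)])
  have mem: "poly q a \<in> adjoin V a" if "q \<in> polys_over V" for q using that by (simp add: adjoin_def)
  have nz: "poly (pderiv p) a \<noteq> 0"
    by (rule pderiv_minimal_annihilator_nonzero[OF R p(1,3) min])
  have "D a = (0 - poly (map_poly D p) a) / poly (pderiv p) a"
    using derivation_poly[OF D(1), of p a] p(2) nz by (simp add: derivation_0[OF D(1)] field_simps eq_neg_iff_add_eq_0)
  moreover have "(0 - poly (map_poly D p) a) / poly (pderiv p) a \<in> adjoin V a"
    by (intro is_subfield_divide[OF F] subring_diff[OF S] subring_0[OF S] mem Dq polys_over_pderiv R p)
  ultimately have "D a \<in> adjoin V a" by simp
  then have "D (poly q a) \<in> adjoin V a" if "q \<in> polys_over V" for q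
    unfolding derivation_poly[OF D(1)]
    using that by (intro subring_add[OF S] subring_mult[OF S] mem Dq polys_over_pderiv R)
  then show ?thesis by (auto simp: adjoin_def)
qed

text \<open>The powers of \<open>a\<close> below the minimal degree \<open>d\<close> form a basis
  over \<open>V\<close>. Uniqueness is stated as a rule for recognising coordinates, from which
  linearity of \<open>co\<close> is derived when it is used.\<close>

lemma adjoin_basis:
  fixes a :: "'a::field"
  assumes V: "is_subfield V" and alg: "algebraic_over V a"
  obtains d and co :: "'a \<Rightarrow> nat \<Rightarrow> 'a" where "0 < d"
    "\<And>w j. w \<in> adjoin V a \<Longrightarrow> co w j \<in> V"
    "\<And>w. w \<in> adjoin V a \<Longrightarrow> (\<Sum>j<d. co w j * a ^ j) = w"
    "\<And>c w j. (\<And>j. j < d \<Longrightarrow> c j \<in> V) \<Longrightarrow> (\<Sum>j<d. c j * a ^ j) = w \<Longrightarrow> j < d \<Longrightarrow> co w j = c j"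
proof -
  note R = is_subfield_subring[OF V]
  obtain p where p: "p \<in> polys_over V" "poly p a = 0" "0 < degree p"
    and min: "\<And>q. q \<in> polys_over V \<Longrightarrow> poly q a = 0 \<Longrightarrow> degree q < degree p \<Longrightarrow> q = 0"
    using minimal_annihilator[OF alg] by metis
  define d where "d = degree p"
  have ex: "\<exists>c. (\<forall>j. c j \<in> V) \<and> (\<Sum>j<d. c j * a ^ j) = w" if w: "w \<in> adjoin V a" for w
  proof -
    obtain q where q: "q \<in> polys_over V" "w = poly q a" using w by (auto simp: adjoin_def)
    obtain l s r where lsr: "l \<in> V" "l \<noteq> 0" "s \<in> polys_over V" "r \<in> polys_over V"
        "degree r < degree p" "[:l:] * q = s * p + r"
      using pseudo_division[OF R p(1,3) q(1)] by blast
    have "l * w = poly r a" using arg_cong[OF lsr(6), of "\<lambda>q. poly q a"] p(2) q(2) by simp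
    also have "\<dots> = (\<Sum>j<d. coeff r j * a ^ j)"
      unfolding poly_altdef d_def
      using lsr(5) by (intro sum.mono_neutral_left) (auto simp: coeff_eq_0)
    finally have "w = (\<Sum>j<d. coeff r j / l * a ^ j)"
      using lsr(2) by (simp add: sum_divide_distrib[symmetric] field_simps)
    moreover have "coeff r j / l \<in> V" for j
      using lsr(1,4) by (intro is_subfield_divide[OF V]) (auto simp: polys_over_def)
    ultimately show ?thesis by metis
  qed
  then obtain co where co: "\<And>w. w \<in> adjoin V a \<Longrightarrow> (\<forall>j. co w j \<in> V) \<and> (\<Sum>j<d. co w j * a ^ j) = w" by metis
  have uniq: "c j = c' j"
    if c: "\<And>j. j < d \<Longrightarrow> c j \<in> V" and c': "\<And>j. j < d \<Longrightarrow> c' j \<in> V"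
      and eq: "(\<Sum>j<d. c j * a ^ j) = (\<Sum>j<d. c' j * a ^ j)" and "j < d" for c c' j
  proof -
    define q where "q = (\<Sum>j<d. monom (c j - c' j) j)"
    have cq: "coeff q i = (if i < d then c i - c' i else 0)" for i
      by (simp add: q_def coeff_sum)
    have "q \<in> polys_over V"
      using c c' by (auto simp: polys_over_def cq intro: subring_diff[OF R] subring_0[OF R])
    moreover have "poly q a = 0" using eq by (simp add: q_def poly_sum poly_monom left_diff_distrib sum_subtractf)
    moreover have "degree q < degree p"
      unfolding d_def[symmetric] using p(3) by (intro degree_lessI) (auto simp: cq d_def)
    ultimately have "q = 0" by (rule min)
    then show ?thesis using cq[of j] \<open>j < d\<close> by simp
  qed
  have "co w j = c j" if "\<And>j. j < d \<Longrightarrow> c j \<in> V" "(\<Sum>j<d. c j * a ^ j) = w" "j < d" for c w j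
  proof (rule uniq)
    define q where "q = (\<Sum>j<d. monom (c j) j)"
    have "q \<in> polys_over V"
      using that(1) by (auto simp: polys_over_def q_def coeff_sum intro: subring_0[OF R])
    moreover have "poly q a = w" using that(2) by (simp add: q_def poly_sum poly_monom)
    ultimately have "w \<in> adjoin V a" by (auto simp: adjoin_def)
    then show "co w j \<in> V" "(\<Sum>j<d. co w j * a ^ j) = (\<Sum>j<d. c j * a ^ j)" for j using co that(2) by auto
  qed (use that in auto)
  then show ?thesis using that[of d co] p(3) co unfolding d_def by blast
qed

text \<open>
  A relation over \<open>V(a)\<close> descends to \<open>V\<close> through the trace, which turns \<open>D w / w\<close> into the
  logarithmic derivative of the norm of \<open>w\<close>. This avoids places of algebraic function fields.
\<close>

lemma residue_property_adjoin:
  fixes t a :: "'a::field_char_0"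
  assumes V: "is_subfield V" "L \<subseteq> V" "t \<in> V" and alg: "algebraic_over V a"
    and D: "derivation D" "D ` V \<subseteq> V" "\<forall>c\<in>L. D c = 0"
    and res: "residue_property D L t V"
  shows "residue_property D L t (adjoin V a)"
proof -
  note R = is_subfield_subring[OF V(1)]
  define F where "F = adjoin V a"
  have F: "is_subfield F" unfolding F_def by (rule is_subfield_adjoin[OF V(1) alg])
  note S = is_subfield_subring[OF F]
  have DF: "D w \<in> F" if "w \<in> F" for w
    using derivation_adjoin[OF V(1) alg D(1,2)] that by (auto simp: F_def)
  have VF: "c \<in> F" if "c \<in> V" for c using adjoin_superset[OF R] that by (auto simp: F_def)
  have aF: "a ^ i \<in> F" for i using subring_power[OF S] adjoin_mem[OF R] by (simp add: F_def)
  obtain d and co :: "'a \<Rightarrow> nat \<Rightarrow> 'a" where d: "0 < d"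
    and coV: "\<And>w j. w \<in> F \<Longrightarrow> co w j \<in> V"
    and co: "\<And>w. w \<in> F \<Longrightarrow> (\<Sum>j<d. co w j * a ^ j) = w"
    and coI: "\<And>c w j. (\<And>j. j < d \<Longrightarrow> c j \<in> V) \<Longrightarrow> (\<Sum>j<d. c j * a ^ j) = w \<Longrightarrow> j < d \<Longrightarrow> co w j = c j"
    unfolding F_def by (rule adjoin_basis[OF V(1) alg]) blast
  have co_add: "co (x + y) j = co x j + co y j" if "x \<in> F" "y \<in> F" "j < d" for x y j
    by (rule coI) (use that in \<open>auto simp: distrib_right sum.distrib co intro: subring_add[OF R] coV\<close>)
  have co_scale: "co (c * x) j = c * co x j" if "c \<in> V" "x \<in> F" "j < d" for c x j
    by (rule coI) (use that in \<open>auto simp: mult.assoc sum_distrib_left[symmetric] co intro: subring_mult[OF R] coV\<close>)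
  have co_power: "co (c * a ^ i) j = (if i = j then c else 0)" if "c \<in> V" "i < d" "j < d" for c i j
    by (rule coI[of "\<lambda>j. if i = j then c else 0"])
      (use that in \<open>auto intro: subring_0[OF R] simp: if_distrib[of "\<lambda>u. u * _"] cong: if_cong\<close>)
  have co_sum: "co (\<Sum>i\<in>I. g i) j = (\<Sum>i\<in>I. co (g i) j)"
    if "\<And>i. i \<in> I \<Longrightarrow> g i \<in> F" "j < d" for g j and I :: "nat set"
    using that(1)
  proof (induction I rule: infinite_finite_induct)
    case (insert i I)
    then show ?case using that(2) by (simp add: co_add subring_sum[OF S])
  qed (use that(2) co_scale[of 0 1] subring_0[OF R] subring_1[OF S] in auto)
  \<comment> \<open>Row \<open>i\<close> of \<open>M w\<close> holds the coordinates of
    \<open>w * a ^ i\<close>, so \<open>M w\<close> represents multiplication by \<open>w\<close>,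
    \<open>T\<close> is the trace to \<open>V\<close>, and \<open>det (M w)\<close> the
    norm.\<close>
  define m where "m w i j = co (w * a ^ i) j" for w i j
  define T where "T w = (\<Sum>i<d. m w i i)" for w
  define M where "M w = mat d d (\<lambda>(i, j). m w i j)" for w
  have M: "M w \<in> carrier_mat d d" for w by (simp add: M_def)
  have mV: "m w i j \<in> V" if "w \<in> F" for w i j
    unfolding m_def by (intro coV subring_mult[OF S] that aF)
  have m_eq: "w * a ^ i = (\<Sum>j<d. m w i j * a ^ j)" if "w \<in> F" for w i
    unfolding m_def by (rule co[symmetric]) (intro subring_mult[OF S] that aF)
  have m_mult: "m (w * z) i j = (\<Sum>k<d. m z i k * m w k j)" if w: "w \<in> F" "z \<in> F" "j < d" for w z i j
  proof -
    have "w * z * a ^ i = w * (\<Sum>k<d. m z i k * a ^ k)" using m_eq[OF w(2)] by (simp add: mult.assoc)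
    also have "\<dots> = (\<Sum>k<d. m z i k * (w * a ^ k))" by (simp add: sum_distrib_left mult_ac)
    finally have "co (w * z * a ^ i) j = (\<Sum>k<d. co (m z i k * (w * a ^ k)) j)"
      using w by (simp add: co_sum subring_mult[OF S] VF mV aF)
    also have "\<dots> = (\<Sum>k<d. m z i k * m w k j)"
      using w by (simp add: co_scale mV subring_mult[OF S] aF m_def[of w])
    finally show ?thesis by (simp add: m_def[of "w * z"])
  qed
  have m_add: "m (x + y) i j = m x i j + m y i j" if "x \<in> F" "y \<in> F" "j < d" for x y i j
    unfolding m_def using that by (simp add: distrib_right co_add subring_mult[OF S] aF)
  have T_add: "T (x + y) = T x + T y" if "x \<in> F" "y \<in> F" for x y
    using that by (simp add: T_def m_add sum.distrib)
  have T_scale: "T (c * x) = c * T x" if "c \<in> V" "x \<in> F" for c x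
    using that by (simp add: T_def m_def mult.assoc co_scale subring_mult[OF S] aF sum_distrib_left)
  have T_sum: "T (\<Sum>i\<in>I. g i) = (\<Sum>i\<in>I. T (g i))" if "\<And>i. i \<in> I \<Longrightarrow> g i \<in> F" for g and I :: "nat set"
    using that
  proof (induction I rule: infinite_finite_induct)
    case (insert i I)
    then show ?case by (simp add: T_add subring_sum[OF S])
  qed (use T_scale[of 0 1] subring_0[OF R] subring_1[OF S] in auto)
  \<comment> \<open>\<open>A\<close> is the matrix of \<open>D\<close> on the basis. With it
    \<open>m_deriv\<close> says that \<open>M (D w)\<close> is the entrywise derivative of
    \<open>M w\<close> plus the commutator of \<open>M w\<close> and \<open>A\<close>; the trace
    does not see the commutator, so it commutes with \<open>D\<close>.\<close>
  define A where "A i j = co (D (a ^ i)) j" for i j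
  have AV: "A i j \<in> V" for i j unfolding A_def by (intro coV DF aF)
  have A_eq: "D (a ^ i) = (\<Sum>j<d. A i j * a ^ j)" for i
    unfolding A_def by (rule co[symmetric]) (intro DF aF)
  have m_deriv: "m (D w) i j = D (m w i j) + (\<Sum>k<d. m w i k * A k j) - (\<Sum>k<d. A i k * m w k j)"
    if w: "w \<in> F" and ij: "i < d" "j < d" for w i j
  proof -
    have "D (w * a ^ i) = (\<Sum>k<d. D (m w i k) * a ^ k + m w i k * D (a ^ k))"
      unfolding m_eq[OF w, of i] by (simp add: derivation_sum[OF D(1)] derivation_mult[OF D(1)] add.commute)
    then have "co (D (w * a ^ i)) j = (\<Sum>k<d. co (D (m w i k) * a ^ k) j) + (\<Sum>k<d. co (m w i k * D (a ^ k)) j)"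
      using w ij by (simp add: co_sum co_add sum.distrib subring_add[OF S] subring_mult[OF S] subring_sum[OF S] VF DF mV aF)
    also have "(\<Sum>k<d. co (D (m w i k) * a ^ k) j) = D (m w i j)"
    proof -
      have "D (m w i k) \<in> V" for k using mV[OF w] D(2) by blast
      then show ?thesis using ij by (simp add: co_power if_distrib[of "\<lambda>u. _ u"] cong: if_cong)
    qed
    also have "(\<Sum>k<d. co (m w i k * D (a ^ k)) j) = (\<Sum>k<d. m w i k * A k j)"
      using w ij by (simp add: co_scale mV DF aF A_def)
    finally have 1: "co (D (w * a ^ i)) j = D (m w i j) + (\<Sum>k<d. m w i k * A k j)" .
    have "D (w * a ^ i) = D w * a ^ i + (\<Sum>k<d. A i k * (w * a ^ k))"
      unfolding derivation_mult[OF D(1)] A_eq[of i] by (simp add: sum_distrib_left mult_ac add.commute)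
    then have "co (D (w * a ^ i)) j = m (D w) i j + (\<Sum>k<d. A i k * m w k j)"
      using w ij by (simp add: co_sum co_add co_scale m_def AV subring_mult[OF S] subring_sum[OF S] VF DF aF)
    with 1 have "m (D w) i j + (\<Sum>k<d. A i k * m w k j) = D (m w i j) + (\<Sum>k<d. m w i k * A k j)" by simp
    then show ?thesis by (simp only: eq_diff_eq)
  qed
  have T_deriv: "T (D w) = D (T w)" if w: "w \<in> F" for w
  proof -
    have "T (D w) = (\<Sum>i<d. D (m w i i)) + (\<Sum>i<d. \<Sum>k<d. m w i k * A k i) - (\<Sum>i<d. \<Sum>k<d. A i k * m w k i)"
      by (simp add: T_def m_deriv[OF w] sum.distrib sum_subtractf)
    also have "(\<Sum>i<d. \<Sum>k<d. m w i k * A k i) = (\<Sum>i<d. \<Sum>k<d. A i k * m w k i)"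
      by (subst sum.swap) (simp add: mult.commute)
    finally show ?thesis by (simp add: T_def derivation_sum[OF D(1)])
  qed
  have m_1: "m c i j = (if i = j then c else 0)" if "c \<in> V" "i < d" "j < d" for c i j
    unfolding m_def using that by (rule co_power)
  have T_logderiv: "det (M w) \<noteq> 0 \<and> T (D w / w) = D (det (M w)) / det (M w)" if w: "w \<in> F" "w \<noteq> 0" for w
  proof -
    define z where "z = inverse w"
    have z: "z \<in> F" using is_subfield_inverse[OF F] w by (simp add: z_def)
    have wz: "w * z = 1" using w by (simp add: z_def)
    have mm: "(\<Sum>k<d. m w i k * m z k j) = (if i = j then 1 else 0)"
      "(\<Sum>k<d. m z i k * m w k j) = (if i = j then 1 else 0)" if "i < d" "j < d" for i j
      using m_mult[OF z w(1) that(2), of i] m_mult[OF w(1) z that(2), of i] m_1[OF subring_1[OF R] that] wz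
      by (simp_all add: mult.commute)
    have MM: "M w * M z = 1\<^sub>m d"
      by (rule eq_matI) (auto simp: M_def scalar_prod_def mm atLeast0LessThan)
    have det: "det (M w) \<noteq> 0"
      using arg_cong[OF MM, of det] det_mult[OF M[of w] M[of z]] by auto
    \<comment> \<open>After multiplication by \<open>M z\<close>, the inverse of \<open>M w\<close>,
      both halves of the commutator have the trace of \<open>A\<close> and cancel. What remains is
      Jacobi's formula for the norm.\<close>
    have assoc: "(\<Sum>i<d. \<Sum>k<d. m z i k * (\<Sum>l<d. m w k l * A l i)) = (\<Sum>i<d. A i i)"
    proof (intro sum.cong refl)
      fix i assume i: "i \<in> {..<d}"
      have "(\<Sum>k<d. m z i k * (\<Sum>l<d. m w k l * A l i)) = (\<Sum>k<d. \<Sum>l<d. m z i k * m w k l * A l i)"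
        by (simp add: sum_distrib_left mult.assoc)
      also have "\<dots> = (\<Sum>l<d. (\<Sum>k<d. m z i k * m w k l) * A l i)"
        by (subst sum.swap) (simp add: sum_distrib_right)
      also have "\<dots> = A i i"
        using i by (simp add: mm if_distrib[of "\<lambda>u. u * _"] cong: if_cong)
      finally show "(\<Sum>k<d. m z i k * (\<Sum>l<d. m w k l * A l i)) = A i i" .
    qed
    have assoc': "(\<Sum>i<d. \<Sum>k<d. m z i k * (\<Sum>l<d. A k l * m w l i)) = (\<Sum>i<d. A i i)"
    proof -
      have "(\<Sum>i<d. \<Sum>k<d. m z i k * (\<Sum>l<d. A k l * m w l i)) = (\<Sum>i<d. \<Sum>k<d. \<Sum>l<d. A k l * (m w l i * m z i k))"
        by (simp add: sum_distrib_left mult_ac)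
      also have "\<dots> = (\<Sum>k<d. \<Sum>i<d. \<Sum>l<d. A k l * (m w l i * m z i k))" by (rule sum.swap)
      also have "\<dots> = (\<Sum>k<d. \<Sum>l<d. A k l * (\<Sum>i<d. m w l i * m z i k))"
        by (rule sum.cong[OF refl], subst sum.swap) (simp add: sum_distrib_left)
      also have "\<dots> = (\<Sum>k<d. A k k)"
        by (simp add: mm if_distrib[of "\<lambda>u. _ * u"] cong: if_cong)
      finally show ?thesis .
    qed
    have "D w / w = D w * z" by (simp add: z_def divide_inverse)
    then have "T (D w / w) = (\<Sum>i<d. \<Sum>k<d. m z i k * m (D w) k i)"
      using m_mult[OF DF[OF w(1)] z] by (simp add: T_def)
    also have "\<dots> = (\<Sum>i<d. \<Sum>k<d. m z i k * D (m w k i))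
        + (\<Sum>i<d. \<Sum>k<d. m z i k * (\<Sum>l<d. m w k l * A l i))
        - (\<Sum>i<d. \<Sum>k<d. m z i k * (\<Sum>l<d. A k l * m w l i))"
      by (simp add: m_deriv[OF w(1)] distrib_left right_diff_distrib sum.distrib sum_subtractf)
    also have "\<dots> = (\<Sum>i<d. \<Sum>k<d. m z i k * D (m w k i))" unfolding assoc assoc' by simp
    also have "\<dots> = (\<Sum>k<d. \<Sum>j<d. D (M w $$ (k, j)) * M z $$ (j, k))"
      by (subst sum.swap) (simp add: M_def mult.commute)
    also have "\<dots> = D (det (M w)) / det (M w)"
      using derivation_det_inverse[OF D(1) M M MM] det by simp
    finally show ?thesis using det by simp
  qed
  have detV: "det (M w) \<in> V" if "w \<in> F" for w
    unfolding det_def'[OF M]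
  proof (intro subring_sum[OF R] subring_mult[OF R] subring_prod[OF R])
    show "signof p \<in> V" for p :: "nat \<Rightarrow> nat"
      by (auto simp: sign_def subring_1[OF R] subring_uminus[OF R])
    fix p i assume "p \<in> {p. p permutes {0..<d}}" "i \<in> {0..<d}"
    then have "i < d" "p i < d" using permutes_in_image[of p "{0..<d}" i] by auto
    then show "M w $$ (i, p i) \<in> V" using mV[OF that] by (simp add: M_def)
  qed
  have det_const: "det (M c) = c ^ d" if "c \<in> V" for c
  proof -
    have "M c = c \<cdot>\<^sub>m 1\<^sub>m d" by (rule eq_matI) (auto simp: M_def m_1[OF that])
    then show ?thesis by (simp add: det_smult)
  qed
  show ?thesis
    unfolding residue_property_def F_def[symmetric]
  proof (intro allI impI)
    fix I :: "nat set" and f w v i0 and e :: nat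
    assume I: "finite I" and f: "f ` I \<subseteq> L" and w: "w ` I \<subseteq> F - {0}" and v: "v \<in> F"
      and i0: "i0 \<in> I" "0 < e" "w i0 = t ^ e" and eq: "(\<Sum>i\<in>I. f i * (D (w i) / w i)) = D v"
    have wi: "w i \<in> F" "w i \<noteq> 0" "f i \<in> V" "D (w i) / w i \<in> F" if "i \<in> I" for i
      using that w f V(2) by (auto intro!: is_subfield_divide[OF F] DF)
    have "D (T v) = T (\<Sum>i\<in>I. f i * (D (w i) / w i))" using T_deriv[OF v] eq by simp
    also have "\<dots> = (\<Sum>i\<in>I. T (f i * (D (w i) / w i)))"
      by (intro T_sum subring_mult[OF S] VF wi)
    also have "\<dots> = (\<Sum>i\<in>I. f i * (D (det (M (w i))) / det (M (w i))))"
    proof (rule sum.cong[OF refl])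
      fix i assume i: "i \<in> I"
      show "T (f i * (D (w i) / w i)) = f i * (D (det (M (w i))) / det (M (w i)))"
        unfolding T_scale[OF wi(3)[OF i] wi(4)[OF i]] using T_logderiv[OF wi(1)[OF i] wi(2)[OF i]] by simp
    qed
    finally have "(\<Sum>i\<in>I. f i * (D (det (M (w i))) / det (M (w i)))) = D (T v)" by simp
    moreover have "(\<lambda>i. det (M (w i))) ` I \<subseteq> V - {0}" using wi detV T_logderiv by auto
    moreover have "T v \<in> V" unfolding T_def by (intro subring_sum[OF R] mV v)
    \<comment> \<open>The norm of \<open>t ^ e\<close> is again a positive power of
      \<open>t\<close>, so the property of \<open>V\<close> applies, and its integers serve
      unchanged for the relation over the extension.\<close>
    moreover have "det (M (w i0)) = t ^ (e * d)"
      using det_const[OF subring_power[OF R V(3)]] i0(3) by (simp add: power_mult)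
    moreover have "0 < e * d" using d i0 by simp
    ultimately show "\<exists>m :: nat \<Rightarrow> int. (\<Sum>i\<in>I. f i * of_int (m i)) = 0 \<and> m i0 \<noteq> 0"
      using res I f i0(1) unfolding residue_property_def by blast
  qed
qed

text \<open>A relation for \<open>t\<close> with coefficients in \<open>L[a]\<close> is a relation
  in two variables; collecting powers of \<open>a\<close> instead gives one over
  \<open>L(t)\<close>. It is not trivial because each of its coefficients is a polynomial in
  \<open>t\<close> over \<open>L\<close>, and \<open>t\<close> is transcendental over
  \<open>L\<close>.\<close>

lemma algebraic_over_exchange:
  fixes a t :: "'a::field_char_0"
  assumes L: "subring L" and t: "\<not> algebraic_over L t" and alg: "algebraic_over (adjoin L a) t"
  shows "algebraic_over (fractions L t) a"
proof -
  obtain G where G: "G \<in> polys_over (adjoin L a)" "G \<noteq> 0" "poly G t = 0"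
    using alg by (auto simp: algebraic_over_def)
  have "\<forall>i. \<exists>q. q \<in> polys_over L \<and> coeff G i = poly q a"
    using G(1) unfolding polys_over_def[of "adjoin L a"] unfolding adjoin_def by auto
  then obtain g where g: "\<And>i. g i \<in> polys_over L" "\<And>i. coeff G i = poly (g i) a" by metis
  define H where "H = (\<Sum>i\<le>degree G. smult (t ^ i) (g i))"
  note S = is_subfield_subring[OF is_subfield_fractions[OF L, of t]]
  have "[:0, 1:] \<in> polys_over L" by (intro polys_over_pCons L subring_0 subring_1 polys_over_0)
  from poly_in_fractions[OF L this, of t] have tS: "t \<in> fractions L t" by simp
  have gS: "g i \<in> polys_over (fractions L t)" for i
    using g(1)[of i] poly_in_fractions[OF L polys_over_const[OF L], of _ t] by (auto simp: polys_over_def)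
  have "H \<in> polys_over (fractions L t)"
    unfolding H_def by (intro subring_sum subring_polys_over S polys_over_smult subring_power tS gS)
  moreover have "poly H a = 0"
    using G(3) unfolding H_def poly_altdef[of G] by (simp add: poly_sum g(2) mult.commute)
  moreover have "H \<noteq> 0"
  proof
    assume "H = 0"
    have "coeff (g i) j = 0" if "i \<le> degree G" for i j
    proof -
      define q where "q = (\<Sum>i\<le>degree G. monom (coeff (g i) j) i)"
      have "q \<in> polys_over L"
        unfolding q_def
        by (intro subring_sum subring_polys_over L polys_over_monom) (use g(1) in \<open>simp add: polys_over_def\<close>)
      moreover have "poly q t = coeff H j"
        unfolding q_def H_def by (simp add: poly_sum poly_monom coeff_sum mult.commute)
      ultimately have "q = 0" using t \<open>H = 0\<close> by (auto simp: algebraic_over_def)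
      then have "coeff q i = 0" by simp
      then show ?thesis using that unfolding q_def by (simp add: coeff_sum)
    qed
    then have "g i = 0" if "i \<le> degree G" for i using that by (intro poly_eqI) simp
    then have "lead_coeff G = 0" using g(2)[of "degree G"] by simp
    then show False using G(2) by simp
  qed
  ultimately show ?thesis by (auto simp: algebraic_over_def)
qed

text \<open>Zorn's lemma applies because a polynomial over the union of a chain has coefficients in
  one member. For a maximal \<open>L\<close>, an element \<open>a\<close> outside \<open>L\<close>
  makes \<open>t\<close> algebraic over \<open>L[a]\<close>, and the exchange makes \<open>a\<close>
  algebraic over \<open>L(t)\<close>.\<close>

lemma maximal_subring_transcendental:
  fixes t :: "'a::field_char_0"
  assumes "subring k" "\<not> algebraic_over k t"
  obtains L where "subring L" "k \<subseteq> L" "\<not> algebraic_over L t" "\<And>a. algebraic_over (fractions L t) a"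
proof -
  define A where "A = {L. subring L \<and> k \<subseteq> L \<and> \<not> algebraic_over L t}"
  have "\<exists>M\<in>A. \<forall>X\<in>A. M \<subseteq> X \<longrightarrow> X = M"
  proof (rule subset_Zorn_nonempty)
    show "A \<noteq> {}" using assms by (auto simp: A_def)
    fix C assume C: "C \<noteq> {}" "subset.chain A C"
    have H: "subring H" "k \<subseteq> H" "\<not> algebraic_over H t" if "H \<in> C" for H
      using that C by (auto simp: A_def subset_chain_def)
    have join: "\<exists>H\<in>C. X \<subseteq> H" if "finite X" "X \<subseteq> \<Union>C" for X
      using finite_subset_Union_chain[OF that C] by metis
    have "subring (\<Union>C)"
      unfolding subring_def
    proof (intro conjI ballI)
      show "1 \<in> \<Union>C" using C(1) H(1) subring_1 by blast
      fix a b assume "a \<in> \<Union>C" "b \<in> \<Union>C"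
      then obtain K where K: "K \<in> C" "a \<in> K" "b \<in> K" using join[of "{a, b}"] by auto
      then show "a - b \<in> \<Union>C" "a * b \<in> \<Union>C"
        using subring_diff[OF H(1)[OF K(1)] K(2,3)] subring_mult[OF H(1)[OF K(1)] K(2,3)] by blast+
    qed
    moreover have "\<not> algebraic_over (\<Union>C) t"
    proof
      assume "algebraic_over (\<Union>C) t"
      then obtain q where q: "q \<in> polys_over (\<Union>C)" "q \<noteq> 0" "poly q t = 0" by (auto simp: algebraic_over_def)
      have "range (coeff q) \<subseteq> insert 0 (coeff q ` {..degree q})" using le_degree by fastforce
      then have "finite (range (coeff q))" by (rule finite_subset) simp
      moreover have "range (coeff q) \<subseteq> \<Union>C" using q(1) unfolding polys_over_def by blast
      ultimately obtain K where K: "K \<in> C" "range (coeff q) \<subseteq> K" using join by blast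
      then have "q \<in> polys_over K" by (auto simp: polys_over_def)
      then show False using H(3)[OF K(1)] q(2,3) unfolding algebraic_over_def by blast
    qed
    moreover obtain K where "K \<in> C" using C(1) by blast
    moreover from this have "k \<subseteq> K" by (rule H(2))
    ultimately show "\<Union>C \<in> A" by (auto simp: A_def)
  qed
  then obtain L where L: "L \<in> A" "\<And>X. X \<in> A \<Longrightarrow> L \<subseteq> X \<Longrightarrow> X = L" by metis
  then have L': "subring L" "k \<subseteq> L" "\<not> algebraic_over L t" by (simp_all add: A_def)
  have "algebraic_over (fractions L t) a" for a
  proof (cases "algebraic_over (adjoin L a) t")
    case True
    then show ?thesis by (rule algebraic_over_exchange[OF L'(1,3)])
  next
    case False
    have "adjoin L a \<in> A"
      using L' False subring_adjoin[OF L'(1)] adjoin_superset[OF L'(1)] unfolding A_def by blast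
    then have "a \<in> L" using L(2)[of "adjoin L a"] adjoin_superset[OF L'(1)] adjoin_mem[OF L'(1)] by metis
    then have "[:- a, 1:] \<in> polys_over L"
      by (intro polys_over_pCons subring_uminus subring_1 polys_over_0 L'(1))
    then have "algebraic_over L a" unfolding algebraic_over_def by (intro bexI[of _ "[:- a, 1:]"]) auto
    moreover have "L \<subseteq> fractions L t"
      using poly_in_fractions[OF L'(1) polys_over_const[OF L'(1)], of _ t] by auto
    ultimately show ?thesis by (rule algebraic_over_mono[rotated])
  qed
  then show ?thesis using that L' by blast
qed

text \<open>Enlarge \<open>k\<close> to a maximal \<open>L\<close> over which \<open>t\<close> is
  transcendental, and let \<open>D\<close> extend differentiation with respect to \<open>t\<close>.
  The \<open>w i\<close> and \<open>v\<close> then lie in a finite tower of simple algebraic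
  extensions of \<open>L(t)\<close>, along which the residue theorem is carried up.\<close>

lemma residue:
  fixes t :: "'a::field_char_0" and f w :: "nat \<Rightarrow> 'a"
  assumes k: "subring k" "\<not> algebraic_over k t"
    and I: "finite I" "f ` I \<subseteq> k" "0 \<notin> w ` I" "i0 \<in> I" "w i0 = t"
    and eq: "\<And>D. derivation D \<Longrightarrow> \<forall>c\<in>k. D c = 0 \<Longrightarrow> (\<Sum>i\<in>I. f i * (D (w i) / w i)) = D v"
  obtains m :: "nat \<Rightarrow> int" where "(\<Sum>i\<in>I. f i * of_int (m i)) = 0" "m i0 \<noteq> 0"
proof -
  obtain L where L: "subring L" "k \<subseteq> L" "\<not> algebraic_over L t" "\<And>a. algebraic_over (fractions L t) a"
    using maximal_subring_transcendental[OF k] by metis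
  obtain D where D: "derivation D" "\<forall>c\<in>L. D c = 0" "D t = 1"
    using exists_derivation_transcendental[OF L(1,3)] by metis
  have Lt: "L \<subseteq> fractions L t" "t \<in> fractions L t"
    using poly_in_fractions[OF L(1) polys_over_const[OF L(1)], of _ t]
      poly_in_fractions[OF L(1) polys_over_pCons[OF L(1) subring_0[OF L(1)] polys_over_1[OF L(1)]], of t]
    by auto
  have tower: "\<exists>V. is_subfield V \<and> fractions L t \<subseteq> V \<and> D ` V \<subseteq> V \<and> X \<subseteq> V \<and> residue_property D L t V"
    if "finite X" for X
    using that
  proof (induction X rule: finite_induct)
    case empty
    then show ?case
      using is_subfield_fractions[OF L(1)] derivation_fractions(2)[OF L(1) D] residue_property_fractions[OF L(1,3) D]
      by (intro exI[of _ "fractions L t"]) auto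
  next
    case (insert a X)
    then obtain V where V: "is_subfield V" "fractions L t \<subseteq> V" "D ` V \<subseteq> V" "X \<subseteq> V" "residue_property D L t V"
      by blast
    note R = is_subfield_subring[OF V(1)]
    have alg: "algebraic_over V a" using algebraic_over_mono[OF V(2) L(4)] .
    have "residue_property D L t (adjoin V a)"
      using Lt V(2) by (intro residue_property_adjoin V alg D) auto
    then show ?case
      using is_subfield_adjoin[OF V(1) alg] derivation_adjoin[OF V(1) alg D(1) V(3)]
        adjoin_superset[OF R, of a] adjoin_mem[OF R, of a] V(2,4)
      by (intro exI[of _ "adjoin V a"]) auto
  qed
  obtain V where V: "insert v (w ` I) \<subseteq> V" "residue_property D L t V"
    using tower[of "insert v (w ` I)"] I(1) by auto
  moreover have "(\<Sum>i\<in>I. f i * (D (w i) / w i)) = D v" using eq[OF D(1)] D(2) L(2) by blast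
  moreover have "f ` I \<subseteq> L" "w ` I \<subseteq> V - {0}" "v \<in> V" "w i0 = t ^ 1" using I L(2) V(1) by auto
  ultimately show ?thesis
    using V(2)[unfolded residue_property_def, rule_format, of I f w v i0 1] I(1,4) that by auto
qed

subsection \<open>Exponential derivations\<close>

lemma additive_of_rat:
  fixes g :: "'a::field_char_0 \<Rightarrow> 'a"
  assumes add: "\<And>x y. g (x + y) = g x + g y"
  shows "g (of_rat q * x) = of_rat q * g x"
proof -
  have 0: "g 0 = 0" using add[of 0 0] by (metis add.right_neutral add_left_cancel)
  have nat: "g (of_nat n * y) = of_nat n * g y" for n y
    by (induction n) (simp_all add: 0 add distrib_right)
  have diff: "g (y - z) = g y - g z" for y z using add[of "y - z" z] by simp
  have int: "g (of_int n * y) = of_int n * g y" for n y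
    by (cases n rule: int_diff_cases) (simp add: nat diff left_diff_distrib)
  obtain a b where q: "q = Rat.Fract a b" "b > 0" by (cases q) auto
  have "of_int b * (of_rat q * x) = of_int a * x" using q by (simp add: of_rat_rat)
  then have "of_int b * g (of_rat q * x) = of_int a * g x" by (metis int)
  then show ?thesis using q by (simp add: of_rat_rat field_simps)
qed

lemma is_subfield_of_rat:
  fixes K :: "'a::field_char_0 set"
  assumes "is_subfield K"
  shows "of_rat q \<in> K"
proof -
  obtain a b where q: "q = Rat.Fract a b" "b > 0" by (cases q) auto
  then show ?thesis
    using is_subfield_divide[OF assms] subring_of_int[OF is_subfield_subring[OF assms]] by (simp add: of_rat_rat)
qed

lemma derivation_commutator:
  assumes "derivation D" "derivation D'"
  shows "derivation (\<lambda>a. D (D' a) - D' (D a))"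
  unfolding derivation_def
  by (simp add: derivation_add[OF assms(1)] derivation_add[OF assms(2)]
      derivation_mult[OF assms(1)] derivation_mult[OF assms(2)] algebra_simps)

definition rat_independent_mod :: "'a::field_char_0 set \<Rightarrow> 'i set \<Rightarrow> ('i \<Rightarrow> 'a) \<Rightarrow> bool" where
  "rat_independent_mod K I b \<longleftrightarrow> (\<forall>q. (\<Sum>i\<in>I. of_rat (q i) * b i) \<in> K \<longrightarrow> (\<forall>i\<in>I. q i = 0))"

lemma rat_independent_mod_subset:
  fixes b :: "'i \<Rightarrow> 'a::field_char_0"
  assumes "rat_independent_mod K I b" "finite I" "I' \<subseteq> I"
  shows "rat_independent_mod K I' b"
  unfolding rat_independent_mod_def
proof (intro allI impI)
  fix q :: "'i \<Rightarrow> rat" assume q: "(\<Sum>i\<in>I'. of_rat (q i) * b i) \<in> K"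
  define q' where "q' i = (if i \<in> I' then q i else 0)" for i
  have "(\<Sum>i\<in>I. of_rat (q' i) * b i) = (\<Sum>i\<in>I'. of_rat (q i) * b i)"
    using assms(2,3) by (intro sum.mono_neutral_cong_right) (auto simp: q'_def)
  with q have "(\<Sum>i\<in>I. of_rat (q' i) * b i) \<in> K" by simp
  then have "\<forall>i\<in>I. q' i = 0" using assms(1) unfolding rat_independent_mod_def by blast
  then show "\<forall>i\<in>I'. q i = 0" using assms(3) by (metis q'_def subsetD)
qed

lemma rat_independent_mod_shift:
  fixes b :: "'i \<Rightarrow> 'a::field_char_0"
  assumes ind: "rat_independent_mod K I b" and I: "finite I" "j \<in> I"
  shows "rat_independent_mod K (I - {j}) (\<lambda>i. b i - of_rat (q i) * b j)"
  unfolding rat_independent_mod_def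
proof (intro allI impI)
  fix r :: "'i \<Rightarrow> rat" assume r: "(\<Sum>i\<in>I - {j}. of_rat (r i) * (b i - of_rat (q i) * b j)) \<in> K"
  \<comment> \<open>Expanding the shifted elements collects exactly this coefficient at
    \<open>b j\<close>.\<close>
  define r' where "r' = r (j := - (\<Sum>i\<in>I - {j}. r i * q i))"
  have "(\<Sum>i\<in>I. of_rat (r' i) * b i) = of_rat (r' j) * b j + (\<Sum>i\<in>I - {j}. of_rat (r' i) * b i)"
    using I by (simp add: sum.remove)
  also have "(\<Sum>i\<in>I - {j}. of_rat (r' i) * b i) = (\<Sum>i\<in>I - {j}. of_rat (r i) * b i)"
    by (intro sum.cong) (auto simp: r'_def)
  also have "of_rat (r' j) * b j = - (\<Sum>i\<in>I - {j}. of_rat (r i) * of_rat (q i) * b j)"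
    by (simp add: r'_def of_rat_minus of_rat_sum of_rat_mult sum_distrib_right)
  also have "\<dots> + (\<Sum>i\<in>I - {j}. of_rat (r i) * b i) =
      (\<Sum>i\<in>I - {j}. of_rat (r i) * (b i - of_rat (q i) * b j))"
    by (simp add: right_diff_distrib sum_subtractf mult.assoc)
  finally have "\<forall>i\<in>I. r' i = 0" using ind r unfolding rat_independent_mod_def by metis
  then show "\<forall>i\<in>I - {j}. r i = 0" by (auto simp: r'_def split: if_splits)
qed

text \<open>An independent subset of maximal size serves as basis, and \<open>Q j i\<close> is the
  coordinate of \<open>b j\<close> at \<open>b i\<close> modulo \<open>K\<close>.\<close>

lemma rat_basis_mod:
  fixes b :: "'i \<Rightarrow> 'a::field_char_0"
  assumes K: "is_subfield K" and J: "finite J"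
  obtains I and Q :: "'i \<Rightarrow> 'i \<Rightarrow> rat" where "I \<subseteq> J" "rat_independent_mod K I b"
    "\<And>j. j \<in> J \<Longrightarrow> b j - (\<Sum>i\<in>I. of_rat (Q j i) * b i) \<in> K"
    "\<And>i j. i \<in> I \<Longrightarrow> j \<in> I \<Longrightarrow> Q j i = (if i = j then 1 else 0)"
proof -
  note R = is_subfield_subring[OF K]
  have "rat_independent_mod K {} b" by (simp add: rat_independent_mod_def)
  then obtain I where I: "I \<subseteq> J" "rat_independent_mod K I b"
    and max: "\<And>I'. I' \<subseteq> J \<Longrightarrow> rat_independent_mod K I' b \<Longrightarrow> card I' \<le> card I"
    using ex_has_greatest_nat[of "\<lambda>I. I \<subseteq> J \<and> rat_independent_mod K I b" "{}" card "card J + 1"]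
      card_mono[OF J] by (metis empty_subsetI le_imp_less_Suc Suc_eq_plus1)
  have fI: "finite I" using I J finite_subset by blast
  have "\<exists>q. b j - (\<Sum>i\<in>I. of_rat (q i) * b i) \<in> K \<and> (j \<in> I \<longrightarrow> (\<forall>i\<in>I. q i = (if i = j then 1 else 0)))"
    if j: "j \<in> J" for j
  proof (cases "j \<in> I")
    case True
    have "(\<Sum>i\<in>I. of_rat (if i = j then 1 else 0) * b i) = b j"
      using fI True by (simp add: if_distrib[of of_rat] if_distrib[of "\<lambda>u. u * _"] cong: if_cong)
    then show ?thesis using subring_0[OF R] by (intro exI[of _ "\<lambda>i. if i = j then 1 else 0"]) auto
  next
    case False
    have "\<not> rat_independent_mod K (insert j I) b"
      using max[of "insert j I"] I(1) j False fI by auto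
    then obtain q where q: "(\<Sum>i\<in>insert j I. of_rat (q i) * b i) \<in> K" "\<exists>i\<in>insert j I. q i \<noteq> 0"
      by (auto simp: rat_independent_mod_def)
    have eq: "(\<Sum>i\<in>insert j I. of_rat (q i) * b i) = of_rat (q j) * b j + (\<Sum>i\<in>I. of_rat (q i) * b i)"
      using False fI by simp
    have qj: "q j \<noteq> 0"
    proof
      assume q0: "q j = 0"
      then have "(\<Sum>i\<in>I. of_rat (q i) * b i) \<in> K" using q(1) eq by simp
      then show False using I(2) q(2) q0 unfolding rat_independent_mod_def by auto
    qed
    have "b j - (\<Sum>i\<in>I. of_rat (- q i / q j) * b i) = (\<Sum>i\<in>insert j I. of_rat (q i) * b i) / of_rat (q j)"
      unfolding eq using qj
      by (simp add: of_rat_divide of_rat_minus sum_divide_distrib sum_negf add_divide_distrib)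
    then have "b j - (\<Sum>i\<in>I. of_rat (- q i / q j) * b i) \<in> K"
      using is_subfield_divide[OF K q(1) is_subfield_of_rat[OF K]] by simp
    then show ?thesis using False by (intro exI[of _ "\<lambda>i. - q i / q j"]) auto
  qed
  then obtain Q where Q: "\<And>j. j \<in> J \<Longrightarrow> b j - (\<Sum>i\<in>I. of_rat (Q j i) * b i) \<in> K \<and>
      (j \<in> I \<longrightarrow> (\<forall>i\<in>I. Q j i = (if i = j then 1 else 0)))" by metis
  show ?thesis by (rule that[OF I, of Q]) (use Q I(1) in auto)
qed

text \<open>A functional vanishing on a common kernel is a combination of the functionals defining
  it: the induction settles the kernel of \<open>l i\<close>, and one vector outside that kernel
  fixes the last coefficient. The operations are parameters because this is applied to a set of
  functions, the derivations.\<close>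

lemma common_kernel_functional:
  fixes V :: "'v set" and add :: "'v \<Rightarrow> 'v \<Rightarrow> 'v" and scale :: "'a::field \<Rightarrow> 'v \<Rightarrow> 'v"
  assumes "finite J"
    and V: "\<And>v w. v \<in> V \<Longrightarrow> w \<in> V \<Longrightarrow> add v w \<in> V" "\<And>c v. v \<in> V \<Longrightarrow> scale c v \<in> V"
    and g: "\<And>v w. g (add v w) = g v + g w" "\<And>c v. g (scale c v) = c * g v"
    and l: "\<And>j v w. j \<in> J \<Longrightarrow> l j (add v w) = l j v + l j w" "\<And>j c v. j \<in> J \<Longrightarrow> l j (scale c v) = c * l j v"
    and ker: "\<And>v. v \<in> V \<Longrightarrow> \<forall>j\<in>J. l j v = 0 \<Longrightarrow> g v = 0"
  shows "\<exists>f. \<forall>v\<in>V. g v = (\<Sum>j\<in>J. f j * l j v)"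
  using assms(1) V l ker
proof (induction J arbitrary: V rule: finite_induct)
  case (insert i J)
  have "\<exists>f. \<forall>v\<in>{v \<in> V. l i v = 0}. g v = (\<Sum>j\<in>J. f j * l j v)"
    by (rule insert.IH) (use insert.prems in auto)
  then obtain f where f: "\<And>v. v \<in> V \<Longrightarrow> l i v = 0 \<Longrightarrow> g v = (\<Sum>j\<in>J. f j * l j v)" by blast
  show ?case
  proof (cases "\<exists>v\<in>V. l i v \<noteq> 0")
    case False
    then have "\<forall>v\<in>V. g v = (\<Sum>j\<in>insert i J. f j * l j v)" using f insert.hyps by auto
    then show ?thesis by blast
  next
    case True
    then obtain u where u: "u \<in> V" "l i u \<noteq> 0" by blast
    \<comment> \<open>Chosen so that the identity holds at \<open>u\<close>; every other
      \<open>v\<close> differs from a vector in the kernel of \<open>l i\<close> by a multiple of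
      \<open>u\<close>.\<close>
    define c where "c = (g u - (\<Sum>j\<in>J. f j * l j u)) / l i u"
    have "g v = (\<Sum>j\<in>insert i J. (f(i := c)) j * l j v)" if v: "v \<in> V" for v
    proof -
      define s where "s = - (l i v / l i u)"
      have "l i (add v (scale s u)) = 0" using u by (simp add: insert.prems(3,4) s_def)
      then have "g (add v (scale s u)) = (\<Sum>j\<in>J. f j * l j (add v (scale s u)))"
        by (intro f insert.prems(1,2) v u)
      then have "g v + s * g u = (\<Sum>j\<in>J. f j * l j v) + s * (\<Sum>j\<in>J. f j * l j u)"
        by (simp add: g insert.prems(3,4) distrib_left sum.distrib sum_distrib_left mult_ac)
      then have "g v = (\<Sum>j\<in>J. f j * l j v) - s * (g u - (\<Sum>j\<in>J. f j * l j u))"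
        by (simp add: algebra_simps)
      also have "g u - (\<Sum>j\<in>J. f j * l j u) = c * l i u" using u by (simp add: c_def)
      also have "s * (c * l i u) = - (c * l i v)" using u by (simp add: s_def)
      finally have "g v = c * l i v + (\<Sum>j\<in>J. f j * l j v)" by simp
      moreover have "(\<Sum>j\<in>J. (f(i := c)) j * l j v) = (\<Sum>j\<in>J. f j * l j v)"
        using insert.hyps by (intro sum.cong) auto
      ultimately show ?thesis using insert.hyps by simp
    qed
    then show ?thesis by blast
  qed
qed simp

section \<open>Exponential forms, their constants, and Ax's theorem\<close>

context exponential_field
begin

lemma E_0: "E 0 = 1"
  using E_add[of 0 0] E_nonzero[of 0] by simp

definition ldiff :: "('a \<Rightarrow> 'a) \<Rightarrow> 'a \<Rightarrow> 'a" where
  "ldiff D u = D (E u) / E u - D u"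

definition exp_derivs :: "'a set \<Rightarrow> ('a \<Rightarrow> 'a) set" where
  "exp_derivs U = {D. derivation D \<and> (\<forall>u\<in>U. ldiff D u = 0)}"

definition exp_consts :: "'a set \<Rightarrow> 'a set" where
  "exp_consts U = {a. \<forall>D\<in>exp_derivs U. D a = 0}"

text \<open>For \<open>K = exp_consts U\<close> this set contains \<open>exp_derivs U\<close> and is
  stable under commutators with it. On these derivations the form of \<open>c\<close> vanishes as
  soon as \<open>c\<close> and \<open>E c\<close> lie in \<open>K\<close>.\<close>

definition derivs_over :: "'a set \<Rightarrow> ('a \<Rightarrow> 'a) set" where
  "derivs_over K = {D. derivation D \<and> (\<forall>c\<in>K. D c = 0)}"

lemma ldiff_add: "derivation D \<Longrightarrow> ldiff D (u + v) = ldiff D u + ldiff D v"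
  by (simp add: ldiff_def E_add derivation_mult derivation_add add_divide_distrib E_nonzero)

lemma ldiff_of_rat: "derivation D \<Longrightarrow> ldiff D (of_rat q * u) = of_rat q * ldiff D u"
  by (rule additive_of_rat) (rule ldiff_add)

lemma ldiff_diff: "derivation D \<Longrightarrow> ldiff D (u - v) = ldiff D u - ldiff D v"
  using ldiff_add[of D "u - v" v] by simp

lemma ldiff_sum: "derivation D \<Longrightarrow> ldiff D (\<Sum>i\<in>I. g i) = (\<Sum>i\<in>I. ldiff D (g i))"
  by (induction I rule: infinite_finite_induct)
    (simp_all add: ldiff_add, simp_all add: ldiff_def E_0 derivation_0 derivation_1)

text \<open>The form of \<open>u\<close> is closed and vanishes on \<open>D\<close>, so by Cartan's
  formula its Lie derivative along \<open>D\<close> is zero. This is that fact evaluated at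
  \<open>D'\<close>.\<close>

lemma ldiff_commutator:
  assumes "derivation D" "derivation D'" "ldiff D u = 0"
  shows "ldiff (\<lambda>a. D (D' a) - D' (D a)) u = D (ldiff D' u)"
proof -
  have DE: "D (E u) = E u * D u" using assms(3) E_nonzero[of u] by (simp add: ldiff_def field_simps)
  have 1: "D' (D (E u)) = E u * D' (D u) + D' (E u) * D u" unfolding DE by (rule derivation_mult[OF assms(2)])
  have 2: "D (ldiff D' u) = (D (D' (E u)) * E u - D' (E u) * (E u * D u)) / (E u)\<^sup>2 - D (D' u)"
    unfolding ldiff_def[of D'] derivation_diff[OF assms(1)] derivation_divide[OF assms(1) E_nonzero] DE ..
  show ?thesis
    unfolding 2 unfolding ldiff_def 1 using E_nonzero[of u] by (simp add: field_simps power2_eq_square)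
qed

lemma ldiff_eq_0_iff: "ldiff D u = 0 \<longleftrightarrow> D (E u) = E u * D u"
  using E_nonzero[of u] by (simp add: ldiff_def field_simps)

lemma exp_derivsD:
  assumes "D \<in> exp_derivs U"
  shows "derivation D" "u \<in> U \<Longrightarrow> ldiff D u = 0"
  using assms by (auto simp: exp_derivs_def)

lemma is_subfield_exp_consts: "is_subfield (exp_consts U)"
  unfolding is_subfield_def
proof (intro conjI ballI)
  note D = exp_derivsD(1)
  show "0 \<in> exp_consts U" "1 \<in> exp_consts U"
    by (auto simp: exp_consts_def derivation_0[OF D] derivation_1[OF D])
  fix a assume a: "a \<in> exp_consts U"
  show "- a \<in> exp_consts U"
    using a by (auto simp: exp_consts_def derivation_minus[OF D])
  show "inverse a \<in> exp_consts U"
    using a by (cases "a = 0") (auto simp: exp_consts_def derivation_inverse[OF D])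
  fix b assume "b \<in> exp_consts U"
  with a show "a + b \<in> exp_consts U" "a * b \<in> exp_consts U"
    by (auto simp: exp_consts_def derivation_add[OF D] derivation_mult[OF D])
qed

text \<open>Applying \<open>D\<close> to the minimal relation, whose coefficients are constants,
  leaves the nonzero value of the formal derivative times \<open>D a\<close>.\<close>

lemma exp_consts_algebraically_closed:
  assumes "algebraic_over (exp_consts U) a"
  shows "a \<in> exp_consts U"
proof -
  note R = is_subfield_subring[OF is_subfield_exp_consts]
  obtain p where p: "p \<in> polys_over (exp_consts U)" "poly p a = 0" "0 < degree p"
    and min: "\<And>q. q \<in> polys_over (exp_consts U) \<Longrightarrow> poly q a = 0 \<Longrightarrow> degree q < degree p \<Longrightarrow> q = 0"
    using minimal_annihilator[OF assms] by metis
  have nz: "poly (pderiv p) a \<noteq> 0"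
    by (rule pderiv_minimal_annihilator_nonzero[OF R p(1,3) min])
  have "D a = 0" if D: "D \<in> exp_derivs U" for D
  proof -
    note D' = exp_derivsD(1)[OF D]
    have "map_poly D p = 0"
      using p(1) D
      by (intro poly_eqI) (auto simp: coeff_map_poly derivation_0[OF D'] polys_over_def exp_consts_def)
    then show ?thesis using derivation_poly[OF D', of p a] p(2) nz by (simp add: derivation_0[OF D'])
  qed
  then show ?thesis by (simp add: exp_consts_def)
qed

lemma
  assumes "\<And>D. D \<in> exp_derivs U \<Longrightarrow> ldiff D c = 0"
  shows E_exp_const: "c \<in> exp_consts U \<Longrightarrow> E c \<in> exp_consts U"
    and exp_const_if_E_exp_const: "E c \<in> exp_consts U \<Longrightarrow> c \<in> exp_consts U"
proof -
  have "D (E c) = 0 \<longleftrightarrow> D c = 0" if "D \<in> exp_derivs U" for D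
    using assms[OF that] E_nonzero[of c] by (simp add: ldiff_eq_0_iff)
  then show "c \<in> exp_consts U \<Longrightarrow> E c \<in> exp_consts U" "E c \<in> exp_consts U \<Longrightarrow> c \<in> exp_consts U"
    unfolding exp_consts_def by blast+
qed

lemma commutator_derivs_over:
  assumes "D \<in> exp_derivs U" "D' \<in> derivs_over (exp_consts U)"
  shows "(\<lambda>a. D (D' a) - D' (D a)) \<in> derivs_over (exp_consts U)"
proof -
  have D: "derivation D" "derivation D'" using assms by (auto simp: exp_derivs_def derivs_over_def)
  then show ?thesis
    using assms derivation_commutator[OF D]
    by (auto simp: derivs_over_def exp_consts_def derivation_0)
qed

text \<open>
  In a relation of minimal length, normalised to have a coefficient \<open>1\<close>, the Lie derivative along
  \<open>exp_derivs U\<close> shows that all coefficients are constant, and minimality makes them independent over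
  \<open>\<rat>\<close>. Then \<open>residue\<close>, applied at the zero of one \<open>E (b i)\<close>, yields a contradiction.
\<close>

lemma ldiff_independent:
  fixes I :: "nat set"
  assumes "finite I"
    and "\<And>i D. i \<in> I \<Longrightarrow> D \<in> exp_derivs U \<Longrightarrow> ldiff D (b i) = 0"
    and "rat_independent_mod (exp_consts U) I b"
    and "\<And>D. D \<in> derivs_over (exp_consts U) \<Longrightarrow> (\<Sum>i\<in>I. f i * ldiff D (b i)) = 0"
  shows "\<forall>i\<in>I. f i = 0"
  using assms
proof (induction "card I" arbitrary: I b f rule: less_induct)
  case less
  define K where "K = exp_consts U"
  note IH = less.hyps[folded K_def]
  note prems = less.prems[folded K_def]
  note K = is_subfield_exp_consts[of U, folded K_def]
  note R = is_subfield_subring[OF K]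
  have der: "derivation D" if "D \<in> derivs_over K" for D using that by (simp add: derivs_over_def)
  show ?case
  proof (rule ccontr)
    assume "\<not> (\<forall>i\<in>I. f i = 0)"
    then obtain i0 where i0: "i0 \<in> I" "f i0 \<noteq> 0" by blast
    \<comment> \<open>The induction hypothesis acts as minimality: a zero coefficient would leave a
      nontrivial shorter relation.\<close>
    have nz: "f i \<noteq> 0" if "i \<in> I" for i
    proof
      assume fi: "f i = 0"
      have "\<forall>j\<in>I - {i}. f j = 0"
      proof (rule IH)
        show "card (I - {i}) < card I" using that prems(1) by (metis card_Diff1_less)
        show "rat_independent_mod K (I - {i}) b" by (rule rat_independent_mod_subset[OF prems(3,1)]) auto
        fix D assume "D \<in> derivs_over K"
        from prems(4)[OF this] show "(\<Sum>j\<in>I - {i}. f j * ldiff D (b j)) = 0"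
          using fi that prems(1) by (simp add: sum.remove)
      qed (use prems in auto)
      then show False using i0 fi by (cases "i0 = i") auto
    qed
    define g where "g i = f i / f i0" for i
    have g0: "g i0 = 1" using i0 by (simp add: g_def)
    have gnz: "g i \<noteq> 0" if "i \<in> I" for i using nz[OF that] i0 by (simp add: g_def)
    have rel: "(\<Sum>i\<in>I. g i * ldiff D (b i)) = 0" if "D \<in> derivs_over K" for D
      using prems(4)[OF that] i0 by (simp add: g_def sum_divide_distrib[symmetric])
    \<comment> \<open>Applying \<open>D\<close> to the relation at \<open>D'\<close>, and using the
      relation at the commutator, leaves a relation with coefficients \<open>D (g i)\<close>. It is
      shorter because \<open>g i0 = 1\<close> has derivative \<open>0\<close>.\<close>
    have gK: "g i \<in> K" if i: "i \<in> I" for i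
    proof -
      have "D (g i) = 0" if D: "D \<in> exp_derivs U" for D
      proof -
        note D1 = exp_derivsD(1)[OF D]
        have "\<forall>i\<in>I - {i0}. D (g i) = 0"
        proof (rule IH)
          show "card (I - {i0}) < card I" using i0 prems(1) by (metis card_Diff1_less)
          show "rat_independent_mod K (I - {i0}) b" by (rule rat_independent_mod_subset[OF prems(3,1)]) auto
          fix D' assume D': "D' \<in> derivs_over K"
          have "0 = D (\<Sum>i\<in>I. g i * ldiff D' (b i))" using rel[OF D'] by (simp add: derivation_0[OF D1])
          also have "\<dots> = (\<Sum>i\<in>I. g i * ldiff (\<lambda>a. D (D' a) - D' (D a)) (b i)) + (\<Sum>i\<in>I. D (g i) * ldiff D' (b i))"
            using ldiff_commutator[OF D1 der[OF D'] prems(2)[OF _ D]]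
            by (simp add: derivation_sum[OF D1] derivation_mult[OF D1] sum.distrib)
          also have "(\<Sum>i\<in>I. g i * ldiff (\<lambda>a. D (D' a) - D' (D a)) (b i)) = 0"
            using commutator_derivs_over[OF D D'[unfolded K_def]] by (intro rel) (simp add: K_def)
          also have "(\<Sum>i\<in>I. D (g i) * ldiff D' (b i)) = (\<Sum>i\<in>I - {i0}. D (g i) * ldiff D' (b i))"
            using i0 prems(1) by (simp add: sum.remove g0 derivation_1[OF D1])
          finally show "(\<Sum>i\<in>I - {i0}. D (g i) * ldiff D' (b i)) = 0" by simp
        qed (use prems in auto)
        then show ?thesis using i g0 derivation_1[OF D1] by (cases "i = i0") auto
      qed
      then show ?thesis by (simp add: K_def exp_consts_def)
    qed
    \<comment> \<open>A rational dependence among the coefficients allows one element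
      \<open>b j\<close> to be absorbed into the others, which again gives a shorter
      relation.\<close>
    have g_ind: "\<forall>i\<in>I. q i = 0" if q: "(\<Sum>i\<in>I. g i * of_rat (q i)) = 0" for q :: "nat \<Rightarrow> rat"
    proof (rule ccontr)
      assume "\<not> (\<forall>i\<in>I. q i = 0)"
      then obtain j where j: "j \<in> I" "q j \<noteq> 0" by blast
      have qj: "(\<Sum>i\<in>I - {j}. g i * of_rat (q i)) = - (g j * of_rat (q j))"
        using q j prems(1) by (simp add: sum.remove eq_neg_iff_add_eq_0 add.commute)
      have "\<forall>i\<in>I - {j}. g i = 0"
      proof (rule IH)
        show "card (I - {j}) < card I" using j prems(1) by (metis card_Diff1_less)
        show "rat_independent_mod K (I - {j}) (\<lambda>i. b i - of_rat (q i / q j) * b j)"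
          by (rule rat_independent_mod_shift[OF prems(3,1) j(1)])
        show "ldiff D (b i - of_rat (q i / q j) * b j) = 0" if "i \<in> I - {j}" "D \<in> exp_derivs U" for i D
          using that prems(2) j(1) exp_derivsD(1)[OF that(2)] by (simp add: ldiff_diff ldiff_of_rat)
        fix D assume D: "D \<in> derivs_over K"
        have "(\<Sum>i\<in>I - {j}. g i * ldiff D (b i - of_rat (q i / q j) * b j)) =
          (\<Sum>i\<in>I - {j}. g i * ldiff D (b i)) - (\<Sum>i\<in>I - {j}. g i * of_rat (q i)) * (ldiff D (b j) / of_rat (q j))"
        proof -
          have "ldiff D (b i - of_rat (q i / q j) * b j) = ldiff D (b i) - of_rat (q i) * (ldiff D (b j) / of_rat (q j))" for i
            by (simp only: ldiff_diff[OF der[OF D]] ldiff_of_rat[OF der[OF D]]) (simp add: of_rat_divide)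
          then show ?thesis by (simp only: right_diff_distrib sum_subtractf sum_distrib_right mult.assoc)
        qed
        also have "\<dots> = (\<Sum>i\<in>I. g i * ldiff D (b i))"
          unfolding qj using j prems(1) by (simp add: sum.remove)
        finally show "(\<Sum>i\<in>I - {j}. g i * ldiff D (b i - of_rat (q i / q j) * b j)) = 0"
          using rel[OF D] by simp
      qed (use prems in auto)
      then have "g j * of_rat (q j) = 0" using qj by simp
      then show False using gnz[OF j(1)] j(2) by simp
    qed
    have "E (b i0) \<notin> K"
    proof
      assume "E (b i0) \<in> K"
      then have "b i0 \<in> K"
        unfolding K_def using exp_const_if_E_exp_const[OF prems(2)[OF i0(1)]] by blast
      moreover define \<delta> :: "nat \<Rightarrow> rat" where "\<delta> i = (if i = i0 then 1 else 0)" for i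
      have "(\<Sum>i\<in>I. of_rat (\<delta> i) * b i) = b i0"
        using prems(1) i0 by (simp add: \<delta>_def if_distrib[of of_rat] if_distrib[of "\<lambda>u. u * _"] cong: if_cong)
      ultimately have "(\<Sum>i\<in>I. of_rat (\<delta> i) * b i) \<in> K" by simp
      then have "\<forall>i\<in>I. \<delta> i = 0" using prems(3) unfolding rat_independent_mod_def by blast
      then show False using i0 by (auto simp: \<delta>_def)
    qed
    then have tr: "\<not> algebraic_over K (E (b i0))" using exp_consts_algebraically_closed by (auto simp: K_def)
    \<comment> \<open>Since the \<open>g i\<close> are constants for \<open>D\<close>, the linear
      parts of the forms add up to an exact term, as \<open>residue\<close> requires.\<close>
    have eq: "(\<Sum>i\<in>I. g i * (D (E (b i)) / E (b i))) = D (\<Sum>i\<in>I. g i * b i)"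
      if "derivation D" "\<forall>c\<in>K. D c = 0" for D
    proof -
      have D: "D \<in> derivs_over K" using that by (simp add: derivs_over_def)
      have "D (\<Sum>i\<in>I. g i * b i) = (\<Sum>i\<in>I. g i * D (b i))"
        using gK that by (simp add: derivation_sum derivation_mult)
      then show ?thesis using rel[OF D] by (simp add: ldiff_def right_diff_distrib sum_subtractf)
    qed
    \<comment> \<open>Here \<open>t\<close> is \<open>E (b i0)\<close>. The integers obtained are a
      rational dependence of the \<open>g i\<close>, against \<open>g_ind\<close>.\<close>
    obtain m :: "nat \<Rightarrow> int" where m: "(\<Sum>i\<in>I. g i * of_int (m i)) = 0" "m i0 \<noteq> 0"
    proof (rule residue[OF R tr prems(1) _ _ i0(1), of g "\<lambda>i. E (b i)"])
      show "g ` I \<subseteq> K" using gK by blast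
      show "0 \<notin> (\<lambda>i. E (b i)) ` I" by (auto simp: E_nonzero[THEN not_sym])
    qed (use eq in simp_all)
    from g_ind[of "\<lambda>i. of_int (m i)"] m i0(1) show False by simp
  qed
qed

text \<open>Ax's theorem for arbitrary elements. Each \<open>b j\<close> is a rational combination
  of the basis plus some \<open>c\<close> in \<open>K\<close>; then \<open>E c\<close> is in
  \<open>K\<close> too, so the form of \<open>c\<close> disappears over \<open>K\<close>. A relation
  thus becomes one between the forms of the basis, and all its coefficients vanish.\<close>

lemma ldiff_relations:
  fixes J :: "nat set"
  assumes "finite J"
  obtains I and Q :: "nat \<Rightarrow> nat \<Rightarrow> rat" where "I \<subseteq> J"
    "\<And>j. j \<in> J \<Longrightarrow> b j - (\<Sum>i\<in>I. of_rat (Q j i) * b i) \<in> exp_consts (b ` J)"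
    "\<And>i j. i \<in> I \<Longrightarrow> j \<in> I \<Longrightarrow> Q j i = (if i = j then 1 else 0)"
    "\<And>f i. \<forall>D\<in>derivs_over (exp_consts (b ` J)). (\<Sum>j\<in>J. f j * ldiff D (b j)) = 0 \<Longrightarrow>
      i \<in> I \<Longrightarrow> (\<Sum>j\<in>J. f j * of_rat (Q j i)) = 0"
proof -
  define K where "K = exp_consts (b ` J)"
  note K = is_subfield_exp_consts[of "b ` J", folded K_def]
  obtain I and Q :: "nat \<Rightarrow> nat \<Rightarrow> rat" where I: "I \<subseteq> J" "rat_independent_mod K I b"
    and Q: "\<And>j. j \<in> J \<Longrightarrow> b j - (\<Sum>i\<in>I. of_rat (Q j i) * b i) \<in> K"
    and id: "\<And>i j. i \<in> I \<Longrightarrow> j \<in> I \<Longrightarrow> Q j i = (if i = j then 1 else 0)"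
    by (rule rat_basis_mod[OF K assms, of b]) (rule that)
  have fI: "finite I" using I assms finite_subset by blast
  have b0: "ldiff D (b j) = 0" if "j \<in> J" "D \<in> exp_derivs (b ` J)" for j D
    using exp_derivsD(2)[OF that(2)] that(1) by blast
  have expand: "ldiff D (b j) = (\<Sum>i\<in>I. of_rat (Q j i) * ldiff D (b i))" if j: "j \<in> J" and D: "D \<in> derivs_over K" for j D
  proof -
    define c where "c = b j - (\<Sum>i\<in>I. of_rat (Q j i) * b i)"
    have lin: "ldiff D' c = ldiff D' (b j) - (\<Sum>i\<in>I. of_rat (Q j i) * ldiff D' (b i))" if "derivation D'" for D'
      by (simp add: c_def ldiff_diff[OF that] ldiff_sum[OF that] ldiff_of_rat[OF that])
    have "ldiff D' c = 0" if "D' \<in> exp_derivs (b ` J)" for D'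
      using lin[OF exp_derivsD(1)[OF that]] b0[OF _ that] j I(1) by (auto intro!: sum.neutral)
    moreover have "c \<in> K" using Q[OF j] by (simp add: c_def)
    ultimately have "c \<in> K" "E c \<in> K" using E_exp_const by (auto simp: K_def)
    then have "ldiff D c = 0" using D by (simp add: ldiff_def derivs_over_def)
    then show ?thesis using lin[of D] D by (simp add: derivs_over_def)
  qed
  have "(\<Sum>j\<in>J. f j * of_rat (Q j i)) = 0"
    if f: "\<forall>D\<in>derivs_over K. (\<Sum>j\<in>J. f j * ldiff D (b j)) = 0" and i: "i \<in> I" for f i
  proof -
    have "\<forall>i\<in>I. (\<Sum>j\<in>J. f j * of_rat (Q j i)) = 0"
    proof (rule ldiff_independent[OF fI, of "b ` J" b])
      show "ldiff D (b i) = 0" if "i \<in> I" "D \<in> exp_derivs (b ` J)" for i D using b0 that I(1) by blast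
      show "rat_independent_mod (exp_consts (b ` J)) I b" using I(2) by (simp add: K_def)
      fix D assume "D \<in> derivs_over (exp_consts (b ` J))"
      then have D: "D \<in> derivs_over K" by (simp add: K_def)
      have "(\<Sum>i\<in>I. (\<Sum>j\<in>J. f j * of_rat (Q j i)) * ldiff D (b i)) =
          (\<Sum>j\<in>J. f j * (\<Sum>i\<in>I. of_rat (Q j i) * ldiff D (b i)))"
        by (simp add: sum_distrib_left sum_distrib_right mult.assoc sum.swap[of _ I])
      also have "\<dots> = (\<Sum>j\<in>J. f j * ldiff D (b j))"
        by (rule sum.cong[OF refl]) (simp only: expand[OF _ D, symmetric])
      also have "\<dots> = 0" using f D by blast
      finally show "(\<Sum>i\<in>I. (\<Sum>j\<in>J. f j * of_rat (Q j i)) * ldiff D (b i)) = 0" .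
    qed
    then show ?thesis using i by blast
  qed
  then show ?thesis
    using Q id unfolding K_def by (intro that[OF I(1), of Q]) simp_all
qed

text \<open>As \<open>p\<close> is a constant, its differential is a combination of the forms of the
  \<open>b j\<close>, and over \<open>K\<close> this is a relation between them. So the coefficients
  \<open>f\<close> are orthogonal to column \<open>i\<close> of \<open>Q\<close>, which allows the
  form of \<open>b i\<close> to be eliminated after replacing \<open>b j\<close> by
  \<open>b j - Q j i * b i\<close>. Each round removes one element; it stops when the basis is
  empty, that is, when all elements are constants.\<close>

lemma exp_const_reduce:
  fixes J :: "nat set"
  assumes "finite J" "p \<in> exp_consts (b ` J)"
  shows "\<exists>J' b'. finite (J' :: nat set) \<and> p \<in> exp_consts (b' ` J') \<and> b' ` J' \<subseteq> exp_consts (b' ` J')"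
  using assms
proof (induction "card J" arbitrary: J b rule: less_induct)
  case less
  obtain I and Q :: "nat \<Rightarrow> nat \<Rightarrow> rat" where I: "I \<subseteq> J"
    and Q: "\<And>j. j \<in> J \<Longrightarrow> b j - (\<Sum>i\<in>I. of_rat (Q j i) * b i) \<in> exp_consts (b ` J)"
    and id: "\<And>i j. i \<in> I \<Longrightarrow> j \<in> I \<Longrightarrow> Q j i = (if i = j then 1 else 0)"
    and rel: "\<And>f i. \<forall>D\<in>derivs_over (exp_consts (b ` J)). (\<Sum>j\<in>J. f j * ldiff D (b j)) = 0 \<Longrightarrow>
      i \<in> I \<Longrightarrow> (\<Sum>j\<in>J. f j * of_rat (Q j i)) = 0"
    by (rule ldiff_relations[OF less.prems(1), of b]) (rule that)
  show ?case
  proof (cases "I = {}")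
    case True
    then have "b ` J \<subseteq> exp_consts (b ` J)" using Q by auto
    then show ?thesis using less.prems by blast
  next
    case False
    then obtain i where i: "i \<in> I" "i \<in> J" using I by blast
    have "\<exists>f. \<forall>D\<in>Collect derivation. D p = (\<Sum>j\<in>J. f j * ldiff D (b j))"
    proof (rule common_kernel_functional[OF less.prems(1),
          where add = "\<lambda>D D' a. D a + D' a" and scale = "\<lambda>c D a. c * D a"])
      fix D :: "'a \<Rightarrow> 'a" assume "D \<in> Collect derivation" "\<forall>j\<in>J. ldiff D (b j) = 0"
      then have "D \<in> exp_derivs (b ` J)" by (auto simp: exp_derivs_def)
      then show "D p = 0" using less.prems(2) by (simp add: exp_consts_def)
    qed (auto simp: derivation_def ldiff_def algebra_simps add_divide_distrib)
    then obtain f where f: "\<And>D. derivation D \<Longrightarrow> D p = (\<Sum>j\<in>J. f j * ldiff D (b j))" by blast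
    have "(\<Sum>j\<in>J. f j * of_rat (Q j i)) = 0"
    proof (rule rel[OF _ i(1)], rule ballI)
      fix D assume "D \<in> derivs_over (exp_consts (b ` J))"
      then have "derivation D" "D p = 0" using less.prems(2) by (auto simp: derivs_over_def)
      then show "(\<Sum>j\<in>J. f j * ldiff D (b j)) = 0" using f by simp
    qed
    then have fi: "f i = - (\<Sum>j\<in>J - {i}. f j * of_rat (Q j i))"
      using i less.prems(1) id[OF i(1) i(1)] by (simp add: sum.remove eq_neg_iff_add_eq_0)
    define b' where "b' j = b j - of_rat (Q j i) * b i" for j
    have Dp: "D p = (\<Sum>j\<in>J - {i}. f j * ldiff D (b' j))" if "derivation D" for D
    proof -
      have "D p = f i * ldiff D (b i) + (\<Sum>j\<in>J - {i}. f j * ldiff D (b j))"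
        using f[OF that] i(2) less.prems(1) by (simp add: sum.remove)
      also have "\<dots> = (\<Sum>j\<in>J - {i}. f j * ldiff D (b' j))"
        unfolding fi b'_def
        by (simp add: ldiff_diff[OF that] ldiff_of_rat[OF that] right_diff_distrib sum_subtractf
            sum_distrib_right mult.assoc)
      finally show ?thesis .
    qed
    have "card (J - {i}) < card J" using i less.prems(1) by (metis card_Diff1_less)
    moreover have "p \<in> exp_consts (b' ` (J - {i}))"
      unfolding exp_consts_def
    proof safe
      fix D assume "D \<in> exp_derivs (b' ` (J - {i}))"
      note D = exp_derivsD[OF this]
      have "ldiff D (b' j) = 0" if "j \<in> J - {i}" for j by (rule D(2)) (use that in blast)
      then show "D p = 0" using Dp[OF D(1)] by simp
    qed
    ultimately show ?thesis using less.hyps less.prems(1) by blast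
  qed
qed

end

subsection \<open>Khovanskii systems\<close>

definition mon :: "('v \<Rightarrow> 'a::comm_ring_1) \<Rightarrow> ('v \<Rightarrow>\<^sub>0 nat) \<Rightarrow> 'a" where
  "mon a m = (\<Prod>v\<in>Poly_Mapping.keys m. a v ^ Poly_Mapping.lookup m v)"

definition mon_deriv :: "'v \<Rightarrow> ('v \<Rightarrow> 'a::comm_ring_1) \<Rightarrow> ('v \<Rightarrow>\<^sub>0 nat) \<Rightarrow> 'a" where
  "mon_deriv v a m = of_nat (Poly_Mapping.lookup m v) * mon a (m - Poly_Mapping.single v 1)"

text \<open>Linear extension from monomials. Evaluation and directional derivatives at a point are
  both of this shape, so that a product rule has to be checked on monomials only.\<close>

definition mpol_extend :: "('c::zero \<Rightarrow> 'a::comm_ring_1) \<Rightarrow> (('v \<Rightarrow>\<^sub>0 nat) \<Rightarrow> 'a) \<Rightarrow> ('v, 'c) mpol \<Rightarrow> 'a" where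
  "mpol_extend h \<phi> f = (\<Sum>m\<in>Poly_Mapping.keys f. h (Poly_Mapping.lookup f m) * \<phi> m)"

lemma mpol_eval_extend: "mpol_eval h a f = mpol_extend h (mon a) f"
  by (simp add: mpol_eval_def mpol_extend_def mon_def)

lemma mon_superset:
  assumes "finite V" "Poly_Mapping.keys m \<subseteq> V"
  shows "mon a m = (\<Prod>v\<in>V. a v ^ Poly_Mapping.lookup m v)"
  unfolding mon_def using assms by (intro prod.mono_neutral_left) (auto simp: in_keys_iff)

lemma mon_add: "mon a (m + n) = mon a m * mon a n"
proof -
  let ?V = "Poly_Mapping.keys m \<union> Poly_Mapping.keys n"
  have "Poly_Mapping.keys (m + n) \<subseteq> ?V" by (rule keys_add)
  then show ?thesis
    by (simp add: mon_superset[of ?V] lookup_add power_add prod.distrib)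
qed

lemma mon_deriv_add:
  fixes a :: "'v \<Rightarrow> 'a::comm_ring_1"
  shows "mon_deriv v a (m + n) = mon_deriv v a m * mon a n + mon a m * mon_deriv v a n"
proof -
  let ?s = "Poly_Mapping.single v (1::nat)"
  have 1: "of_nat (Poly_Mapping.lookup m v) * mon a (m + n - ?s) = mon_deriv v a m * mon a n" for m n :: "'v \<Rightarrow>\<^sub>0 nat"
  proof (cases "Poly_Mapping.lookup m v = 0")
    case False
    have "m + n - ?s = (m - ?s) + n"
      using False by (intro poly_mapping_eqI) (auto simp: lookup_add lookup_minus lookup_single when_def)
    then show ?thesis by (simp add: mon_deriv_def mon_add mult.assoc)
  qed (simp add: mon_deriv_def)
  show ?thesis
    using 1[of m n] 1[of n m] by (simp add: mon_deriv_def lookup_add distrib_right add.commute[of m n] mult_ac)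
qed

lemma derivation_mon:
  fixes a :: "'v \<Rightarrow> 'a::idom"
  assumes D: "derivation D" and V: "finite V" "Poly_Mapping.keys m \<subseteq> V"
  shows "D (mon a m) = (\<Sum>v\<in>V. mon_deriv v a m * D (a v))"
proof -
  have "D (mon a m) = (\<Sum>v\<in>V. D (a v ^ Poly_Mapping.lookup m v) * (\<Prod>w\<in>V - {v}. a w ^ Poly_Mapping.lookup m w))"
    unfolding mon_superset[OF V] by (rule derivation_prod[OF D V(1)])
  also have "\<dots> = (\<Sum>v\<in>V. mon_deriv v a m * D (a v))"
  proof (rule sum.cong[OF refl])
    fix v assume v: "v \<in> V"
    let ?s = "Poly_Mapping.single v (1::nat)"
    have "Poly_Mapping.keys (m - ?s) \<subseteq> V"
      using V(2) by (auto simp: in_keys_iff lookup_minus subset_iff)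
    then have "mon a (m - ?s) = (\<Prod>w\<in>V. a w ^ Poly_Mapping.lookup (m - ?s) w)"
      by (rule mon_superset[OF V(1)])
    also have "\<dots> = a v ^ (Poly_Mapping.lookup m v - 1) * (\<Prod>w\<in>V - {v}. a w ^ Poly_Mapping.lookup (m - ?s) w)"
      using v V(1) by (simp add: prod.remove lookup_minus)
    also have "(\<Prod>w\<in>V - {v}. a w ^ Poly_Mapping.lookup (m - ?s) w) = (\<Prod>w\<in>V - {v}. a w ^ Poly_Mapping.lookup m w)"
      by (intro prod.cong) (auto simp: lookup_minus lookup_single when_def)
    finally show "D (a v ^ Poly_Mapping.lookup m v) * (\<Prod>w\<in>V - {v}. a w ^ Poly_Mapping.lookup m w) =
        mon_deriv v a m * D (a v)"
      by (simp add: derivation_power[OF D] mon_deriv_def mult_ac)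
  qed
  finally show ?thesis .
qed

lemma mpol_sum_monomials:
  fixes f :: "('v, 'c::comm_ring_1) mpol"
  shows "(\<Sum>m\<in>Poly_Mapping.keys f. Poly_Mapping.single m (Poly_Mapping.lookup f m)) = f"
  by (rule poly_mapping_eqI) (auto simp: lookup_sum lookup_single when_def in_keys_iff)

context
  fixes h :: "'c::comm_ring_1 \<Rightarrow> 'a::comm_ring_1"
  assumes h_add: "h (x + y) = h x + h y" and h_mult: "h (x * y) = h x * h y" and h_1: "h 1 = 1"
begin

lemma hom_0: "h 0 = 0"
  using h_add[of 0 0] by (metis add.right_neutral add_left_cancel)

lemma hom_of_nat: "h (of_nat n) = of_nat n"
  by (induction n) (simp_all add: hom_0 h_1 h_add)

lemma mpol_extend_superset:
  assumes "finite M" "Poly_Mapping.keys f \<subseteq> M"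
  shows "mpol_extend h \<phi> f = (\<Sum>m\<in>M. h (Poly_Mapping.lookup f m) * \<phi> m)"
  unfolding mpol_extend_def using assms by (intro sum.mono_neutral_left) (auto simp: in_keys_iff hom_0)

lemma mpol_extend_add: "mpol_extend h \<phi> (f + g) = mpol_extend h \<phi> f + mpol_extend h \<phi> g"
proof -
  let ?M = "Poly_Mapping.keys f \<union> Poly_Mapping.keys g"
  have "Poly_Mapping.keys (f + g) \<subseteq> ?M" by (rule keys_add)
  then show ?thesis
    by (simp add: mpol_extend_superset[of ?M] lookup_add h_add distrib_right sum.distrib)
qed

lemma mpol_extend_0: "mpol_extend h \<phi> 0 = 0"
  by (simp add: mpol_extend_def)

lemma mpol_extend_diff: "mpol_extend h \<phi> (f - g) = mpol_extend h \<phi> f - mpol_extend h \<phi> g"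
  using mpol_extend_add[of \<phi> "f - g" g] by simp

lemma mpol_extend_single: "mpol_extend h \<phi> (Poly_Mapping.single m c) = h c * \<phi> m"
  by (subst mpol_extend_superset[of "{m}"]) (auto simp: lookup_single)

lemma mpol_extend_sum: "mpol_extend h \<phi> (\<Sum>i\<in>I. g i) = (\<Sum>i\<in>I. mpol_extend h \<phi> (g i))"
  by (induction I rule: infinite_finite_induct) (simp_all add: mpol_extend_0 mpol_extend_add)

lemma mpol_extend_mult:
  "mpol_extend h \<phi> (f * g) = (\<Sum>m\<in>Poly_Mapping.keys f. \<Sum>n\<in>Poly_Mapping.keys g.
     h (Poly_Mapping.lookup f m) * h (Poly_Mapping.lookup g n) * \<phi> (m + n))"
proof -
  have "f * g = (\<Sum>m\<in>Poly_Mapping.keys f. Poly_Mapping.single m (Poly_Mapping.lookup f m)) *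
      (\<Sum>n\<in>Poly_Mapping.keys g. Poly_Mapping.single n (Poly_Mapping.lookup g n))"
    by (simp only: mpol_sum_monomials)
  also have "\<dots> = (\<Sum>m\<in>Poly_Mapping.keys f. \<Sum>n\<in>Poly_Mapping.keys g.
      Poly_Mapping.single (m + n) (Poly_Mapping.lookup f m * Poly_Mapping.lookup g n))"
    by (simp add: sum_product mult_single)
  finally show ?thesis by (simp add: mpol_extend_sum mpol_extend_single h_mult)
qed

lemma mpol_extend_leibniz:
  assumes "\<And>m n. \<psi> (m + n) = \<psi> m * mon a n + mon a m * \<psi> n"
  shows "mpol_extend h \<psi> (f * g) = mpol_eval h a f * mpol_extend h \<psi> g + mpol_extend h \<psi> f * mpol_eval h a g"
  unfolding mpol_extend_mult assms mpol_eval_extend unfolding mpol_extend_def sum_product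
  by (simp add: sum.distrib[symmetric] distrib_left mult_ac add.commute)

lemma mpol_eval_mult: "mpol_eval h a (f * g) = mpol_eval h a f * mpol_eval h a g"
  unfolding mpol_eval_extend mpol_extend_mult mon_add unfolding mpol_extend_def sum_product
  by (simp add: mult_ac)

lemma mpol_eval_pderiv: "mpol_eval h a (mpol_pderiv v f) = mpol_extend h (mon_deriv v a) f"
  unfolding mpol_pderiv_def mpol_eval_extend mpol_extend_sum mpol_extend_single h_mult hom_of_nat
  by (simp add: mpol_extend_def mon_deriv_def mult_ac)

end

lemma derivation_mpol_eval:
  fixes a :: "'v \<Rightarrow> 'a::idom"
  assumes D: "derivation D" and f: "\<forall>m. D (Poly_Mapping.lookup f m) = 0"
    and V: "finite V" "mpol_indets f \<subseteq> V"
  shows "D (mpol_eval (\<lambda>c. c) a f) = (\<Sum>v\<in>V. mpol_eval (\<lambda>c. c) a (mpol_pderiv v f) * D (a v))"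
proof -
  have "Poly_Mapping.keys m \<subseteq> V" if "m \<in> Poly_Mapping.keys f" for m
    using that V(2) by (auto simp: mpol_indets_def)
  then have "D (mpol_eval (\<lambda>c. c) a f) =
      (\<Sum>m\<in>Poly_Mapping.keys f. Poly_Mapping.lookup f m * (\<Sum>v\<in>V. mon_deriv v a m * D (a v)))"
    unfolding mpol_eval_extend mpol_extend_def
    using f by (simp add: derivation_sum[OF D] derivation_mult[OF D] derivation_mon[OF D V(1)])
  also have "\<dots> = (\<Sum>v\<in>V. mpol_eval (\<lambda>c. c) a (mpol_pderiv v f) * D (a v))"
    unfolding mpol_eval_pderiv[of "\<lambda>c. c", simplified] mpol_extend_def
    by (simp add: sum_distrib_left sum_distrib_right mult.assoc sum.swap[of _ V])
  finally show ?thesis .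
qed

lemma mpol_indets_diff: "mpol_indets (f - g) \<subseteq> mpol_indets f \<union> mpol_indets (g :: ('v, 'c::comm_ring_1) mpol)"
proof -
  have "Poly_Mapping.keys (f - g) \<subseteq> Poly_Mapping.keys f \<union> Poly_Mapping.keys g"
    by (auto simp: in_keys_iff lookup_minus)
  then show ?thesis by (auto simp: mpol_indets_def)
qed

lemma mpol_indets_mult: "mpol_indets (f * g) \<subseteq> mpol_indets f \<union> mpol_indets (g :: ('v, 'c::comm_ring_1) mpol)"
proof
  fix v assume "v \<in> mpol_indets (f * g)"
  then obtain m where m: "m \<in> Poly_Mapping.keys (f * g)" "v \<in> Poly_Mapping.keys m" by (auto simp: mpol_indets_def)
  then obtain m1 m2 where "m = m1 + m2" "m1 \<in> Poly_Mapping.keys f" "m2 \<in> Poly_Mapping.keys g"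
    using keys_mult by blast
  moreover have "Poly_Mapping.keys (m1 + m2) \<subseteq> Poly_Mapping.keys m1 \<union> Poly_Mapping.keys m2" by (rule keys_add)
  ultimately show "v \<in> mpol_indets f \<union> mpol_indets g" using m(2) by (auto simp: mpol_indets_def)
qed

text \<open>Gaussian elimination on a possibly infinite set of rows: some row \<open>s\<close> has a
  nonzero last entry, and clearing the last column with it leaves the same problem with one column
  less.\<close>

lemma trivial_kernel_finite_rows:
  fixes A :: "(nat \<Rightarrow> 'a::field) set"
  assumes "\<And>b. \<forall>r\<in>A. (\<Sum>j<k. r j * b j) = 0 \<Longrightarrow> \<forall>j<k. b j = 0"
  shows "\<exists>r. (\<forall>i<k. r i \<in> A) \<and> (\<forall>b. (\<forall>i<k. (\<Sum>j<k. r i j * b j) = 0) \<longrightarrow> (\<forall>j<k. b j = 0))"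
  using assms
proof (induction k arbitrary: A)
  case (Suc k)
  have "\<exists>s\<in>A. s k \<noteq> 0"
  proof (rule ccontr)
    assume "\<not> ?thesis"
    then have "\<forall>r\<in>A. (\<Sum>j<Suc k. r j * (if j = k then 1 else 0)) = 0" by simp
    from Suc.prems[OF this] show False by auto
  qed
  then obtain s where s: "s \<in> A" "s k \<noteq> 0" by blast
  define el where "el r = (\<lambda>j. r j - r k / s k * s j)" for r
  have el: "(\<Sum>j<k. el r j * b j) = (\<Sum>j<Suc k. r j * b j) - r k / s k * (\<Sum>j<Suc k. s j * b j)" for r b
    using s(2) by (simp add: el_def left_diff_distrib sum_subtractf sum_distrib_left mult.assoc algebra_simps)
  have "\<exists>r. (\<forall>i<k. r i \<in> el ` A) \<and> (\<forall>b. (\<forall>i<k. (\<Sum>j<k. r i j * b j) = 0) \<longrightarrow> (\<forall>j<k. b j = 0))"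
  proof (rule Suc.IH)
    fix b assume b: "\<forall>r\<in>el ` A. (\<Sum>j<k. r j * b j) = 0"
    define b' where "b' = b(k := - (\<Sum>j<k. s j * b j) / s k)"
    have bb: "(\<Sum>j<k. r j * b' j) = (\<Sum>j<k. r j * b j)" for r by (intro sum.cong) (auto simp: b'_def)
    have s0: "(\<Sum>j<Suc k. s j * b' j) = 0" using s(2) by (simp add: bb) (simp add: b'_def)
    have "\<forall>r\<in>A. (\<Sum>j<Suc k. r j * b' j) = 0"
      using b el[of _ b'] s0 bb by force
    then have "\<forall>j<Suc k. b' j = 0" by (rule Suc.prems)
    then show "\<forall>j<k. b j = 0" by (metis b'_def fun_upd_other less_SucI nat_neq_iff)
  qed
  then obtain r where r: "\<And>i. i < k \<Longrightarrow> r i \<in> el ` A"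
    and tr: "\<And>b. \<forall>i<k. (\<Sum>j<k. r i j * b j) = 0 \<Longrightarrow> \<forall>j<k. b j = 0" by blast
  then have "\<forall>i. \<exists>q. i < k \<longrightarrow> q \<in> A \<and> r i = el q" by blast
  then obtain q where q: "\<And>i. i < k \<Longrightarrow> q i \<in> A \<and> r i = el (q i)" by metis
  have "\<forall>j<Suc k. b j = 0" if b: "\<forall>i<Suc k. (\<Sum>j<Suc k. (q(k := s)) i j * b j) = 0" for b
  proof -
    have s0: "(\<Sum>j<Suc k. s j * b j) = 0" using b[rule_format, of k] by simp
    have "(\<Sum>j<k. r i j * b j) = 0" if i: "i < k" for i
      using q[OF i] el[of "q i" b] s0 b[rule_format, of i] i by simp
    then have "\<forall>j<k. b j = 0" using tr by blast
    moreover from this have "s k * b k = 0" using s0 by simp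
    ultimately show ?thesis using s(2) by (auto simp: less_Suc_eq)
  qed
  moreover have "\<forall>i<Suc k. (q(k := s)) i \<in> A" using q s(1) by (auto simp: less_Suc_eq)
  ultimately show ?case by blast
qed simp

lemma trivial_kernel_det_nonzero:
  fixes r :: "nat \<Rightarrow> nat \<Rightarrow> 'a::field"
  assumes "\<And>b. \<forall>i<k. (\<Sum>j<k. r i j * b j) = 0 \<Longrightarrow> \<forall>j<k. b j = 0"
  shows "det (mat k k (\<lambda>(i, j). r i j)) \<noteq> 0"
proof
  let ?A = "mat k k (\<lambda>(i, j). r i j)"
  assume "det ?A = 0"
  then obtain v where v: "v \<in> carrier_vec k" "v \<noteq> 0\<^sub>v k" "?A *\<^sub>v v = 0\<^sub>v k"
    using det_0_iff_vec_prod_zero_field[of ?A k] by auto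
  have "(\<Sum>j<k. r i j * v $ j) = 0" if "i < k" for i
    using arg_cong[OF v(3), of "\<lambda>w. vec_index w i"] that v(1)
    by (simp add: scalar_prod_def atLeast0LessThan)
  then have "\<forall>j<k. v $ j = 0" using assms by blast
  then have "v = 0\<^sub>v k" using v(1) by (intro eq_vecI) auto
  then show False using v(2) by simp
qed

context exponential_field
begin

text \<open>
  A vector killed by all rows \<open>(\<partial>f/\<partial>X\<^sub>j)\<^sub>j\<close>, for \<open>f\<close> vanishing at \<open>x\<close>, defines a derivation respecting
  \<open>E\<close> on \<open>x\<close>; by rigidity it vanishes, so some \<open>k\<close> rows form a nonsingular system.
\<close>

lemma exp_algebraicI:
  fixes x :: "nat \<Rightarrow> 'a"
  assumes k: "0 < k" and rigid: "x ` {..<k} \<subseteq> exp_consts (x ` {..<k})"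
  shows "exp_algebraic E (x 0)"
proof -
  define a where "a v = (case v of IVar j \<Rightarrow> x j | IExp j \<Rightarrow> E (x j))" for v
  \<comment> \<open>The derivative of a monomial along \<open>X_j\<close>, with the factor
    \<open>E (x j)\<close> coming from the chain rule.\<close>
  define dm where "dm j m = mon_deriv (IVar j) a m + E (x j) * mon_deriv (IExp j) a m" for j m
  have ev: "exp_poly_eval E x f = mpol_eval of_int a f" for f
    by (simp add: exp_poly_eval_def a_def[abs_def])
  note ring = of_int_add of_int_mult of_int_1
  have dev: "exp_poly_eval E x (exp_poly_deriv j f) = mpol_extend of_int (dm j) f" for j f
  proof -
    have "exp_poly_eval E x (exp_poly_deriv j f) = mpol_extend of_int (mon_deriv (IVar j) a) f
        + mpol_eval of_int a (Poly_Mapping.single (Poly_Mapping.single (IExp j) 1) 1) * mpol_extend of_int (mon_deriv (IExp j) a) f"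
      unfolding ev exp_poly_deriv_def
      by (simp add: mpol_eval_extend mpol_extend_add mpol_eval_mult[unfolded mpol_eval_extend]
          mpol_eval_pderiv[unfolded mpol_eval_extend])
    also have "mpol_eval of_int a (Poly_Mapping.single (Poly_Mapping.single (IExp j) 1) 1) = E (x j)"
      by (simp add: mpol_eval_extend mpol_extend_single mon_def a_def)
    finally show ?thesis
      by (simp add: mpol_extend_def dm_def distrib_left sum.distrib sum_distrib_left mult_ac)
  qed
  define I where "I = {f \<in> exp_polys k. exp_poly_eval E x f = 0}"
  define row where "row f = (\<lambda>j. exp_poly_eval E x (exp_poly_deriv j f))" for f
  have "\<forall>j<k. b j = 0" if b: "\<forall>r\<in>row ` I. (\<Sum>j<k. r j * b j) = 0" for b
  proof -
    \<comment> \<open>The derivative of a monomial at \<open>x\<close> in the direction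
      \<open>b\<close>.\<close>
    define \<psi> where "\<psi> m = (\<Sum>j<k. dm j m * b j)" for m
    have \<psi>: "mpol_extend of_int \<psi> f = (\<Sum>j<k. row f j * b j)" for f
      by (simp add: mpol_extend_def \<psi>_def row_def dev sum_distrib_left sum_distrib_right mult.assoc
          sum.swap[of _ "{..<k}"])
    have dm_add: "dm j (m + n) = dm j m * mon a n + mon a m * dm j n" for j m n
      by (simp add: dm_def mon_deriv_add algebra_simps)
    have \<psi>_add: "\<psi> (m + n) = \<psi> m * mon a n + mon a m * \<psi> n" for m n
      by (simp add: \<psi>_def dm_add distrib_right distrib_left sum.distrib sum_distrib_left sum_distrib_right mult_ac)
    \<comment> \<open>The candidate derivation on the ring generated by the \<open>x j\<close> and
      \<open>E (x j)\<close>. It is single-valued precisely because \<open>b\<close> is killed by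
      the rows of all polynomials vanishing at \<open>x\<close>.\<close>
    define G where "G = (\<lambda>f. (mpol_eval of_int a f, mpol_extend of_int \<psi> f)) ` exp_polys k"
    have G: "deriv_graph G"
      unfolding deriv_graph_def
    proof (intro conjI allI impI)
      have "Poly_Mapping.single 0 1 \<in> exp_polys k" by (simp add: exp_polys_def mpol_indets_def)
      moreover have "\<psi> 0 = 0" by (simp add: \<psi>_def dm_def mon_deriv_def)
      ultimately show "(1, 0) \<in> G"
        unfolding G_def by (intro image_eqI[of _ _ "Poly_Mapping.single 0 1"])
          (simp_all add: mpol_eval_extend mpol_extend_single mon_def del: single_one)
      show "c = 0" if "(0, c) \<in> G" for c
        using that b unfolding G_def \<psi> I_def ev by auto
      have "(u - v, u' - v') \<in> G \<and> (u * v, u * v' + u' * v) \<in> G" if uv: "(u, u') \<in> G" "(v, v') \<in> G" for u u' v v'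
      proof -
        obtain f g where f: "f \<in> exp_polys k" "u = mpol_eval of_int a f" "u' = mpol_extend of_int \<psi> f"
          and g: "g \<in> exp_polys k" "v = mpol_eval of_int a g" "v' = mpol_extend of_int \<psi> g"
          using uv by (auto simp: G_def)
        have "f - g \<in> exp_polys k" "f * g \<in> exp_polys k"
          using f(1) g(1) mpol_indets_diff[of f g] mpol_indets_mult[of f g] by (auto simp: exp_polys_def)
        moreover have "mpol_eval of_int a (f - g) = u - v" "mpol_extend of_int \<psi> (f - g) = u' - v'"
          "mpol_eval of_int a (f * g) = u * v" "mpol_extend of_int \<psi> (f * g) = u * v' + u' * v"
          using f g by (simp_all add: mpol_eval_extend[of _ _ "f - g"] mpol_extend_diff mpol_eval_mult
              mpol_extend_leibniz[OF _ _ _ \<psi>_add]) (simp_all add: mpol_eval_extend)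
        ultimately show ?thesis unfolding G_def by (metis (no_types, lifting) image_eqI)
      qed
      then show "\<forall>(u, u')\<in>G. \<forall>(v, v')\<in>G. (u - v, u' - v') \<in> G \<and> (u * v, u * v' + u' * v) \<in> G" by blast
    qed
    obtain D where D: "derivation D" "\<And>u u'. (u, u') \<in> G \<Longrightarrow> D u = u'"
      by (rule deriv_graph_extend[OF G]) (rule that)
    define X :: "exp_indet \<Rightarrow> exp_poly" where "X v = Poly_Mapping.single (Poly_Mapping.single v 1) 1" for v
    have Xk: "X (IVar j) \<in> exp_polys k" "X (IExp j) \<in> exp_polys k" if "j < k" for j
      using that by (auto simp: X_def exp_polys_def mpol_indets_def)
    have mdX: "mon_deriv v a (Poly_Mapping.single w 1) = (if v = w then 1 else 0)" for v w
      by (auto simp: mon_deriv_def mon_def lookup_single)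
    have \<psi>X: "\<psi> (Poly_Mapping.single (IVar j) 1) = b j" "\<psi> (Poly_Mapping.single (IExp j) 1) = E (x j) * b j"
      if "j < k" for j
      using that by (simp_all add: \<psi>_def dm_def mdX[unfolded One_nat_def] distrib_right sum.distrib if_distrib[of "\<lambda>u. _ * u"] if_distrib[of "\<lambda>u. u * _"] cong: if_cong)
    have evX: "mpol_eval of_int a (X v) = a v" for v
      by (simp add: X_def mpol_eval_extend mpol_extend_single mon_def)
    have Dx: "D (x j) = b j" "D (E (x j)) = E (x j) * b j" if j: "j < k" for j
    proof -
      have "(a v, \<psi> (Poly_Mapping.single v 1)) \<in> G" if "X v \<in> exp_polys k" for v
        unfolding G_def using that evX[of v]
        by (intro image_eqI[of _ _ "X v"]) (simp_all add: X_def mpol_extend_single)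
      from D(2)[OF this[OF Xk(1)[OF j]]] D(2)[OF this[OF Xk(2)[OF j]]] \<psi>X[OF j]
      show "D (x j) = b j" "D (E (x j)) = E (x j) * b j" by (simp_all add: a_def)
    qed
    then have "D \<in> exp_derivs (x ` {..<k})" using D(1) by (auto simp: exp_derivs_def ldiff_eq_0_iff)
    \<comment> \<open>Rigidity: the extended derivation kills the forms of the \<open>x j\<close>,
      so it kills the \<open>x j\<close>, whose derivatives are the entries of
      \<open>b\<close>.\<close>
    then have "D (x j) = 0" if "j < k" for j using rigid that unfolding exp_consts_def by blast
    then show ?thesis using Dx(1) by simp
  qed
  then obtain r where r: "\<And>i. i < k \<Longrightarrow> r i \<in> row ` I"
    and tr: "\<And>b. \<forall>i<k. (\<Sum>j<k. r i j * b j) = 0 \<Longrightarrow> \<forall>j<k. b j = 0"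
    using trivial_kernel_finite_rows[of "row ` I" k] by blast
  from r have "\<forall>i. \<exists>g. i < k \<longrightarrow> g \<in> I \<and> r i = row g" by blast
  then obtain f where f: "\<And>i. i < k \<Longrightarrow> f i \<in> I \<and> r i = row (f i)" by metis
  have "mat k k (\<lambda>(i, j). exp_poly_eval E x (exp_poly_deriv j (f i))) = mat k k (\<lambda>(i, j). r i j)"
    using f by (intro eq_matI) (auto simp: row_def)
  then have "det (mat k k (\<lambda>(i, j). exp_poly_eval E x (exp_poly_deriv j (f i)))) \<noteq> 0"
    using trivial_kernel_det_nonzero[OF tr] by simp
  then show ?thesis
    unfolding exp_algebraic_def using k f by (intro exI[of _ k] exI[of _ x] exI[of _ f]) (auto simp: I_def)
qed

text \<open>After the reduction, \<open>p\<close> is put in front of the list, since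
  \<open>exp_algebraic\<close> concerns the first coordinate. An additional element leaves fewer
  derivations and so more constants; rigidity is preserved.\<close>

lemma exp_algebraic_if_exp_const:
  fixes J :: "nat set"
  assumes "finite J" "p \<in> exp_consts (b ` J)"
  shows "exp_algebraic E p"
proof -
  obtain J' :: "nat set" and b' where J': "finite J'" "p \<in> exp_consts (b' ` J')"
      "b' ` J' \<subseteq> exp_consts (b' ` J')"
    using exp_const_reduce[OF assms] by blast
  obtain us where us: "set us = b' ` J'" using finite_list[of "b' ` J'"] J'(1) by auto
  define x where "x i = (p # us) ! i" for i
  have x: "x ` {..<Suc (length us)} = insert p (b' ` J')"
    using us nth_image[of "Suc (length us)" "p # us"] by (simp add: x_def[abs_def] atLeast0LessThan)
  have "exp_derivs (insert p (b' ` J')) \<subseteq> exp_derivs (b' ` J')" by (auto simp: exp_derivs_def)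
  then have "exp_consts (b' ` J') \<subseteq> exp_consts (insert p (b' ` J'))" unfolding exp_consts_def by blast
  then have "x ` {..<Suc (length us)} \<subseteq> exp_consts (x ` {..<Suc (length us)})"
    unfolding x using J'(2,3) by blast
  from exp_algebraicI[OF _ this] show ?thesis by (simp add: x_def)
qed

end

subsection \<open>Transcendence degree and the theorem\<close>

text \<open>Truncated subtraction can merge two monomials only if one of them omits
  \<open>v\<close>, and that one contributes a zero coefficient. The remaining source of
  \<open>m\<close> is \<open>m\<close> times \<open>v\<close>.\<close>

lemma lookup_mpol_pderiv:
  "Poly_Mapping.lookup (mpol_pderiv v f) m =
     of_nat (Poly_Mapping.lookup m v + 1) * Poly_Mapping.lookup f (m + Poly_Mapping.single v 1)"
proof -
  let ?s = "Poly_Mapping.single v (1::nat)"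
  have eq: "(of_nat (Poly_Mapping.lookup n v) * Poly_Mapping.lookup f n when n - ?s = m) =
      (if n = m + ?s then of_nat (Poly_Mapping.lookup n v) * Poly_Mapping.lookup f n else 0)" for n
  proof (cases "Poly_Mapping.lookup n v = 0")
    case True
    then have "n \<noteq> m + ?s" by (auto simp: lookup_add)
    then show ?thesis using True by simp
  next
    case False
    then have "n = (n - ?s) + ?s"
      by (intro poly_mapping_eqI) (auto simp: lookup_add lookup_minus lookup_single when_def)
    then have "n - ?s = m \<longleftrightarrow> n = m + ?s" by (metis add_diff_cancel_right')
    then show ?thesis by (simp add: when_def)
  qed
  have "Poly_Mapping.lookup (mpol_pderiv v f) m = (\<Sum>n\<in>Poly_Mapping.keys f.
      if n = m + ?s then of_nat (Poly_Mapping.lookup n v) * Poly_Mapping.lookup f n else 0)"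
    by (simp only: mpol_pderiv_def lookup_sum lookup_single eq)
  then show ?thesis by (auto simp: lookup_add in_keys_iff)
qed

text \<open>Differentiate a minimal relation \<open>f\<close>. Since \<open>S\<close> is
  independent, \<open>a\<close> occurs in \<open>f\<close>, so the partial derivative at
  \<open>a\<close> is a nonzero smaller polynomial; by minimality its value is nonzero, and the
  equation can be solved for \<open>D a\<close>.\<close>

lemma derivation_algebraic_dependence:
  fixes K :: "'a::field_char_0 set"
  assumes K: "subring K" and S: "finite S" "alg_independent K S" "a \<notin> S" "\<not> alg_independent K (insert a S)"
  shows "\<exists>c. \<forall>D. derivation D \<longrightarrow> (\<forall>u\<in>K. D u = 0) \<longrightarrow> D a = (\<Sum>s\<in>S. c s * D s)"
proof -
  define P where "P f \<longleftrightarrow> (\<forall>m. Poly_Mapping.lookup f m \<in> K) \<and> mpol_indets f \<subseteq> insert a S \<and>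
      mpol_eval (\<lambda>c. c) (\<lambda>s. s) f = 0 \<and> f \<noteq> 0" for f :: "('a, 'a) mpol"
  \<comment> \<open>The exponents of \<open>a\<close> summed over all monomials: differentiation
    lowers each surviving positive exponent by one and creates no further monomials.\<close>
  define \<mu> where "\<mu> f = (\<Sum>m\<in>Poly_Mapping.keys f. Poly_Mapping.lookup m a)" for f :: "('a, 'a) mpol"
  obtain f0 where "P f0" using S(4) unfolding alg_independent_def P_def by blast
  from ex_has_least_nat[of P f0 \<mu>, OF this] obtain f where f: "P f" and min: "\<And>g. P g \<Longrightarrow> \<mu> f \<le> \<mu> g"
    by blast
  define g where "g = mpol_pderiv a f"
  let ?s = "Poly_Mapping.single a (1::nat)"
  have g: "Poly_Mapping.lookup g m = of_nat (Poly_Mapping.lookup m a + 1) * Poly_Mapping.lookup f (m + ?s)" for m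
    unfolding g_def by (rule lookup_mpol_pderiv)
  have "\<not> mpol_indets f \<subseteq> S"
    using f S(2) unfolding alg_independent_def P_def by blast
  then have "a \<in> mpol_indets f" using f unfolding P_def by blast
  then obtain n where n: "n \<in> Poly_Mapping.keys f" "Poly_Mapping.lookup n a \<noteq> 0"
    by (auto simp: mpol_indets_def in_keys_iff)
  have n': "(n - ?s) + ?s = n"
    using n(2) by (intro poly_mapping_eqI) (auto simp: lookup_add lookup_minus lookup_single when_def)
  have kg: "(\<lambda>m. m + ?s) ` Poly_Mapping.keys g \<subseteq> Poly_Mapping.keys f"
    by (auto simp: in_keys_iff g)
  have "\<mu> g < \<mu> f"
  proof -
    have "\<mu> g = (\<Sum>m\<in>(\<lambda>m. m + ?s) ` Poly_Mapping.keys g. Poly_Mapping.lookup m a - 1)"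
      unfolding \<mu>_def by (subst sum.reindex) (auto simp: inj_on_def lookup_add)
    also have "\<dots> \<le> (\<Sum>m\<in>Poly_Mapping.keys f. Poly_Mapping.lookup m a - 1)"
      by (rule sum_mono2[OF _ kg]) auto
    also have "\<dots> < \<mu> f"
      unfolding \<mu>_def using n(2) by (intro sum_strict_mono_ex1 bexI[OF _ n(1)]) auto
    finally show ?thesis .
  qed
  then have "\<not> P g" using min leD by blast
  moreover have "g \<noteq> 0"
  proof
    assume "g = 0"
    then have "Poly_Mapping.lookup g (n - ?s) = 0" by simp
    then have "Poly_Mapping.lookup f n = 0" unfolding g n' by (simp del: of_nat_Suc)
    then show False using n(1) by (simp add: in_keys_iff)
  qed
  moreover have "mpol_indets g \<subseteq> insert a S"
  proof
    fix v assume "v \<in> mpol_indets g"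
    then obtain m where m: "m \<in> Poly_Mapping.keys g" "v \<in> Poly_Mapping.keys m" by (auto simp: mpol_indets_def)
    then have "m + ?s \<in> Poly_Mapping.keys f" "v \<in> Poly_Mapping.keys (m + ?s)"
      using imageI[OF m(1), of "\<lambda>m. m + ?s"] kg by (blast, simp add: in_keys_iff lookup_add)
    then have "v \<in> mpol_indets f" by (auto simp: mpol_indets_def)
    then show "v \<in> insert a S" using f by (auto simp: P_def)
  qed
  moreover have "\<forall>m. Poly_Mapping.lookup g m \<in> K"
    unfolding g using f by (auto simp: P_def intro!: subring_mult[OF K] subring_of_nat[OF K] simp del: of_nat_Suc of_nat_add)
  ultimately have nz: "mpol_eval (\<lambda>c. c) (\<lambda>s. s) g \<noteq> 0" by (auto simp: P_def)
  define c where "c s = - mpol_eval (\<lambda>c. c) (\<lambda>s. s) (mpol_pderiv s f) / mpol_eval (\<lambda>c. c) (\<lambda>s. s) g" for s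
  have "D a = (\<Sum>s\<in>S. c s * D s)" if D: "derivation D" "\<forall>u\<in>K. D u = 0" for D
  proof -
    have "0 = D (mpol_eval (\<lambda>c. c) (\<lambda>s. s) f)" using f by (simp add: P_def derivation_0[OF D(1)])
    also have "\<dots> = (\<Sum>s\<in>insert a S. mpol_eval (\<lambda>c. c) (\<lambda>s. s) (mpol_pderiv s f) * D s)"
      using f D S(1) by (intro derivation_mpol_eval) (auto simp: P_def)
    also have "\<dots> = mpol_eval (\<lambda>c. c) (\<lambda>s. s) g * D a + (\<Sum>s\<in>S. mpol_eval (\<lambda>c. c) (\<lambda>s. s) (mpol_pderiv s f) * D s)"
      using S by (simp add: g_def)
    finally have "D a = - (\<Sum>s\<in>S. mpol_eval (\<lambda>c. c) (\<lambda>s. s) (mpol_pderiv s f) * D s) / mpol_eval (\<lambda>c. c) (\<lambda>s. s) g"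
      using nz by (simp add: field_simps eq_neg_iff_add_eq_0)
    also have "\<dots> = (\<Sum>s\<in>S. c s * D s)"
      by (simp add: c_def sum_divide_distrib sum_negf[symmetric])
    finally show ?thesis .
  qed
  then show ?thesis by blast
qed

section \<open>Transcendence degree and the span of derivations\<close>

lemma field_gen_superset: "X \<subseteq> field_gen X"
  unfolding field_gen_def by (rule hull_subset)

lemma field_gen_minimal: "X \<subseteq> K \<Longrightarrow> is_subfield K \<Longrightarrow> field_gen X \<subseteq> K"
  unfolding field_gen_def by (rule hull_minimal)

lemma is_subfield_field_gen: "is_subfield (field_gen X)"
  unfolding field_gen_def by (rule hull_in) (auto simp: is_subfield_def)

lemma is_subfield_kernel:
  fixes D :: "'a::field_char_0 \<Rightarrow> 'a"
  assumes D: "derivation D"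
  shows "is_subfield {a. D a = 0}"
  unfolding is_subfield_def
proof (intro conjI ballI)
  fix a assume "a \<in> {a. D a = 0}"
  then show "inverse a \<in> {a. D a = 0}"
    by (cases "a = 0") (simp_all add: derivation_inverse[OF D] derivation_0[OF D])
qed (simp_all add: derivation_0[OF D] derivation_1[OF D] derivation_add[OF D] derivation_mult[OF D]
    derivation_minus[OF D])

text \<open>Take for \<open>S\<close> a largest algebraically independent subset of
  \<open>X\<close>, so that \<open>card S\<close> is bounded by the transcendence degree. The other
  elements of \<open>X\<close> depend algebraically on \<open>S\<close>, so the values of a
  derivation on \<open>S\<close> determine those on \<open>X\<close>.\<close>

lemma derivations_spanned_if_td_less:
  fixes X Y :: "'a::field_char_0 set"
  assumes X: "finite X" and td: "\<not> enat n \<le> td X Y"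
  shows "\<exists>S c. finite S \<and> card S < n \<and>
    (\<forall>a\<in>X. \<forall>D. derivation D \<longrightarrow> (\<forall>u\<in>Y. D u = 0) \<longrightarrow> D a = (\<Sum>s\<in>S. c a s * D s))"
proof -
  define K where "K = field_gen Y"
  have K: "subring K" unfolding K_def by (intro is_subfield_subring is_subfield_field_gen)
  have "alg_independent K {}"
    unfolding alg_independent_def
  proof (intro allI impI)
    fix f :: "('a, 'a) mpol"
    assume f: "mpol_indets f \<subseteq> {}" "mpol_eval (\<lambda>c. c) (\<lambda>s. s) f = 0"
    then have keys: "Poly_Mapping.keys f \<subseteq> {0}" by (auto simp: mpol_indets_def)
    then have "mpol_eval (\<lambda>c. c) (\<lambda>s. s) f = (\<Sum>m\<in>{0}. Poly_Mapping.lookup f m)"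
      unfolding mpol_eval_def
      by (intro sum.mono_neutral_cong_left) (auto simp: in_keys_iff)
    then have "Poly_Mapping.lookup f 0 = 0" using f(2) by simp
    then show "f = 0" using keys by (intro poly_mapping_eqI) (auto simp: in_keys_iff)
  qed
  then obtain S where S: "S \<subseteq> X" "alg_independent K S"
    and max: "\<And>T. T \<subseteq> X \<Longrightarrow> alg_independent K T \<Longrightarrow> card T \<le> card S"
    using ex_has_greatest_nat[of "\<lambda>T. T \<subseteq> X \<and> alg_independent K T" "{}" card "card X + 1"]
      card_mono[OF X] by (metis empty_subsetI le_imp_less_Suc Suc_eq_plus1)
  have fS: "finite S" using S(1) X finite_subset by blast
  have "enat (card S) \<le> td X Y"
    unfolding td_def trans_degree_def K_def[symmetric]
    using S fS field_gen_superset[of "X \<union> Y"] by (intro SUP_upper) auto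
  then have "enat (card S) < enat n" using td by (meson le_less_trans not_le)
  then have card: "card S < n" by simp
  have "\<exists>c. \<forall>D. derivation D \<longrightarrow> (\<forall>u\<in>K. D u = 0) \<longrightarrow> D a = (\<Sum>s\<in>S. c s * D s)" if a: "a \<in> X" for a
  proof (cases "a \<in> S")
    case True
    have "(\<Sum>s\<in>S. (if s = a then 1 else 0) * D s) = (\<Sum>s\<in>S. if s = a then D s else 0)" for D :: "'a \<Rightarrow> 'a"
      by (intro sum.cong) auto
    then have "D a = (\<Sum>s\<in>S. (if s = a then 1 else 0) * D s)" for D :: "'a \<Rightarrow> 'a"
      using fS True by simp
    then show ?thesis by (intro exI[of _ "\<lambda>s. if s = a then 1 else 0"]) blast
  next
    case False
    have "\<not> alg_independent K (insert a S)" using max[of "insert a S"] S(1) a False fS by auto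
    then show ?thesis by (rule derivation_algebraic_dependence[OF K fS S(2) False])
  qed
  then obtain c where c: "\<And>a D. a \<in> X \<Longrightarrow> derivation D \<Longrightarrow> \<forall>u\<in>K. D u = 0 \<Longrightarrow> D a = (\<Sum>s\<in>S. c a s * D s)"
    by metis
  have K0: "\<forall>u\<in>K. D u = 0" if "derivation D" "\<forall>u\<in>Y. D u = 0" for D
    using field_gen_minimal[OF _ is_subfield_kernel[OF that(1)], of Y] that(2) by (auto simp: K_def)
  show ?thesis
    by (intro exI[of _ S] exI[of _ c] conjI ballI allI impI fS card) (intro c K0; assumption)
qed

text \<open>If zero were the only solution, \<open>n\<close> of the equations would form a
  nonsingular square matrix; but there are fewer than \<open>n\<close> equations, so two of its rows
  coincide.\<close>

lemma underdetermined_system: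
  fixes C :: "nat \<Rightarrow> 's \<Rightarrow> 'a::field"
  assumes "finite S" "card S < n"
  shows "\<exists>g. (\<exists>i<n. g i \<noteq> 0) \<and> (\<forall>s\<in>S. (\<Sum>i<n. g i * C i s) = 0)"
proof (rule ccontr)
  assume neg: "\<not> ?thesis"
  define A where "A = (\<lambda>s i. C i s) ` S"
  have "\<forall>i<n. b i = 0" if "\<forall>r\<in>A. (\<Sum>i<n. r i * b i) = 0" for b
    using neg that by (auto simp: A_def mult.commute)
  then obtain r where r: "\<And>i. i < n \<Longrightarrow> r i \<in> A"
    and tr: "\<And>b. \<forall>i<n. (\<Sum>j<n. r i j * b j) = 0 \<Longrightarrow> \<forall>j<n. b j = 0"
    using trivial_kernel_finite_rows[of A n] by blast
  have "card A < n" using assms card_image_le[OF assms(1), of "\<lambda>s i. C i s"] by (simp add: A_def)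
  moreover have "r ` {..<n} \<subseteq> A" using r by auto
  ultimately have "\<not> inj_on r {..<n}"
    using assms(1) card_inj_on_le[of r "{..<n}" A] by (auto simp: A_def)
  then obtain i j where ij: "i < n" "j < n" "i \<noteq> j" "r i = r j" by (auto simp: inj_on_def)
  have "det (mat n n (\<lambda>(i, j). r i j)) = 0"
    using ij by (intro det_identical_rows[of _ n i j]) (auto intro!: eq_vecI)
  then show False using trivial_kernel_det_nonzero[OF tr] by blast
qed

text \<open>Elimination without division keeps every entry in \<open>P\<close>. The solution
  \<open>g\<close> only witnesses that the rank is too small; at the end a free variable is set to
  \<open>1\<close>, and each back substitution is scaled by the pivot \<open>s n\<close>.\<close>

lemma kernel_over_subring:
  fixes R :: "(nat \<Rightarrow> 'a::idom) set"
  assumes P: "subring P" and R: "\<And>r l. r \<in> R \<Longrightarrow> l < n \<Longrightarrow> r l \<in> P"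
    and g: "\<exists>l<n. g l \<noteq> 0" "\<forall>r\<in>R. (\<Sum>l<n. r l * g l) = 0"
  shows "\<exists>h. (\<forall>l<n. h l \<in> P) \<and> (\<exists>l<n. h l \<noteq> 0) \<and> (\<forall>r\<in>R. (\<Sum>l<n. r l * h l) = 0)"
  using R g
proof (induction n arbitrary: R)
  case (Suc n)
  show ?case
  proof (cases "\<exists>s\<in>R. s n \<noteq> 0")
    case False
    then have "\<forall>r\<in>R. (\<Sum>l<Suc n. r l * (if l = n then 1 else 0)) = 0" by simp
    then show ?thesis
      using subring_0[OF P] subring_1[OF P] by (intro exI[of _ "\<lambda>l. if l = n then 1 else 0"]) auto
  next
    case True
    then obtain s where s: "s \<in> R" "s n \<noteq> 0" by blast
    define el where "el r = (\<lambda>l. s n * r l - r n * s l)" for r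
    have el: "(\<Sum>l<n. el r l * u l) = s n * (\<Sum>l<n. r l * u l) - r n * (\<Sum>l<n. s l * u l)" for r u
      by (simp add: el_def left_diff_distrib sum_subtractf sum_distrib_left mult.assoc)
    have "\<exists>h. (\<forall>l<n. h l \<in> P) \<and> (\<exists>l<n. h l \<noteq> 0) \<and> (\<forall>r\<in>el ` R. (\<Sum>l<n. r l * h l) = 0)"
    proof (rule Suc.IH)
      show "r l \<in> P" if "r \<in> el ` R" "l < n" for r l
        using that Suc.prems(1) s(1) by (auto simp: el_def intro!: subring_diff[OF P] subring_mult[OF P])
      show "\<exists>l<n. g l \<noteq> 0"
      proof (rule ccontr)
        assume "\<not> ?thesis"
        then have z: "\<forall>l<n. g l = 0" by blast
        then have "s n * g n = 0" using Suc.prems(3) s(1) by auto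
        then show False using z s(2) Suc.prems(2) by (auto simp: less_Suc_eq)
      qed
      show "\<forall>r\<in>el ` R. (\<Sum>l<n. r l * g l) = 0"
      proof safe
        fix r assume r: "r \<in> R"
        have "(\<Sum>l<n. u l * g l) = - (u n * g n)" if "u \<in> R" for u
          using Suc.prems(3) that by (simp add: eq_neg_iff_add_eq_0)
        then show "(\<Sum>l<n. el r l * g l) = 0" unfolding el using r s(1) by simp
      qed
    qed
    then obtain h where h: "\<And>l. l < n \<Longrightarrow> h l \<in> P" "\<exists>l<n. h l \<noteq> 0" "\<And>r. r \<in> R \<Longrightarrow> (\<Sum>l<n. el r l * h l) = 0"
      by blast
    define h' where "h' l = (if l = n then - (\<Sum>l<n. s l * h l) else s n * h l)" for l
    have "(\<Sum>l<Suc n. r l * h' l) = 0" if "r \<in> R" for r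
    proof -
      have "(\<Sum>l<n. r l * h' l) = s n * (\<Sum>l<n. r l * h l)"
        by (simp add: h'_def sum_distrib_left mult_ac)
      then have "(\<Sum>l<Suc n. r l * h' l) = (\<Sum>l<n. el r l * h l)" unfolding el by (simp add: h'_def)
      then show ?thesis using h(3)[OF that] by simp
    qed
    moreover have "\<exists>l<Suc n. h' l \<noteq> 0" using h(2) s(2) by (auto simp: h'_def less_Suc_eq)
    moreover have "\<forall>l<Suc n. h' l \<in> P"
      using h(1) s(1) Suc.prems(1)
      by (auto simp: h'_def less_Suc_eq intro!: subring_uminus[OF P] subring_sum[OF P] subring_mult[OF P])
    ultimately show ?thesis by blast
  qed
qed simp

lemma sum_lessThan_add: "(\<Sum>j<m + n. F j) = (\<Sum>j<m. F j) + (\<Sum>i<n. F (m + i :: nat) :: 'a::comm_monoid_add)"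
  by (induction n) (simp_all add: add.assoc)

section \<open>The transcendence bound\<close>

context exponential_field
begin

lemma E_of_int_mult: "E (of_int m * u) = E u powi m"
proof -
  have nat: "E (of_nat k * u) = E u ^ k" for k
    by (induction k) (simp_all add: E_0 E_add distrib_right)
  have "E (- v) = inverse (E v)" for v
    using E_add[of v "- v"] E_nonzero[of v] by (simp add: E_0 field_simps)
  then show ?thesis
    by (cases m rule: int_cases2) (simp_all add: nat power_int_minus)
qed

lemma E_sum: "finite I \<Longrightarrow> E (\<Sum>i\<in>I. g i) = (\<Prod>i\<in>I. E (g i))"
  by (induction I rule: finite_induct) (simp_all add: E_0 E_add)

text \<open>Multiplying a rational relation by the common denominator \<open>N\<close> makes it
  integral, and \<open>E\<close> turns it into a multiplicative relation.\<close>

lemma rat_independent_if_mult_independent: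
  assumes "mult_independent n (\<lambda>i. E (x i))"
  shows "rat_independent_mod {0} {..<n} x"
  unfolding rat_independent_mod_def
proof (intro allI impI)
  fix q :: "nat \<Rightarrow> rat" assume "(\<Sum>i<n. of_rat (q i) * x i) \<in> {0}"
  then have q: "(\<Sum>i<n. of_rat (q i) * x i) = 0" by simp
  define N where "N = (\<Prod>i<n. snd (quotient_of (q i)))"
  have N: "N \<noteq> 0" using quotient_of_denom_pos' by (auto simp: N_def less_le)
  have "\<exists>m. of_int N * q i = of_int m" if "i < n" for i
  proof -
    obtain a b where ab: "quotient_of (q i) = (a, b)" by (cases "quotient_of (q i)")
    then have "of_int b * q i = of_int a"
      using quotient_of_div[OF ab] quotient_of_denom_pos[OF ab] by simp
    moreover have "N = (\<Prod>j\<in>{..<n} - {i}. snd (quotient_of (q j))) * b"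
      unfolding N_def using that ab by (simp add: prod.remove[of _ i] mult.commute)
    ultimately have "of_int N * q i = of_int ((\<Prod>j\<in>{..<n} - {i}. snd (quotient_of (q j))) * a)"
      by (simp add: mult.assoc)
    then show ?thesis by blast
  qed
  then obtain m where m: "\<And>i. i < n \<Longrightarrow> of_int N * q i = of_int (m i)" by metis
  have m': "of_int (m i) = of_int N * (of_rat (q i) :: 'a)" if "i < n" for i
    using arg_cong[OF m[OF that], of "of_rat :: rat \<Rightarrow> 'a"] by (simp add: of_rat_mult)
  have "(\<Sum>i<n. of_int (m i) * x i) = of_int N * (\<Sum>i<n. of_rat (q i) * x i)"
    using m' by (simp add: sum_distrib_left mult.assoc)
  then have "E (\<Sum>i<n. of_int (m i) * x i) = 1" using q by (simp add: E_0)
  then have "(\<Prod>i<n. E (x i) powi m i) = 1" by (simp add: E_sum E_of_int_mult)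
  then have "\<forall>i<n. m i = 0" using assms by (simp add: mult_independent_def)
  then show "\<forall>i\<in>{..<n}. q i = 0" using m N by auto
qed

text \<open>
  When \<open>D p = 0\<close>, the value \<open>ldiff D (p * x i) - p * ldiff D (x i)\<close> only involves \<open>D\<close> on the
  exponentials, so a small transcendence degree forces a relation. Subtracting a multiple of \<open>D0\<close>
  reduces every \<open>D\<close> to this case.
\<close>

lemma ldiff_relation_if_td_less:
  fixes x :: "nat \<Rightarrow> 'a"
  assumes td: "\<not> enat n \<le> td ((\<lambda>i. E (x i)) ` {..<n} \<union> (\<lambda>i. E (p * x i)) ` {..<n}) {p}"
    and D0: "derivation D0" "D0 p \<noteq> 0" "\<And>i. i < n \<Longrightarrow> ldiff D0 (x i) = 0" "\<And>i. i < n \<Longrightarrow> ldiff D0 (p * x i) = 0"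
  shows "\<exists>g. (\<exists>i<n. g i \<noteq> 0) \<and>
    (\<forall>D. derivation D \<longrightarrow> (\<Sum>i<n. g i * (ldiff D (p * x i) - p * ldiff D (x i))) = 0)"
proof -
  define X where "X = (\<lambda>i. E (x i)) ` {..<n} \<union> (\<lambda>i. E (p * x i)) ` {..<n}"
  have "finite X" by (simp add: X_def)
  from derivations_spanned_if_td_less[OF this td[folded X_def]] obtain S c where S: "finite S" "card S < n"
    and "\<forall>a\<in>X. \<forall>D. derivation D \<longrightarrow> (\<forall>u\<in>{p}. D u = 0) \<longrightarrow> D a = (\<Sum>s\<in>S. c a s * D s)" by blast
  then have c: "D a = (\<Sum>s\<in>S. c a s * D s)" if "a \<in> X" "derivation D" "D p = 0" for a D
    using that by simp
  \<comment> \<open>The coefficient of \<open>D s\<close> in the difference of forms when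
    \<open>D p = 0\<close>: the two terms \<open>p * D (x i)\<close> then cancel.\<close>
  define C where "C i s = c (E (p * x i)) s / E (p * x i) - p * (c (E (x i)) s / E (x i))" for i s
  obtain g where g: "\<exists>i<n. g i \<noteq> 0" "\<And>s. s \<in> S \<Longrightarrow> (\<Sum>i<n. g i * C i s) = 0"
    using underdetermined_system[OF S, of C] by blast
  define \<eta> where "\<eta> D i = ldiff D (p * x i) - p * ldiff D (x i)" for D i
  have const: "(\<Sum>i<n. g i * \<eta> D i) = 0" if D: "derivation D" "D p = 0" for D
  proof -
    have "\<eta> D i = (\<Sum>s\<in>S. C i s * D s)" if i: "i < n" for i
    proof -
      have "\<eta> D i = D (E (p * x i)) / E (p * x i) - p * (D (E (x i)) / E (x i))"
        by (simp add: \<eta>_def ldiff_def derivation_mult[OF D(1)] D(2) right_diff_distrib)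
      also have "D (E (p * x i)) = (\<Sum>s\<in>S. c (E (p * x i)) s * D s)" using i by (intro c D) (auto simp: X_def)
      also have "D (E (x i)) = (\<Sum>s\<in>S. c (E (x i)) s * D s)" using i by (intro c D) (auto simp: X_def)
      finally show ?thesis
        by (simp add: C_def sum_divide_distrib sum_distrib_left sum_subtractf left_diff_distrib mult.assoc)
    qed
    then have "(\<Sum>i<n. g i * \<eta> D i) = (\<Sum>s\<in>S. (\<Sum>i<n. g i * C i s) * D s)"
      by (simp add: sum_distrib_left sum_distrib_right mult.assoc sum.swap[of _ S])
    then show ?thesis using g(2) by simp
  qed
  have "(\<Sum>i<n. g i * \<eta> D i) = 0" if D: "derivation D" for D
  proof -
    define t where "t = D p / D0 p"
    define D' where "D' a = D a - t * D0 a" for a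
    have D': "derivation D'" "D' p = 0"
      using D0(1,2) D by (auto simp: D'_def derivation_def t_def algebra_simps add_divide_distrib)
    have "ldiff D' u = ldiff D u - t * ldiff D0 u" for u
      by (simp add: ldiff_def D'_def diff_divide_distrib algebra_simps)
    then have "\<eta> D' i = \<eta> D i" if "i < n" for i using D0(3,4)[OF that] by (simp add: \<eta>_def)
    then show ?thesis using const[OF D'] by simp
  qed
  then show ?thesis using g(1) unfolding \<eta>_def by blast
qed

lemma td_exp_transcendental_power:
  fixes x :: "nat \<Rightarrow> 'a"
  assumes p: "exp_transcendental E p" and x: "rat_independent_mod {0} {..<n} x"
  shows "td ((\<lambda>i. E (x i)) ` {..<n} \<union> (\<lambda>i. E (p * x i)) ` {..<n}) {p} \<ge> enat n"
proof (rule ccontr)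
  assume td: "\<not> ?thesis"
  \<comment> \<open>Both families in one list: index \<open>l\<close> stands for \<open>x l\<close>,
    index \<open>n + l\<close> for \<open>p * x l\<close>.\<close>
  define b where "b j = (if j < n then x j else p * x (j - n))" for j
  have b: "b l = x l" "b (n + l) = p * x l" if "l < n" for l using that by (simp_all add: b_def)
  define J where "J = {..<n + n}"
  have J: "finite J" by (simp add: J_def)
  define K where "K = exp_consts (b ` J)"
  note R = is_subfield_subring[OF is_subfield_exp_consts[of "b ` J", folded K_def]]
  have pK: "p \<notin> K" using exp_algebraic_if_exp_const[OF J] p unfolding K_def by blast
  then have tr: "\<not> algebraic_over K p" using exp_consts_algebraically_closed unfolding K_def by blast
  obtain D0 where D0: "D0 \<in> exp_derivs (b ` J)" "D0 p \<noteq> 0" using pK unfolding K_def exp_consts_def by blast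
  have D0b: "ldiff D0 (b j) = 0" if "j \<in> J" for j using exp_derivsD(2)[OF D0(1)] that by blast
  have D0': "ldiff D0 (x i) = 0" "ldiff D0 (p * x i) = 0" if "i < n" for i
    using D0b[of i] D0b[of "n + i"] b[OF that] that by (simp_all add: J_def)
  obtain g where g: "\<exists>i<n. g i \<noteq> 0"
    and rel: "\<And>D. derivation D \<Longrightarrow> (\<Sum>i<n. g i * (ldiff D (p * x i) - p * ldiff D (x i))) = 0"
    using ldiff_relation_if_td_less[OF td exp_derivsD(1)[OF D0(1)] D0(2) D0'] by blast
  obtain I and Q :: "nat \<Rightarrow> nat \<Rightarrow> rat" where I: "I \<subseteq> J"
    and Q: "\<And>j. j \<in> J \<Longrightarrow> b j - (\<Sum>i\<in>I. of_rat (Q j i) * b i) \<in> exp_consts (b ` J)"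
    and "\<And>i j. i \<in> I \<Longrightarrow> j \<in> I \<Longrightarrow> Q j i = (if i = j then 1 else 0)"
    and Qrel: "\<And>f i. \<forall>D\<in>derivs_over (exp_consts (b ` J)). (\<Sum>j\<in>J. f j * ldiff D (b j)) = 0 \<Longrightarrow>
      i \<in> I \<Longrightarrow> (\<Sum>j\<in>J. f j * of_rat (Q j i)) = 0"
    by (rule ldiff_relations[OF J, of b]) (rule that)
  define f where "f j = (if j < n then - p * g j else g (j - n))" for j
  have f: "f l = - p * g l" "f (n + l) = g l" if "l < n" for l using that by (simp_all add: f_def)
  \<comment> \<open>By Ax's theorem \<open>g\<close> solves a linear system with coefficients in
    \<open>\<rat>[p]\<close>. It therefore also has a nonzero solution \<open>h\<close> with entries
    in \<open>\<rat>[p]\<close>.\<close>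
  have gQ: "(\<Sum>l<n. (of_rat (Q (n + l) i) - p * of_rat (Q l i)) * g l) = 0" if i: "i \<in> I" for i
  proof -
    have "\<forall>D\<in>derivs_over (exp_consts (b ` J)). (\<Sum>j\<in>J. f j * ldiff D (b j)) = 0"
    proof
      fix D assume "D \<in> derivs_over (exp_consts (b ` J))"
      then have "(\<Sum>i<n. g i * (ldiff D (p * x i) - p * ldiff D (x i))) = 0" by (intro rel) (simp add: derivs_over_def)
      moreover have "(\<Sum>j\<in>J. f j * ldiff D (b j)) =
          (\<Sum>l<n. - p * g l * ldiff D (x l)) + (\<Sum>l<n. g l * ldiff D (p * x l))"
        unfolding J_def sum_lessThan_add by (simp add: b f)
      ultimately show "(\<Sum>j\<in>J. f j * ldiff D (b j)) = 0"
        by (simp add: sum.distrib[symmetric] algebra_simps)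
    qed
    from Qrel[OF this i] have "(\<Sum>j\<in>J. f j * of_rat (Q j i)) = 0" .
    moreover have "(\<Sum>j\<in>J. f j * of_rat (Q j i)) =
        (\<Sum>l<n. - p * g l * of_rat (Q l i)) + (\<Sum>l<n. g l * of_rat (Q (n + l) i))"
      unfolding J_def sum_lessThan_add by (simp add: f)
    ultimately show ?thesis
      by (simp add: sum.distrib[symmetric] left_diff_distrib right_diff_distrib sum_subtractf sum_negf mult_ac)
  qed
  have Rats: "subring (\<rat> :: 'a set)" by (auto simp: subring_def)
  have "\<exists>h. (\<forall>l<n. h l \<in> adjoin \<rat> p) \<and> (\<exists>l<n. h l \<noteq> 0) \<and>
      (\<forall>r\<in>(\<lambda>i l. of_rat (Q (n + l) i) - p * of_rat (Q l i)) ` I. (\<Sum>l<n. r l * h l) = 0)"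
  proof (rule kernel_over_subring[OF subring_adjoin[OF Rats] _ g])
    fix r l assume "r \<in> (\<lambda>i l. of_rat (Q (n + l) i) - p * of_rat (Q l i)) ` I" "l < n"
    moreover have "of_rat q \<in> adjoin \<rat> p" for q using adjoin_superset[OF Rats] Rats_of_rat by blast
    ultimately show "r l \<in> adjoin \<rat> p"
      using adjoin_mem[OF Rats]
      by (auto intro!: subring_diff[OF subring_adjoin[OF Rats]] subring_mult[OF subring_adjoin[OF Rats]])
  qed (use gQ in auto)
  then obtain h where h: "\<And>l. l < n \<Longrightarrow> h l \<in> adjoin \<rat> p" "\<exists>l<n. h l \<noteq> 0"
    and hQ: "\<And>i. i \<in> I \<Longrightarrow> (\<Sum>l<n. (of_rat (Q (n + l) i) - p * of_rat (Q l i)) * h l) = 0" by auto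
  have "\<forall>l. \<exists>u. l < n \<longrightarrow> u \<in> polys_over \<rat> \<and> h l = poly u p" using h(1) by (auto simp: adjoin_def)
  then obtain u where u: "\<And>l. l < n \<Longrightarrow> u l \<in> polys_over \<rat>" "\<And>l. l < n \<Longrightarrow> h l = poly (u l) p" by metis
  \<comment> \<open>Coefficients of \<open>T * u l\<close>: multiplication of \<open>h l\<close> by
    \<open>p\<close> becomes a shift.\<close>
  define sh where "sh l e = coeff (pCons 0 (u l)) e" for l e
  have ratK: "of_rat q \<in> K" for q using is_subfield_of_rat[OF is_subfield_exp_consts] by (simp add: K_def)
  have uK: "coeff (u l) e \<in> K" "sh l e \<in> K" if "l < n" for l e
  proof -
    have *: "coeff (u l) e \<in> K" for e using u(1)[OF that] ratK unfolding polys_over_def by (metis (mono_tags, lifting) Rats_cases mem_Collect_eq)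
    then show "coeff (u l) e \<in> K" "sh l e \<in> K"
      by (auto simp: sh_def coeff_pCons subring_0[OF R] split: nat.splits)
  qed
  \<comment> \<open>Since \<open>p\<close> is transcendental over \<open>K\<close>, the system for
    \<open>h\<close> holds for each power of \<open>p\<close> separately.\<close>
  have coeff_rel: "(\<Sum>l<n. of_rat (Q (n + l) i) * coeff (u l) e - of_rat (Q l i) * sh l e) = 0" if i: "i \<in> I" for i e
  proof -
    define Z where "Z = (\<Sum>l<n. smult (of_rat (Q (n + l) i)) (u l) - smult (of_rat (Q l i)) (pCons 0 (u l)))"
    have cZ: "coeff Z e = (\<Sum>l<n. of_rat (Q (n + l) i) * coeff (u l) e - of_rat (Q l i) * sh l e)" for e
      by (simp add: Z_def sh_def coeff_sum del: smult_pCons)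
    have "coeff Z e \<in> K" for e
      unfolding cZ by (intro subring_sum[OF R] subring_diff[OF R] subring_mult[OF R] ratK uK) auto
    then have "Z \<in> polys_over K" by (simp add: polys_over_def)
    moreover have "poly Z p = (\<Sum>l<n. (of_rat (Q (n + l) i) - p * of_rat (Q l i)) * h l)"
      using u(2) by (simp add: Z_def poly_sum algebra_simps)
    ultimately have "Z = 0" using tr hQ[OF i] by (auto simp: algebraic_over_def)
    then show ?thesis using cZ[of e] by simp
  qed
  define X where "X = (\<Sum>l<n. smult (x l) (u l))"
  define k where "k j = b j - (\<Sum>i\<in>I. of_rat (Q j i) * b i)" for j
  have kK: "k j \<in> K" if "j \<in> J" for j using Q[OF that] by (simp add: k_def K_def)
  \<comment> \<open>The coefficient of \<open>T ^ e\<close> pairs \<open>p * x l\<close> with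
    \<open>u l\<close> and \<open>x l\<close> with its shift. Expanding both in the basis modulo
    \<open>K\<close>, \<open>coeff_rel\<close> removes the basis part and the remainders
    \<open>k\<close> stay.\<close>
  have "[:p, - 1:] * X \<in> polys_over K"
    unfolding polys_over_def
  proof safe
    fix e
    have "coeff ([:p, - 1:] * X) e = (\<Sum>l<n. p * x l * coeff (u l) e - x l * sh l e)"
      by (cases e) (simp_all add: X_def sh_def coeff_sum sum_distrib_left sum_subtractf right_diff_distrib mult_ac)
    also have "\<dots> = (\<Sum>l<n. (k (n + l) * coeff (u l) e - k l * sh l e)
        + (\<Sum>i\<in>I. (of_rat (Q (n + l) i) * coeff (u l) e - of_rat (Q l i) * sh l e) * b i))"
    proof (rule sum.cong[OF refl])
      fix l assume "l \<in> {..<n}"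
      then have "p * x l = k (n + l) + (\<Sum>i\<in>I. of_rat (Q (n + l) i) * b i)" "x l = k l + (\<Sum>i\<in>I. of_rat (Q l i) * b i)"
        using b by (simp_all add: k_def)
      then show "p * x l * coeff (u l) e - x l * sh l e = (k (n + l) * coeff (u l) e - k l * sh l e)
        + (\<Sum>i\<in>I. (of_rat (Q (n + l) i) * coeff (u l) e - of_rat (Q l i) * sh l e) * b i)"
        by (simp only: distrib_right left_diff_distrib sum_distrib_right sum_subtractf) (simp add: mult_ac)
    qed
    also have "\<dots> = (\<Sum>l<n. k (n + l) * coeff (u l) e - k l * sh l e) +
        (\<Sum>i\<in>I. (\<Sum>l<n. of_rat (Q (n + l) i) * coeff (u l) e - of_rat (Q l i) * sh l e) * b i)"
      by (simp only: sum.distrib sum_distrib_right sum.swap[of _ I])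
    also have "\<dots> = (\<Sum>l<n. k (n + l) * coeff (u l) e - k l * sh l e)" using coeff_rel by simp
    also have "\<dots> \<in> K"
      by (intro subring_sum[OF R] subring_diff[OF R] subring_mult[OF R] kK uK) (auto simp: J_def)
    finally show "coeff ([:p, - 1:] * X) e \<in> K" .
  qed
  moreover have "poly ([:p, - 1:] * X) p = 0" by simp
  ultimately have "[:p, - 1:] * X = 0" using tr unfolding algebraic_over_def by blast
  then have "X = 0" by (metis mult_eq_0_iff one_neq_neg_one pCons_eq_0_iff zero_neq_neg_one)
  \<comment> \<open>Every coefficient of \<open>X = 0\<close> is a rational relation between the
    \<open>x l\<close>.\<close>
  have "u l = 0" if l: "l < n" for l
  proof (rule poly_eqI)
    fix e
    have "\<forall>l. \<exists>q. l < n \<longrightarrow> coeff (u l) e = of_rat q" using u(1) unfolding polys_over_def by (auto elim!: Rats_cases)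
    then obtain q where q: "\<And>l. l < n \<Longrightarrow> coeff (u l) e = of_rat (q l)" by metis
    have "(\<Sum>l<n. of_rat (q l) * x l) = coeff X e" using q by (simp add: X_def coeff_sum mult.commute)
    then have "\<forall>l\<in>{..<n}. q l = 0" using x \<open>X = 0\<close> by (auto simp: rat_independent_mod_def)
    then show "coeff (u l) e = coeff 0 e" using q l by simp
  qed
  then show False using h(2) u(2) by auto
qed

end

theorem theorem1p2:
  fixes E :: "'a::field_char_0 \<Rightarrow> 'a" and p :: 'a and n :: nat and x :: "nat \<Rightarrow> 'a"
  assumes "exponential_field E"
    and "exp_transcendental E p"
    and "mult_independent n (\<lambda>i. E (x i))"
  shows "td ((\<lambda>i. E (x i)) ` {..<n} \<union> (\<lambda>i. E (p * x i)) ` {..<n}) {p} \<ge> enat n"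
proof -
  interpret exponential_field E by (rule assms(1))
  show ?thesis
    by (rule td_exp_transcendental_power[OF assms(2) rat_independent_if_mult_independent[OF assms(3)]])
qed

end
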